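(* Let $G=H\rtimes L$ be an internal semidirect product with $H\lhd G$ amenable, and let $(X,Y,\mu)$ be a square-integrable $(G,H)$-transverse system with $H$-transverse measure $\sigma$. If $\xi\in\mathrm{Hom}(H,\mathbb T)$ is an eigencharacter of $Y$ with eigenfunction $\psi_\xi$ such that $$\mathrm{Stab}_L(\xi)\cap\Lambda(Y)=\{e_L\},$$ then the normalized $\psi_\xi$-twisted Siegel–Radon transform $S^{\mathrm{norm}}_{\psi_\xi}=\sigma(Y)^{-1/2}\cdot S_{\psi_\xi}:{}^0\mathrm{Ind}_H^G(\xi)\to L^2(X,\mu)$ extends continuously to a unitary intertwiner (i.e. a $G$-equivariant linear isometric embedding) $S^{\mathrm{norm}}_{\psi_\xi}:\mathrm{Ind}_H^G(\xi)\to L^2(X,\mu)$.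
   Context: $G$ is a unimodular lcsc (locally compact second countable) group, $H<G$ a closed unimodular subgroup, with Haar measures $m_G,m_H$ and the $G$-invariant measure $m_{H\backslash G}$ normalized by $\int_G f\,dm_G=\int_{H\backslash G}\int_H f(hg)\,dm_H(h)\,dm_{H\backslash G}(Hg)$; here $H$ is normal and $L<G$ is a closed subgroup with $G=H\rtimes L$. $X$ is a standard Borel $G$-space, $\mu$ a $G$-invariant Borel probability measure, $Y\subset X$ a $(G,H)$-cross section (Borel, $G.Y=X$, $H.Y=Y$), with hitting time sets $Y_x=\{Hg\in H\backslash G\mid g.x\in Y\}$. Square-integrable: $\int_X|Y_x\cap K|^2d\mu(x)<\infty$ for every compact $K\subset H\backslash G$. Identifying $H\backslash G$ with $L$, $Y_x$ becomes $\{l\in L\mid l.x\in Y\}$; set $\Lambda(Y)=\bigcup_{y\in Y}Y_y\subset L$. The $H$-transverse measure $\sigma$ is the unique finite $H$-invariant Borel measure on $Y$ with $\int_X\sum_{Hg\in Y_x}\int_HF((hg)^{-1},hg.x)\,dm_H(h)\,d\mu(x)=\int_G\int_YF(g,y)\,d\sigma(y)\,dm_G(g)$ for all bounded Borel $F$ on $G\times Y$ vanishing outside $K\times Y$ for some compact $K\subset G$. $\mathrm{Hom}(H,\mathbb T)$ denotes the unitary characters of $H$; $L$ acts on it by $(l.\eta)(h)=\eta(l^{-1}hl)$ and $\mathrm{Stab}_L(\xi)$ is the stabilizer of $\xi$. $\xi$ is an eigencharacter of $Y$ with eigenfunction $\psi_\xi$ if $\psi_\xi:Y_0\to\mathbb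 C$ is a nonzero bounded Borel function on an $H$-invariant $\sigma$-conull set $Y_0\subset Y$ with $\psi_\xi(h^{-1}.y)=\xi(h)\psi_\xi(y)$ for all $h\in H,y\in Y_0$. ${}^0\mathrm{Ind}_H^G(\xi)$ is the space of $f\in C(G)$ with $f(hg)=\xi(h)f(g)$ for $h\in H$, $g\in G$, and $|f|\in C_c(H\backslash G)$; $\mathrm{Ind}_H^G(\xi)$ is its completion for $\langle f_1,f_2\rangle=\int_{H\backslash G}f_1\overline{f_2}\,dm_{H\backslash G}$, with $G$-action $(g.f)(x)=f(xg)$. $S_{\psi_\xi}f(x)=\sum_{Hg\in Y_x}f(g)\psi_\xi(g.x)$ (defined $\mu$-a.e.). $G$ acts on $L^2(X,\mu)$ by $(g.\phi)(x)=\phi(g^{-1}.x)$.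
   Formalization: The formal statement adds the normalization that the integral of |ψ_ξ|² over Y_0 with respect to σ equals σ(Y); for an eigenfunction that is only nonzero and bounded the isometry claim is false (replace ψ_ξ by 2ψ_ξ), and this condition is exactly what an isometry requires. *)

theory Defs
  imports "HOL-Probability.Probability"
begin

section \<open>Locally compact second countable groups\<close>

text \<open>Groups are written additively although they need not be commutative: \<^class>\<open>group_add\<close> is
  the class of arbitrary groups. So \<open>g + h\<close> is the product \<open>gh\<close>, \<open>- g\<close> is the inverse, and
  \<open>0\<close> is the identity.\<close>

class lcsc_group_add = topological_group_add + t2_space + second_countable_topology +
  assumes locally_compact: "\<exists>U K. open U \<and> compact K \<and> x \<in> U \<and> U \<subseteq> K"

definition is_subgroup :: "'g::group_add set \<Rightarrow> bool" where
  "is_subgroup S \<longleftrightarrow> 0 \<in> S \<and> (\<forall>a\<in>S. \<forall>b\<in>S. a + b \<in> S) \<and> (\<forall>a\<in>S. - a \<in> S)"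

definition is_normal_subgroup :: "'g::group_add set \<Rightarrow> bool" where
  "is_normal_subgroup H \<longleftrightarrow> is_subgroup H \<and> (\<forall>g. \<forall>h\<in>H. g + h - g \<in> H)"

definition internal_semidirect :: "'g::group_add set \<Rightarrow> 'g set \<Rightarrow> bool" where
  "internal_semidirect H L \<longleftrightarrow>
     is_normal_subgroup H \<and> is_subgroup L \<and> H \<inter> L = {0} \<and>
     (\<forall>g. \<exists>h\<in>H. \<exists>l\<in>L. g = h + l)"

text \<open>Left Haar measures on a closed subgroup \<open>S\<close>. Regularity is automatic, since \<open>S\<close> is locally
  compact and second countable.\<close>

definition haar_measure :: "'g::lcsc_group_add set \<Rightarrow> 'g measure \<Rightarrow> bool" where
  "haar_measure S m \<longleftrightarrow>
     space m = S \<and> sets m = sets (restrict_space borel S) \<and>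
     (\<forall>K. compact K \<and> K \<subseteq> S \<longrightarrow> emeasure m K < \<infinity>) \<and>
     emeasure m S \<noteq> 0 \<and>
     (\<forall>g\<in>S. \<forall>A\<in>sets m. emeasure m ((\<lambda>x. g + x) ` A) = emeasure m A)"

definition unimodular :: "'g::lcsc_group_add set \<Rightarrow> bool" where
  "unimodular S \<longleftrightarrow>
     (\<forall>m. haar_measure S m \<longrightarrow>
        (\<forall>g\<in>S. \<forall>A\<in>sets m. emeasure m ((\<lambda>x. x + g) ` A) = emeasure m A))"

definition bounded_borel :: "'g measure \<Rightarrow> ('g \<Rightarrow> real) set" where
  "bounded_borel m = {f \<in> borel_measurable m. \<exists>B. \<forall>x\<in>space m. \<bar>f x\<bar> \<le> B}"

text \<open>Amenability of \<open>S\<close> with Haar measure \<open>m\<close>: there is a left-invariant mean on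
  \<open>L\<^sup>\<infinity>(S, m)\<close>. By linearity, positivity for a.e. nonnegative functions
  makes the mean depend only on the a.e. class.\<close>

definition amenable :: "'g::lcsc_group_add set \<Rightarrow> 'g measure \<Rightarrow> bool" where
  "amenable S m \<longleftrightarrow> (\<exists>M :: ('g \<Rightarrow> real) \<Rightarrow> real.
     (\<forall>f\<in>bounded_borel m. \<forall>f'\<in>bounded_borel m. M (\<lambda>x. f x + f' x) = M f + M f') \<and>
     (\<forall>f\<in>bounded_borel m. \<forall>a. M (\<lambda>x. a * f x) = a * M f) \<and>
     (\<forall>f\<in>bounded_borel m. (AE x in m. 0 \<le> f x) \<longrightarrow> 0 \<le> M f) \<and>
     M (\<lambda>_. 1) = 1 \<and>
     (\<forall>f\<in>bounded_borel m. \<forall>s\<in>S. M (\<lambda>x. f (s + x)) = M f))"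

section \<open>The coset space\<close>

definition coset :: "'g::group_add set \<Rightarrow> 'g \<Rightarrow> 'g set" where
  "coset H g = (\<lambda>h. h + g) ` H"

definition cosets :: "'g::group_add set \<Rightarrow> 'g set set" where
  "cosets H = range (coset H)"

text \<open>An arbitrary representative. It is only used in expressions that do not depend on
  the choice.\<close>

definition rep :: "'g set \<Rightarrow> 'g" where
  "rep c = (SOME g. g \<in> c)"

definition coset_topology :: "'g::lcsc_group_add set \<Rightarrow> 'g set topology" where
  "coset_topology H = topology (\<lambda>U. U \<subseteq> cosets H \<and> open (coset H -` U))"

lemma openin_coset_topology:
  "openin (coset_topology H) U \<longleftrightarrow> U \<subseteq> cosets H \<and> open (coset H -` U)"
proof -
  have "istopology (\<lambda>U. U \<subseteq> cosets H \<and> open (coset H -` U))"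
    unfolding istopology_def by (auto simp: vimage_Union intro!: open_Int)
  then show ?thesis
    unfolding coset_topology_def by simp
qed

lemma topspace_coset_topology: "topspace (coset_topology H) = cosets H"
proof -
  have "coset H -` cosets H = UNIV"
    by (auto simp: cosets_def)
  then have "openin (coset_topology H) (cosets H)"
    by (simp add: openin_coset_topology)
  then show ?thesis
    by (metis openin_coset_topology openin_subset openin_topspace subset_antisym)
qed

definition coset_borel :: "'g::lcsc_group_add set \<Rightarrow> 'g set measure" where
  "coset_borel H = sigma (cosets H) {U. openin (coset_topology H) U}"

text \<open>The \<open>G\<close>-invariant measure on \<open>H\G\<close>, normalized by Weil's formula for nonnegative
  Borel functions (which is equivalent to the formula on \<open>C\<^sub>c(G)\<close>).\<close>

definition quotient_measure ::
    "'g::lcsc_group_add set \<Rightarrow> 'g measure \<Rightarrow> 'g measure \<Rightarrow> 'g set measure \<Rightarrow> bool" where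
  "quotient_measure H mG mH mHG \<longleftrightarrow>
     space mHG = cosets H \<and> sets mHG = sets (coset_borel H) \<and>
     (\<forall>g. \<forall>A\<in>sets mHG. emeasure mHG ((\<lambda>c. (\<lambda>x. x + g) ` c) ` A) = emeasure mHG A) \<and>
     (\<forall>f\<in>borel_measurable mG.
        (\<integral>\<^sup>+ g. f g \<partial>mG) = (\<integral>\<^sup>+ c. (\<integral>\<^sup>+ h. f (h + rep c) \<partial>mH) \<partial>mHG))"

section \<open>Transverse systems\<close>

text \<open>The \<open>\<sigma>\<close>-algebra of \<open>M\<close> is the Borel \<open>\<sigma>\<close>-algebra of a Polish topology.\<close>

definition standard_borel :: "'x measure \<Rightarrow> bool" where
  "standard_borel M \<longleftrightarrow>
     (\<exists>T. completely_metrizable_space T \<and> second_countable T \<and> topspace T = space M \<and>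
          sets M = sigma_sets (topspace T) {U. openin T U})"

definition borel_G_space :: "('g::lcsc_group_add \<Rightarrow> 'x \<Rightarrow> 'x) \<Rightarrow> 'x measure \<Rightarrow> bool" where
  "borel_G_space act M \<longleftrightarrow>
     standard_borel M \<and>
     (\<lambda>(g, x). act g x) \<in> measurable (borel \<Otimes>\<^sub>M M) M \<and>
     (\<forall>x\<in>space M. act 0 x = x \<and> (\<forall>g h. act (g + h) x = act g (act h x)))"

definition invariant_probability :: "('g::lcsc_group_add \<Rightarrow> 'x \<Rightarrow> 'x) \<Rightarrow> 'x measure \<Rightarrow> bool" where
  "invariant_probability act \<mu> \<longleftrightarrow> prob_space \<mu> \<and> (\<forall>g. distr \<mu> \<mu> (act g) = \<mu>)"

definition cross_section ::
    "('g::lcsc_group_add \<Rightarrow> 'x \<Rightarrow> 'x) \<Rightarrow> 'x measure \<Rightarrow> 'g set \<Rightarrow> 'x set \<Rightarrow> bool" where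
  "cross_section act \<mu> H Y \<longleftrightarrow>
     Y \<in> sets \<mu> \<and> (\<Union>g. act g ` Y) = space \<mu> \<and> (\<Union>h\<in>H. act h ` Y) = Y"

definition hitting :: "('g::group_add \<Rightarrow> 'x \<Rightarrow> 'x) \<Rightarrow> 'g set \<Rightarrow> 'x set \<Rightarrow> 'x \<Rightarrow> 'g set set" where
  "hitting act H Y x = {coset H g | g. act g x \<in> Y}"

text \<open>Square-integrability: \<open>x \<mapsto> |Y\<^sub>x \<inter> K|\<close> lies in \<open>L\<^sup>2(X, \<mu>)\<close> for compact \<open>K\<close>. The sets
  \<open>{x. |Y\<^sub>x \<inter> K| \<ge> n}\<close> are projections of Borel sets, hence analytic, so measurability holds with
  respect to the completion of \<open>\<mu>\<close> (and is automatic there), but not necessarily for the Borel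
  \<open>\<sigma>\<close>-algebra itself. Without it, \<^const>\<open>nn_integral\<close> would be a lower integral.\<close>

definition square_integrable_system ::
    "('g::lcsc_group_add \<Rightarrow> 'x \<Rightarrow> 'x) \<Rightarrow> 'x measure \<Rightarrow> 'g set \<Rightarrow> 'x set \<Rightarrow> bool" where
  "square_integrable_system act \<mu> H Y \<longleftrightarrow>
     (\<forall>K. compactin (coset_topology H) K \<longrightarrow>
        (\<lambda>x. emeasure (count_space UNIV) (hitting act H Y x \<inter> K))
          \<in> borel_measurable (completion \<mu>) \<and>
        (\<integral>\<^sup>+ x. (emeasure (count_space UNIV) (hitting act H Y x \<inter> K))\<^sup>2 \<partial>completion \<mu>) < \<infinity>)"

text \<open>The integral over \<open>X\<close> is taken with respect to the completion of \<open>\<mu>\<close> for the same reason.\<close>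

definition transverse_measure ::
    "('g::lcsc_group_add \<Rightarrow> 'x \<Rightarrow> 'x) \<Rightarrow> 'x measure \<Rightarrow> 'g set \<Rightarrow> 'x set \<Rightarrow>
     'g measure \<Rightarrow> 'g measure \<Rightarrow> 'x measure \<Rightarrow> bool" where
  "transverse_measure act \<mu> H Y mG mH \<sigma> \<longleftrightarrow>
     space \<sigma> = Y \<and> sets \<sigma> = sets (restrict_space \<mu> Y) \<and> finite_measure \<sigma> \<and>
     (\<forall>h\<in>H. distr \<sigma> \<sigma> (act h) = \<sigma>) \<and>
     (\<forall>F :: 'g \<times> 'x \<Rightarrow> complex.
        F \<in> borel_measurable (borel \<Otimes>\<^sub>M restrict_space \<mu> Y) \<and>
        (\<exists>B. \<forall>g. \<forall>y\<in>Y. cmod (F (g, y)) \<le> B) \<and>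
        (\<exists>K. compact K \<and> (\<forall>g. \<forall>y\<in>Y. g \<notin> K \<longrightarrow> F (g, y) = 0)) \<longrightarrow>
        (LINT x|completion \<mu>. (\<Sum>\<^sub>\<infinity>c\<in>hitting act H Y x.
            LINT h|mH. F (- (h + rep c), act (h + rep c) x)))
        = (LINT g|mG. LINT y|\<sigma>. F (g, y)))"

text \<open>\<open>\<Lambda>(Y)\<close> as a subset of \<open>L\<close>, via the identification \<open>l \<mapsto> Hl\<close> of \<open>L\<close> with \<open>H\G\<close>.\<close>

definition return_set ::
    "('g::group_add \<Rightarrow> 'x \<Rightarrow> 'x) \<Rightarrow> 'g set \<Rightarrow> 'g set \<Rightarrow> 'x set \<Rightarrow> 'g set" where
  "return_set act H L Y = {l \<in> L. \<exists>y\<in>Y. coset H l \<in> hitting act H Y y}"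

section \<open>Characters and eigenfunctions\<close>

definition unitary_character :: "'g::lcsc_group_add set \<Rightarrow> ('g \<Rightarrow> complex) \<Rightarrow> bool" where
  "unitary_character H \<xi> \<longleftrightarrow>
     continuous_on H \<xi> \<and> (\<forall>h\<in>H. cmod (\<xi> h) = 1) \<and>
     (\<forall>h\<in>H. \<forall>h'\<in>H. \<xi> (h + h') = \<xi> h * \<xi> h')"

definition character_stabilizer ::
    "'g::group_add set \<Rightarrow> 'g set \<Rightarrow> ('g \<Rightarrow> complex) \<Rightarrow> 'g set" where
  "character_stabilizer H L \<xi> = {l \<in> L. \<forall>h\<in>H. \<xi> (- l + h + l) = \<xi> h}"

text \<open>\<open>\<psi>\<close> is a function on \<open>Y0\<close>; its values elsewhere are irrelevant. It is nonzero as an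
  element of \<open>L\<^sup>\<infinity>(Y, \<sigma>)\<close>.\<close>

definition eigenfunction ::
    "('g::lcsc_group_add \<Rightarrow> 'x \<Rightarrow> 'x) \<Rightarrow> 'x measure \<Rightarrow> 'g set \<Rightarrow> ('g \<Rightarrow> complex) \<Rightarrow>
     'x set \<Rightarrow> ('x \<Rightarrow> complex) \<Rightarrow> bool" where
  "eigenfunction act \<sigma> H \<xi> Y0 \<psi> \<longleftrightarrow>
     Y0 \<in> sets \<sigma> \<and> (AE y in \<sigma>. y \<in> Y0) \<and> (\<forall>h\<in>H. act h ` Y0 \<subseteq> Y0) \<and>
     \<psi> \<in> borel_measurable (restrict_space \<sigma> Y0) \<and>
     (\<exists>B. \<forall>y\<in>Y0. cmod (\<psi> y) \<le> B) \<and>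
     \<not> (AE y in \<sigma>. y \<in> Y0 \<longrightarrow> \<psi> y = 0) \<and>
     (\<forall>h\<in>H. \<forall>y\<in>Y0. \<psi> (act (- h) y) = \<xi> h * \<psi> y)"

section \<open>Induced representations\<close>

definition ind0 :: "'g::lcsc_group_add set \<Rightarrow> ('g \<Rightarrow> complex) \<Rightarrow> ('g \<Rightarrow> complex) set" where
  "ind0 H \<xi> = {f. continuous_on UNIV f \<and>
     (\<forall>h\<in>H. \<forall>g. f (h + g) = \<xi> h * f g) \<and>
     (\<exists>K. compactin (coset_topology H) K \<and> (\<forall>g. coset H g \<notin> K \<longrightarrow> f g = 0))}"

definition ind0_inner ::
    "'g set measure \<Rightarrow> ('g \<Rightarrow> complex) \<Rightarrow> ('g \<Rightarrow> complex) \<Rightarrow> complex" where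
  "ind0_inner mHG f1 f2 = (LINT c|mHG. f1 (rep c) * cnj (f2 (rep c)))"

definition ind0_dist ::
    "'g set measure \<Rightarrow> ('g \<Rightarrow> complex) \<Rightarrow> ('g \<Rightarrow> complex) \<Rightarrow> real" where
  "ind0_dist mHG f1 f2 =
     sqrt (Re (ind0_inner mHG (\<lambda>g. f1 g - f2 g) (\<lambda>g. f1 g - f2 g)))"

text \<open>The completion of \<^const>\<open>ind0\<close> consists of the Cauchy sequences in \<^const>\<open>ind0\<close> modulo
  sequences converging to zero. Elements are represented by Cauchy sequences, equality is
  \<open>ind_eq\<close>, \<open>f\<close> is embedded as the constant sequence, and the linear structure and the action
  of \<open>G\<close> are termwise.\<close>

definition ind ::
    "'g::lcsc_group_add set \<Rightarrow> 'g set measure \<Rightarrow> ('g \<Rightarrow> complex) \<Rightarrow> (nat \<Rightarrow> 'g \<Rightarrow> complex) set" where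
  "ind H mHG \<xi> = {u. (\<forall>n. u n \<in> ind0 H \<xi>) \<and>
     (\<forall>e>0. \<exists>N. \<forall>m\<ge>N. \<forall>n\<ge>N. ind0_dist mHG (u m) (u n) < e)}"

definition ind_eq ::
    "'g set measure \<Rightarrow> (nat \<Rightarrow> 'g \<Rightarrow> complex) \<Rightarrow> (nat \<Rightarrow> 'g \<Rightarrow> complex) \<Rightarrow> bool" where
  "ind_eq mHG u v \<longleftrightarrow> (\<lambda>n. ind0_dist mHG (u n) (v n)) \<longlonglongrightarrow> 0"

definition ind_inner ::
    "'g set measure \<Rightarrow> (nat \<Rightarrow> 'g \<Rightarrow> complex) \<Rightarrow> (nat \<Rightarrow> 'g \<Rightarrow> complex) \<Rightarrow> complex" where
  "ind_inner mHG u v = lim (\<lambda>n. ind0_inner mHG (u n) (v n))"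

definition ind_act :: "'g::group_add \<Rightarrow> (nat \<Rightarrow> 'g \<Rightarrow> complex) \<Rightarrow> nat \<Rightarrow> 'g \<Rightarrow> complex" where
  "ind_act g u = (\<lambda>n x. u n (x + g))"

section \<open>Intertwiners into \<open>L\<^sup>2(X, \<mu>)\<close>\<close>

text \<open>Elements of \<open>L\<^sup>2(X, \<mu>)\<close> are represented by functions; equality is equality a.e.\<close>

definition L2 :: "'x measure \<Rightarrow> ('x \<Rightarrow> complex) set" where
  "L2 \<mu> = {\<phi> \<in> borel_measurable \<mu>. integrable \<mu> (\<lambda>x. (cmod (\<phi> x))\<^sup>2)}"

definition L2_inner :: "'x measure \<Rightarrow> ('x \<Rightarrow> complex) \<Rightarrow> ('x \<Rightarrow> complex) \<Rightarrow> complex" where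
  "L2_inner \<mu> \<phi>1 \<phi>2 = (LINT x|\<mu>. \<phi>1 x * cnj (\<phi>2 x))"

text \<open>A well-defined map from the completion to \<open>L\<^sup>2(X, \<mu>)\<close> that is linear, isometric and
  \<open>G\<close>-equivariant.\<close>

definition unitary_intertwiner ::
    "('g::lcsc_group_add \<Rightarrow> 'x \<Rightarrow> 'x) \<Rightarrow> 'x measure \<Rightarrow> 'g set \<Rightarrow> 'g set measure \<Rightarrow>
     ('g \<Rightarrow> complex) \<Rightarrow> ((nat \<Rightarrow> 'g \<Rightarrow> complex) \<Rightarrow> 'x \<Rightarrow> complex) \<Rightarrow> bool" where
  "unitary_intertwiner act \<mu> H mHG \<xi> T \<longleftrightarrow>
     (\<forall>u\<in>ind H mHG \<xi>. T u \<in> L2 \<mu>) \<and>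
     (\<forall>u\<in>ind H mHG \<xi>. \<forall>v\<in>ind H mHG \<xi>. ind_eq mHG u v \<longrightarrow> (AE x in \<mu>. T u x = T v x)) \<and>
     (\<forall>u\<in>ind H mHG \<xi>. \<forall>v\<in>ind H mHG \<xi>. \<forall>a b.
        AE x in \<mu>. T (\<lambda>n g. a * u n g + b * v n g) x = a * T u x + b * T v x) \<and>
     (\<forall>u\<in>ind H mHG \<xi>. \<forall>v\<in>ind H mHG \<xi>. L2_inner \<mu> (T u) (T v) = ind_inner mHG u v) \<and>
     (\<forall>u\<in>ind H mHG \<xi>. \<forall>g. AE x in \<mu>. T (ind_act g u) x = T u (act (- g) x))"

definition siegel_radon ::
    "('g::group_add \<Rightarrow> 'x \<Rightarrow> 'x) \<Rightarrow> 'g set \<Rightarrow> 'x set \<Rightarrow> ('x \<Rightarrow> complex) \<Rightarrow>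
     ('g \<Rightarrow> complex) \<Rightarrow> 'x \<Rightarrow> complex" where
  "siegel_radon act H Y \<psi> f x = (\<Sum>\<^sub>\<infinity>c\<in>hitting act H Y x. f (rep c) * \<psi> (act (rep c) x))"

text \<open>Dividing by \<open>\<sigma>(Y)\<^sup>1\<^sup>/\<^sup>2\<close> is the right scaling for eigenfunctions normalized by
  \<open>\<integral>|\<psi>|\<^sup>2 d\<sigma> = \<sigma>(Y)\<close>, for example those of modulus one.\<close>

definition siegel_radon_norm ::
    "('g::group_add \<Rightarrow> 'x \<Rightarrow> 'x) \<Rightarrow> 'g set \<Rightarrow> 'x set \<Rightarrow> 'x measure \<Rightarrow> ('x \<Rightarrow> complex) \<Rightarrow>
     ('g \<Rightarrow> complex) \<Rightarrow> 'x \<Rightarrow> complex" where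
  "siegel_radon_norm act H Y \<sigma> \<psi> f x =
     complex_of_real (measure \<sigma> Y powr (- 1 / 2)) * siegel_radon act H Y \<psi> f x"

end

theory Submission
  imports Defs
begin

text \<open>By the transverse formula, \<open>\<langle>S f\<^sub>1, S f\<^sub>2\<rangle>\<close> is the integral over \<open>G \<times> Y\<close> of a sum over
  \<open>l \<in> L\<close> with \<open>l.y \<in> Y\<close>. Replacing \<open>y\<close> by \<open>h\<inverse>.y\<close> with \<open>h \<in> H\<close> multiplies the summand at \<open>l\<close> by a character of
  \<open>H\<close>, which is nontrivial for \<open>l \<noteq> e\<close> because \<open>l\<close> does not stabilize \<open>\<xi>\<close>. Since \<open>\<sigma>\<close> is \<open>H\<close>-invariant, one may
  average over \<open>H\<close>, and only the term \<open>l = e\<close> survives; it gives \<open>\<sigma>(Y) \<langle>f\<^sub>1, f\<^sub>2\<rangle>\<close>. The averages are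
  explicit: the \<open>k\<close>-th step takes the mean of a function and its translate by \<open>h\<^sub>k\<close>, where the sequence
  \<open>h\<close> visits each point of a countable dense subset of \<open>H\<close> infinitely often. A character \<open>\<chi>\<close> is thereby
  multiplied by factors \<open>(1 + \<chi>(h\<^sub>k)) / 2\<close>, whose product tends to zero unless \<open>\<chi>\<close> is trivial.\<close>

section \<open>Square-integrable functions\<close>

text \<open>The transverse formula accepts only bounded functions with compact support in
  \<open>G\<close>, whereas the transform sums over cosets and \<open>S f2\<close> is unbounded. A
  weight \<open>\<rho>\<close> on \<open>G\<close>, with integral 1 over every coset in the support,
  turns the sum into such a function. Only \<open>S f1\<close> is unfolded this way;
  \<open>cnj (S f2)\<close> is carried along as a factor, appears at \<open>act g y\<close>, and is
  expanded there over an index set that does not depend on \<open>g\<close>. This factor has to be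
  truncated. Truncating by the size of \<open>S f2\<close> would spoil the averaging, since that
  size changes when \<open>y\<close> moves along \<open>H\<close>. The number of hits
  \<open>N C\<close> does not change, because \<open>H\<close> is normal, and it dominates
  \<open>S f2\<close> up to a constant; dominated convergence by a multiple of its square removes
  the truncation. A second obstacle is that \<open>Y\<close> may be a null set of \<open>X\<close>:
  almost everywhere statements have to be carried from \<open>X\<close> to \<open>G\<close> times
  \<open>Y\<close> (\<open>AE_act_P\<close>) and from \<open>Y\<close> to orbits in \<open>X\<close>
  (\<open>AE_avoids_null\<close>). Stepwise means suffice as averages because they preserve the
  integral and every bound that depends on \<open>g\<close> alone, while each sum over
  \<open>l\<close> is finite almost everywhere.\<close>

lemma norm_add_square_le: "(norm (u + v))\<^sup>2 \<le> 2 * (norm u)\<^sup>2 + 2 * (norm v)\<^sup>2"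
  for u v :: "'a::real_normed_vector"
proof -
  have "(norm (u + v))\<^sup>2 \<le> (norm u + norm v)\<^sup>2"
    by (simp add: power_mono norm_triangle_ineq)
  also have "\<dots> \<le> 2 * (norm u)\<^sup>2 + 2 * (norm v)\<^sup>2"
    using sum_squares_bound[of "norm u" "norm v"] by (simp add: power2_sum)
  finally show ?thesis .
qed

lemma borel_measurable_cnj [measurable (raw)]:
  "f \<in> borel_measurable M \<Longrightarrow> (\<lambda>x. cnj (f x)) \<in> borel_measurable M"
  by (rule borel_measurable_continuous_on[OF continuous_on_cnj[OF continuous_on_id], simplified])

lemma L2_measurable [measurable_dest]: "\<phi> \<in> L2 M \<Longrightarrow> \<phi> \<in> borel_measurable M"
  by (simp add: L2_def)

lemma L2_add:
  assumes "\<phi> \<in> L2 M" "\<theta> \<in> L2 M"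
  shows "(\<lambda>x. \<phi> x + \<theta> x) \<in> L2 M"
proof -
  have [measurable]: "\<phi> \<in> borel_measurable M" "\<theta> \<in> borel_measurable M"
    using assms by (auto dest: L2_measurable)
  have "integrable M (\<lambda>x. (cmod (\<phi> x + \<theta> x))\<^sup>2)"
  proof (rule Bochner_Integration.integrable_bound)
    show "integrable M (\<lambda>x. 2 * (cmod (\<phi> x))\<^sup>2 + 2 * (cmod (\<theta> x))\<^sup>2)"
      using assms by (auto simp: L2_def)
  qed (use norm_add_square_le in auto)
  then show ?thesis by (simp add: L2_def)
qed

lemma L2_cmult:
  assumes "\<phi> \<in> L2 M"
  shows "(\<lambda>x. a * \<phi> x) \<in> L2 M"
  using assms by (auto simp: L2_def norm_mult power_mult_distrib)

lemma L2_diff: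
  assumes "\<phi> \<in> L2 M" "\<theta> \<in> L2 M"
  shows "(\<lambda>x. \<phi> x - \<theta> x) \<in> L2 M"
  using L2_add[OF assms(1) L2_cmult[OF assms(2), of "-1"]] by simp

lemma L2_inner_integrable:
  assumes "\<phi> \<in> L2 M" "\<theta> \<in> L2 M"
  shows "integrable M (\<lambda>x. \<phi> x * cnj (\<theta> x))"
proof -
  have [measurable]: "\<phi> \<in> borel_measurable M" "\<theta> \<in> borel_measurable M"
    using assms by (auto dest: L2_measurable)
  show ?thesis
  proof (rule Bochner_Integration.integrable_bound)
    show "integrable M (\<lambda>x. (cmod (\<phi> x))\<^sup>2 + (cmod (\<theta> x))\<^sup>2)"
      using assms by (auto simp: L2_def)
    have "a * b \<le> a\<^sup>2 + b\<^sup>2" if "a \<ge> 0" "b \<ge> 0" for a b :: real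
      using sum_squares_bound[of a b] mult_nonneg_nonneg[OF that] by linarith
    then show "AE x in M. norm (\<phi> x * cnj (\<theta> x)) \<le> norm ((cmod (\<phi> x))\<^sup>2 + (cmod (\<theta> x))\<^sup>2)"
      by (auto simp: norm_mult)
  qed measurable
qed

lemma L2_inner_self: "L2_inner M \<phi> \<phi> = complex_of_real (LINT x|M. (cmod (\<phi> x))\<^sup>2)"
  unfolding L2_inner_def integral_complex_of_real[symmetric]
  by (simp only: complex_norm_square)

lemma L2_Cauchy_Schwarz:
  assumes "\<phi> \<in> L2 M" "\<theta> \<in> L2 M"
  shows "(cmod (L2_inner M \<phi> \<theta>))\<^sup>2 \<le> (LINT x|M. (cmod (\<phi> x))\<^sup>2) * (LINT x|M. (cmod (\<theta> x))\<^sup>2)"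
proof -
  have [measurable]: "\<phi> \<in> borel_measurable M" "\<theta> \<in> borel_measurable M"
    using assms by (auto dest: L2_measurable)
  have sq: "(\<integral>\<^sup>+x. (ennreal (cmod (\<eta> x)))\<^sup>2 \<partial>M) = ennreal (LINT x|M. (cmod (\<eta> x))\<^sup>2)" if "\<eta> \<in> L2 M" for \<eta>
    using that by (subst nn_integral_eq_integral[symmetric]) (auto simp: L2_def ennreal_power)
  have "ennreal (cmod (L2_inner M \<phi> \<theta>)) \<le> (\<integral>\<^sup>+x. ennreal (cmod (\<phi> x)) * ennreal (cmod (\<theta> x)) \<partial>M)"
    unfolding L2_inner_def
    using integral_norm_bound_ennreal[OF L2_inner_integrable[OF assms]]
    by (simp add: norm_mult ennreal_mult)
  then have "ennreal ((cmod (L2_inner M \<phi> \<theta>))\<^sup>2)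
      \<le> (\<integral>\<^sup>+x. ennreal (cmod (\<phi> x)) * ennreal (cmod (\<theta> x)) \<partial>M)\<^sup>2"
    by (metis ennreal_power norm_ge_zero power_mono zero_le)
  also have "\<dots> \<le> (\<integral>\<^sup>+x. (ennreal (cmod (\<phi> x)))\<^sup>2 \<partial>M) * (\<integral>\<^sup>+x. (ennreal (cmod (\<theta> x)))\<^sup>2 \<partial>M)"
    by (rule Cauchy_Schwarz_nn_integral) auto
  also have "\<dots> = ennreal ((LINT x|M. (cmod (\<phi> x))\<^sup>2) * (LINT x|M. (cmod (\<theta> x))\<^sup>2))"
    using assms by (simp add: sq ennreal_mult)
  finally show ?thesis
    by (subst (asm) ennreal_le_iff) auto
qed

section \<open>Convergence and completeness in \<open>L2\<close>\<close>

definition L2_tendsto :: "'x measure \<Rightarrow> (nat \<Rightarrow> 'x \<Rightarrow> complex) \<Rightarrow> ('x \<Rightarrow> complex) \<Rightarrow> bool" where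
  "L2_tendsto M s \<phi> \<longleftrightarrow> (\<lambda>n. LINT x|M. (cmod (s n x - \<phi> x))\<^sup>2) \<longlonglongrightarrow> 0"

text \<open>Convergence is measured by squared norms throughout, and this bound with its factor 2
  stands in for the Minkowski inequality.\<close>

lemma L2_square_triangle:
  assumes "\<phi> \<in> L2 M" "\<theta> \<in> L2 M"
  shows "(LINT x|M. (cmod (\<phi> x + \<theta> x))\<^sup>2)
    \<le> 2 * (LINT x|M. (cmod (\<phi> x))\<^sup>2) + 2 * (LINT x|M. (cmod (\<theta> x))\<^sup>2)"
proof -
  have "(LINT x|M. (cmod (\<phi> x + \<theta> x))\<^sup>2) \<le> (LINT x|M. 2 * (cmod (\<phi> x))\<^sup>2 + 2 * (cmod (\<theta> x))\<^sup>2)"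
    by (rule integral_mono) (use assms L2_add[OF assms] norm_add_square_le in \<open>auto simp: L2_def\<close>)
  also have "\<dots> = 2 * (LINT x|M. (cmod (\<phi> x))\<^sup>2) + 2 * (LINT x|M. (cmod (\<theta> x))\<^sup>2)"
    using assms by (subst Bochner_Integration.integral_add) (auto simp: L2_def)
  finally show ?thesis .
qed

lemma null_sequence_sandwich:
  assumes "\<And>n. 0 \<le> (a n :: real)" "\<And>n. a n \<le> b n" "b \<longlonglongrightarrow> 0"
  shows "a \<longlonglongrightarrow> 0"
  by (rule real_tendsto_sandwich[OF _ _ tendsto_const assms(3)]) (use assms in auto)

lemma L2_tendsto_unique:
  assumes s: "\<And>n. s n \<in> L2 M" and \<phi>: "\<phi> \<in> L2 M" and \<theta>: "\<theta> \<in> L2 M"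
    and "L2_tendsto M s \<phi>" "L2_tendsto M s \<theta>"
  shows "AE x in M. \<phi> x = \<theta> x"
proof -
  let ?d = "LINT x|M. (cmod (\<phi> x - \<theta> x))\<^sup>2"
  have "?d \<le> 2 * (LINT x|M. (cmod (s n x - \<phi> x))\<^sup>2) + 2 * (LINT x|M. (cmod (s n x - \<theta> x))\<^sup>2)" for n
    using L2_square_triangle[OF L2_diff[OF \<phi> s] L2_diff[OF s \<theta>], of n n]
    by (simp add: norm_minus_commute[of "\<phi> _"])
  moreover have "(\<lambda>n. 2 * (LINT x|M. (cmod (s n x - \<phi> x))\<^sup>2) + 2 * (LINT x|M. (cmod (s n x - \<theta> x))\<^sup>2))
      \<longlonglongrightarrow> 2 * 0 + 2 * 0"
    using assms(4,5) unfolding L2_tendsto_def by (intro tendsto_intros)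
  ultimately have "?d \<le> 0"
    by (intro LIMSEQ_le_const[where X="\<lambda>n. 2 * (LINT x|M. (cmod (s n x - \<phi> x))\<^sup>2) + 2 * (LINT x|M. (cmod (s n x - \<theta> x))\<^sup>2)"]) auto
  then have "?d = 0" by (intro antisym) auto
  then have "AE x in M. (cmod (\<phi> x - \<theta> x))\<^sup>2 = 0"
    using L2_diff[OF \<phi> \<theta>] by (subst (asm) integral_nonneg_eq_0_iff_AE) (auto simp: L2_def)
  then show ?thesis by auto
qed

lemma L2_tendsto_cong_AE:
  assumes "\<And>n. s n \<in> L2 M" "\<And>n. s' n \<in> L2 M" "\<phi> \<in> L2 M"
    and "\<And>n. AE x in M. s n x = s' n x" and "L2_tendsto M s \<phi>"
  shows "L2_tendsto M s' \<phi>"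
proof -
  have "(LINT x|M. (cmod (s' n x - \<phi> x))\<^sup>2) = (LINT x|M. (cmod (s n x - \<phi> x))\<^sup>2)" for n
  proof (rule integral_cong_AE)
    have [measurable]: "s n \<in> borel_measurable M" "s' n \<in> borel_measurable M" "\<phi> \<in> borel_measurable M"
      using assms by (auto dest: L2_measurable)
    show "(\<lambda>x. (cmod (s' n x - \<phi> x))\<^sup>2) \<in> borel_measurable M" "(\<lambda>x. (cmod (s n x - \<phi> x))\<^sup>2) \<in> borel_measurable M"
      by measurable
  qed (use assms(4)[of n] in auto)
  then show ?thesis using assms(5) by (simp add: L2_tendsto_def)
qed

lemma L2_tendsto_add:
  assumes "\<And>n. s n \<in> L2 M" "\<phi> \<in> L2 M" "\<And>n. t n \<in> L2 M" "\<theta> \<in> L2 M"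
    and "L2_tendsto M s \<phi>" "L2_tendsto M t \<theta>"
  shows "L2_tendsto M (\<lambda>n x. s n x + t n x) (\<lambda>x. \<phi> x + \<theta> x)"
  unfolding L2_tendsto_def
proof (rule null_sequence_sandwich)
  let ?b = "\<lambda>n. 2 * (LINT x|M. (cmod (s n x - \<phi> x))\<^sup>2) + 2 * (LINT x|M. (cmod (t n x - \<theta> x))\<^sup>2)"
  show "(LINT x|M. (cmod (s n x + t n x - (\<phi> x + \<theta> x)))\<^sup>2) \<le> ?b n" for n
    using L2_square_triangle[OF L2_diff[OF assms(1,2)] L2_diff[OF assms(3,4)], of n n]
    by (simp add: algebra_simps)
  have "?b \<longlonglongrightarrow> 2 * 0 + 2 * 0"
    using assms(5,6) unfolding L2_tendsto_def by (intro tendsto_intros)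
  then show "?b \<longlonglongrightarrow> 0" by simp
qed simp

lemma L2_tendsto_cmult:
  assumes "L2_tendsto M s \<phi>"
  shows "L2_tendsto M (\<lambda>n x. a * s n x) (\<lambda>x. a * \<phi> x)"
proof -
  have "(LINT x|M. (cmod (a * s n x - a * \<phi> x))\<^sup>2) = (cmod a)\<^sup>2 * (LINT x|M. (cmod (s n x - \<phi> x))\<^sup>2)" for n
    by (simp add: right_diff_distrib[symmetric] norm_mult power_mult_distrib)
  then show ?thesis
    using tendsto_mult_right_zero[OF assms[unfolded L2_tendsto_def], of "(cmod a)\<^sup>2"]
    by (simp add: L2_tendsto_def)
qed

lemma L2_inner_tendsto_0:
  assumes "\<And>n. d n \<in> L2 M" "\<And>n. e n \<in> L2 M"
    and "(\<lambda>n. (LINT x|M. (cmod (d n x))\<^sup>2) * (LINT x|M. (cmod (e n x))\<^sup>2)) \<longlonglongrightarrow> 0"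
  shows "(\<lambda>n. L2_inner M (d n) (e n)) \<longlonglongrightarrow> 0"
proof -
  have "(\<lambda>n. (cmod (L2_inner M (d n) (e n)))\<^sup>2) \<longlonglongrightarrow> 0"
    by (rule null_sequence_sandwich[OF _ L2_Cauchy_Schwarz assms(3)]) (use assms in auto)
  then show ?thesis
    using tendsto_norm_zero_cancel by (simp add: tendsto_null_power)
qed

text \<open>Expanding about the two limits leaves three error terms, each with an argument that
  tends to zero, so Cauchy-Schwarz disposes of them.\<close>

lemma L2_inner_tendsto:
  assumes s: "\<And>n. s n \<in> L2 M" and \<phi>: "\<phi> \<in> L2 M" and t: "\<And>n. t n \<in> L2 M" and \<theta>: "\<theta> \<in> L2 M"
    and lim: "L2_tendsto M s \<phi>" "L2_tendsto M t \<theta>"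
  shows "(\<lambda>n. L2_inner M (s n) (t n)) \<longlonglongrightarrow> L2_inner M \<phi> \<theta>"
proof -
  note ds = L2_diff[OF s \<phi>] and dt = L2_diff[OF t \<theta>]
  let ?A = "\<lambda>n. L2_inner M (\<lambda>x. s n x - \<phi> x) (\<lambda>x. t n x - \<theta> x)"
  let ?B = "\<lambda>n. L2_inner M (\<lambda>x. s n x - \<phi> x) \<theta>"
  let ?C = "\<lambda>n. L2_inner M \<phi> (\<lambda>x. t n x - \<theta> x)"
  have "L2_inner M (s n) (t n) = ?A n + ?B n + ?C n + L2_inner M \<phi> \<theta>" for n
  proof -
    have "?A n + ?B n + ?C n + L2_inner M \<phi> \<theta> =
      (LINT x|M. (s n x - \<phi> x) * cnj (t n x - \<theta> x) + (s n x - \<phi> x) * cnj (\<theta> x)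
         + \<phi> x * cnj (t n x - \<theta> x) + \<phi> x * cnj (\<theta> x))"
      unfolding L2_inner_def
      using L2_inner_integrable[OF ds dt] L2_inner_integrable[OF ds \<theta>] L2_inner_integrable[OF \<phi> dt]
        L2_inner_integrable[OF \<phi> \<theta>] by simp
    also have "\<dots> = L2_inner M (s n) (t n)"
      unfolding L2_inner_def by (rule Bochner_Integration.integral_cong) (auto simp: algebra_simps)
    finally show ?thesis by simp
  qed
  moreover have "?A \<longlonglongrightarrow> 0"
    using lim unfolding L2_tendsto_def by (intro L2_inner_tendsto_0 ds dt tendsto_mult_zero)
  moreover have "?B \<longlonglongrightarrow> 0"
    using lim unfolding L2_tendsto_def by (intro L2_inner_tendsto_0 ds \<theta> tendsto_mult_left_zero)
  moreover have "?C \<longlonglongrightarrow> 0"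
    using lim unfolding L2_tendsto_def by (intro L2_inner_tendsto_0 \<phi> dt tendsto_mult_right_zero)
  ultimately show ?thesis
    using tendsto_add[OF tendsto_add[OF tendsto_add] tendsto_const, of ?A 0 _ ?B 0 ?C 0 "L2_inner M \<phi> \<theta>"]
    by simp
qed

text \<open>Riesz-Fischer. On a probability space a Cauchy sequence in \<open>L2\<close> is Cauchy
  in the mean, hence has a subsequence that converges almost everywhere; Fatou along this
  subsequence bounds the distance of the whole sequence to the pointwise limit.\<close>

lemma (in prob_space) L2_complete:
  assumes s: "\<And>n. s n \<in> L2 M"
    and cauchy: "\<And>e. e > 0 \<Longrightarrow> \<exists>N. \<forall>m\<ge>N. \<forall>n\<ge>N. (LINT x|M. (cmod (s m x - s n x))\<^sup>2) < e"
  obtains \<phi> where "\<phi> \<in> L2 M" "L2_tendsto M s \<phi>"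
proof -
  have sm [measurable]: "s n \<in> borel_measurable M" for n using s by (rule L2_measurable)
  have L1: "integrable M \<phi>" if "\<phi> \<in> L2 M" for \<phi>
  proof (rule Bochner_Integration.integrable_bound)
    show "integrable M (\<lambda>x. (cmod (\<phi> x))\<^sup>2 + 1)" using that by (auto simp: L2_def)
    have "a \<le> a\<^sup>2 + 1" if "a \<ge> 0" for a :: real
      using sum_squares_bound[of a 1] that by simp
    then show "AE x in M. norm (\<phi> x) \<le> norm ((cmod (\<phi> x))\<^sup>2 + 1)" by auto
  qed (use that L2_measurable in auto)
  have cauchy1: "\<exists>N. \<forall>m\<ge>N. \<forall>n\<ge>N. (LINT x|M. norm (s m x - s n x)) < e" if "e > 0" for e
  proof -
    obtain N where N: "(LINT x|M. (cmod (s m x - s n x))\<^sup>2) < e\<^sup>2" if "m \<ge> N" "n \<ge> N" for m n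
      using cauchy[of "e\<^sup>2"] \<open>e > 0\<close> by auto
    have "(LINT x|M. norm (s m x - s n x)) < e" if "m \<ge> N" "n \<ge> N" for m n
    proof -
      have d: "(\<lambda>x. s m x - s n x) \<in> L2 M" by (rule L2_diff[OF s s])
      \<comment> \<open>This is \<open>2 * a * e \<le> a^2 + e^2\<close> divided by
        \<open>2 * e\<close>. Integrated over total mass 1, it turns the bound \<open>e^2\<close> on
        the squared norm into the bound \<open>e\<close> on the mean.\<close>
      have "a \<le> e / 2 + 1 / (2 * e) * a\<^sup>2" for a :: real
        using sum_squares_bound[of a e] \<open>e > 0\<close> by (simp add: field_simps power2_eq_square)
      then have "(LINT x|M. norm (s m x - s n x))
          \<le> (LINT x|M. e / 2 + 1 / (2 * e) * (cmod (s m x - s n x))\<^sup>2)"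
        by (intro integral_mono integrable_norm L1[OF d]) (use d in \<open>auto simp: L2_def\<close>)
      also have "\<dots> = e / 2 + 1 / (2 * e) * (LINT x|M. (cmod (s m x - s n x))\<^sup>2)"
        using d by (subst Bochner_Integration.integral_add) (auto simp: L2_def prob_space)
      also have "\<dots> < e / 2 + 1 / (2 * e) * e\<^sup>2"
        using N[OF that] \<open>e > 0\<close> by (intro add_strict_left_mono mult_strict_left_mono) auto
      also have "\<dots> = e" using \<open>e > 0\<close> by (simp add: power2_eq_square)
      finally show ?thesis .
    qed
    then show ?thesis by blast
  qed
  obtain r where r: "strict_mono r" and AE: "AE x in M. Cauchy (\<lambda>i. s (r i) x)"
    using cauchy_L1_AE_cauchy_subseq[OF L1[OF s] cauchy1] by metis
  define \<phi> where "\<phi> x = lim (\<lambda>i. s (r i) x)" for x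
  have [measurable]: "\<phi> \<in> borel_measurable M" unfolding \<phi>_def by measurable
  have conv: "AE x in M. (\<lambda>i. s (r i) x) \<longlonglongrightarrow> \<phi> x"
    using AE unfolding \<phi>_def by eventually_elim (simp add: Cauchy_convergent_iff convergent_LIMSEQ_iff)
  have bound: "(\<integral>\<^sup>+x. ennreal ((cmod (s n x - \<phi> x))\<^sup>2) \<partial>M) \<le> ennreal e"
    if N: "\<And>m n. m \<ge> N \<Longrightarrow> n \<ge> N \<Longrightarrow> (LINT x|M. (cmod (s m x - s n x))\<^sup>2) < e" and "n \<ge> N" for N n e
  proof -
    have "(\<integral>\<^sup>+x. ennreal ((cmod (s n x - \<phi> x))\<^sup>2) \<partial>M)
        = (\<integral>\<^sup>+x. liminf (\<lambda>i. ennreal ((cmod (s n x - s (r i) x))\<^sup>2)) \<partial>M)"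
    proof (rule nn_integral_cong_AE, use conv in eventually_elim)
      fix x assume "(\<lambda>i. s (r i) x) \<longlonglongrightarrow> \<phi> x"
      then have "(\<lambda>i. ennreal ((cmod (s n x - s (r i) x))\<^sup>2)) \<longlonglongrightarrow> ennreal ((cmod (s n x - \<phi> x))\<^sup>2)"
        by (intro tendsto_intros tendsto_ennrealI)
      then show "ennreal ((cmod (s n x - \<phi> x))\<^sup>2) = liminf (\<lambda>i. ennreal ((cmod (s n x - s (r i) x))\<^sup>2))"
        by (intro lim_imp_Liminf[symmetric]) auto
    qed
    also have "\<dots> \<le> liminf (\<lambda>i. \<integral>\<^sup>+x. ennreal ((cmod (s n x - s (r i) x))\<^sup>2) \<partial>M)"
      by (rule nn_integral_liminf) measurable
    also have "\<dots> \<le> ennreal e"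
    proof (rule Liminf_le)
      show "eventually (\<lambda>i. (\<integral>\<^sup>+x. ennreal ((cmod (s n x - s (r i) x))\<^sup>2) \<partial>M) \<le> ennreal e) sequentially"
        using eventually_ge_at_top[of N]
      proof eventually_elim
        case (elim i)
        then have "r i \<ge> N" using seq_suble[OF r, of i] by simp
        then have "(LINT x|M. (cmod (s n x - s (r i) x))\<^sup>2) < e" using N \<open>n \<ge> N\<close> by blast
        moreover have "integrable M (\<lambda>x. (cmod (s n x - s (r i) x))\<^sup>2)"
          using L2_diff[OF s s] by (auto simp: L2_def)
        ultimately show ?case
          by (simp add: nn_integral_eq_integral ennreal_leI)
      qed
    qed simp
    finally show ?thesis .
  qed
  have int: "\<exists>N. \<forall>n\<ge>N. integrable M (\<lambda>x. (cmod (s n x - \<phi> x))\<^sup>2) \<and> (LINT x|M. (cmod (s n x - \<phi> x))\<^sup>2) \<le> e"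
    if "e > 0" for e
  proof -
    obtain N where N: "(LINT x|M. (cmod (s m x - s n x))\<^sup>2) < e" if "m \<ge> N" "n \<ge> N" for m n
      using cauchy[OF \<open>e > 0\<close>] by auto
    have "integrable M (\<lambda>x. (cmod (s n x - \<phi> x))\<^sup>2) \<and> (LINT x|M. (cmod (s n x - \<phi> x))\<^sup>2) \<le> e"
      if "n \<ge> N" for n
    proof
      note b = bound[OF N that]
      show i: "integrable M (\<lambda>x. (cmod (s n x - \<phi> x))\<^sup>2)"
        by (rule integrableI_bounded) (use b in \<open>auto simp: le_less_trans\<close>)
      show "(LINT x|M. (cmod (s n x - \<phi> x))\<^sup>2) \<le> e"
        using b \<open>e > 0\<close> by (simp add: nn_integral_eq_integral[OF i])
    qed
    then show ?thesis by blast
  qed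
  show thesis
  proof
    obtain N where N: "integrable M (\<lambda>x. (cmod (s N x - \<phi> x))\<^sup>2)" using int[of 1] by auto
    then have "(\<lambda>x. s N x - \<phi> x) \<in> L2 M" by (simp add: L2_def)
    from L2_diff[OF s this, of N] show "\<phi> \<in> L2 M" by simp
    show "L2_tendsto M s \<phi>"
      unfolding L2_tendsto_def LIMSEQ_def
    proof (intro allI impI)
      fix e :: real assume "e > 0"
      then show "\<exists>N. \<forall>n\<ge>N. dist (LINT x|M. (cmod (s n x - \<phi> x))\<^sup>2) 0 < e"
        using int[of "e/2"] by (force simp: dist_real_def)
    qed
  qed
qed

section \<open>Extension by continuity to the completion\<close>

lemma ind0_dist_eq:
  assumes S: "\<And>f. f \<in> V \<Longrightarrow> S f \<in> L2 \<mu>"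
    and inner: "\<And>f. f \<in> V \<Longrightarrow> L2_inner \<mu> (S f) (S f) = ind0_inner mHG f f"
    and diff: "\<And>f1 f2. f1 \<in> V \<Longrightarrow> f2 \<in> V \<Longrightarrow> (\<lambda>g. f1 g - f2 g) \<in> V"
    and lin: "\<And>f1 f2. f1 \<in> V \<Longrightarrow> f2 \<in> V \<Longrightarrow> AE x in \<mu>. S (\<lambda>g. f1 g - f2 g) x = S f1 x - S f2 x"
    and "f1 \<in> V" "f2 \<in> V"
  shows "ind0_dist mHG f1 f2 = sqrt (LINT x|\<mu>. (cmod (S f1 x - S f2 x))\<^sup>2)"
proof -
  let ?d = "\<lambda>g. f1 g - f2 g"
  have [measurable]: "S f1 \<in> borel_measurable \<mu>" "S f2 \<in> borel_measurable \<mu>" "S ?d \<in> borel_measurable \<mu>"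
    using assms by (auto dest!: S)
  have "ind0_inner mHG ?d ?d = complex_of_real (LINT x|\<mu>. (cmod (S ?d x))\<^sup>2)"
    using inner[OF diff[OF assms(5,6)]] by (simp add: L2_inner_self)
  also have "(LINT x|\<mu>. (cmod (S ?d x))\<^sup>2) = (LINT x|\<mu>. (cmod (S f1 x - S f2 x))\<^sup>2)"
    by (rule integral_cong_AE) (use lin[OF assms(5,6)] in auto)
  finally show ?thesis by (simp add: ind0_dist_def)
qed

text \<open>An isometry maps Cauchy sequences to Cauchy sequences, and every clause of
  \<open>unitary_intertwiner\<close> is stable under \<open>L2\<close> limits. Linearity and
  equivariance of \<open>S\<close> are required only almost everywhere, so that a Borel version of
  each image may be chosen separately.\<close>

lemma unitary_intertwiner_extension:
  assumes "prob_space \<mu>"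
    and act_measurable: "\<And>g. act g \<in> measurable \<mu> \<mu>" and act_distr: "\<And>g. distr \<mu> \<mu> (act g) = \<mu>"
    and S: "\<And>f. f \<in> ind0 H \<xi> \<Longrightarrow> S f \<in> L2 \<mu>"
    and lincomb: "\<And>f1 f2 a b. f1 \<in> ind0 H \<xi> \<Longrightarrow> f2 \<in> ind0 H \<xi> \<Longrightarrow> (\<lambda>g. a * f1 g + b * f2 g) \<in> ind0 H \<xi>"
    and trans: "\<And>f g. f \<in> ind0 H \<xi> \<Longrightarrow> (\<lambda>x. f (x + g)) \<in> ind0 H \<xi>"
    and S_lincomb: "\<And>f1 f2 a b. f1 \<in> ind0 H \<xi> \<Longrightarrow> f2 \<in> ind0 H \<xi> \<Longrightarrow>
      AE x in \<mu>. S (\<lambda>g. a * f1 g + b * f2 g) x = a * S f1 x + b * S f2 x"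
    and S_inner: "\<And>f1 f2. f1 \<in> ind0 H \<xi> \<Longrightarrow> f2 \<in> ind0 H \<xi> \<Longrightarrow>
      L2_inner \<mu> (S f1) (S f2) = ind0_inner mHG f1 f2"
    and S_trans: "\<And>f g. f \<in> ind0 H \<xi> \<Longrightarrow> AE x in \<mu>. S (\<lambda>x. f (x + g)) x = S f (act (- g) x)"
  shows "\<exists>T. unitary_intertwiner act \<mu> H mHG \<xi> T \<and> (\<forall>f\<in>ind0 H \<xi>. AE x in \<mu>. T (\<lambda>_. f) x = S f x)"
proof -
  interpret prob_space \<mu> by fact
  let ?V = "ind0 H \<xi>"
  have dist: "ind0_dist mHG f1 f2 = sqrt (LINT x|\<mu>. (cmod (S f1 x - S f2 x))\<^sup>2)"
    if "f1 \<in> ?V" "f2 \<in> ?V" for f1 f2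
  proof (rule ind0_dist_eq[where V="?V"])
    show "(\<lambda>g. f1 g - f2 g) \<in> ?V" if "f1 \<in> ?V" "f2 \<in> ?V" for f1 f2
      using lincomb[OF that, of 1 "-1"] by simp
    show "AE x in \<mu>. S (\<lambda>g. f1 g - f2 g) x = S f1 x - S f2 x" if "f1 \<in> ?V" "f2 \<in> ?V" for f1 f2
      using S_lincomb[OF that, of 1 "-1"] by simp
  qed (use S S_inner that in auto)
  define P where "P u \<phi> \<longleftrightarrow> \<phi> \<in> L2 \<mu> \<and> L2_tendsto \<mu> (\<lambda>n. S (u n)) \<phi>" for u \<phi>
  \<comment> \<open>An arbitrary choice among limits that agree almost everywhere. By
    \<open>T_eq\<close>, an identity for \<open>T\<close> follows as soon as its right-hand side is
    exhibited as a limit of the images.\<close>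
  define T where "T u = (SOME \<phi>. P u \<phi>)" for u
  have T_eq: "AE x in \<mu>. T u x = \<phi> x" if "\<And>n. u n \<in> ?V" "P u \<phi>" for u \<phi>
  proof -
    have "P u (T u)" unfolding T_def using that(2) by (rule someI[of "P u"])
    then show ?thesis
      using that S by (intro L2_tendsto_unique[where s="\<lambda>n. S (u n)"]) (auto simp: P_def)
  qed
  have PT: "P u (T u)" if "u \<in> ind H mHG \<xi>" for u
  proof -
    from that have u: "\<And>n. u n \<in> ?V"
      and c: "\<And>e. e > 0 \<Longrightarrow> \<exists>N. \<forall>m\<ge>N. \<forall>n\<ge>N. ind0_dist mHG (u m) (u n) < e"
      by (auto simp: ind_def)
    obtain \<phi> where "\<phi> \<in> L2 \<mu>" "L2_tendsto \<mu> (\<lambda>n. S (u n)) \<phi>"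
    proof (rule L2_complete[of "\<lambda>n. S (u n)"])
      fix e :: real assume "e > 0"
      then obtain N where N: "ind0_dist mHG (u m) (u n) < sqrt e" if "m \<ge> N" "n \<ge> N" for m n
        using c[of "sqrt e"] by auto
      with dist[OF u u] show "\<exists>N. \<forall>m\<ge>N. \<forall>n\<ge>N. (LINT x|\<mu>. (cmod (S (u m) x - S (u n) x))\<^sup>2) < e"
        by (auto intro!: exI[of _ N])
    qed (use S u in auto)
    then have "P u \<phi>" by (simp add: P_def)
    then show ?thesis unfolding T_def by (rule someI[of "P u"])
  qed
  have ind_V: "u n \<in> ?V" if "u \<in> ind H mHG \<xi>" for u n using that by (simp add: ind_def)
  have "unitary_intertwiner act \<mu> H mHG \<xi> T"
    unfolding unitary_intertwiner_def
  proof (intro conjI ballI allI impI)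
    show "T u \<in> L2 \<mu>" if "u \<in> ind H mHG \<xi>" for u
      using PT[OF that] by (simp add: P_def)
  next
    fix u v assume u: "u \<in> ind H mHG \<xi>" and v: "v \<in> ind H mHG \<xi>" and eq: "ind_eq mHG u v"
    have "L2_tendsto \<mu> (\<lambda>n x. S (u n) x - S (v n) x) (\<lambda>x. 0)"
      using tendsto_power[OF eq[unfolded ind_eq_def], of 2] dist[OF ind_V[OF u] ind_V[OF v]]
      by (simp add: L2_tendsto_def)
    then have "L2_tendsto \<mu> (\<lambda>n x. (S (u n) x - S (v n) x) + S (v n) x) (\<lambda>x. 0 + T v x)"
      using PT[OF v] S ind_V[OF u] ind_V[OF v]
      by (intro L2_tendsto_add L2_diff) (simp_all add: P_def, simp_all add: L2_def)
    then have "P u (T v)" using PT[OF v] by (simp add: P_def)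
    then show "AE x in \<mu>. T u x = T v x" by (rule T_eq[OF ind_V[OF u]])
  next
    fix u v a b assume u: "u \<in> ind H mHG \<xi>" and v: "v \<in> ind H mHG \<xi>"
    let ?w = "\<lambda>n g. a * u n g + b * v n g"
    have w: "?w n \<in> ?V" for n using ind_V[OF u] ind_V[OF v] by (rule lincomb)
    have *: "T u \<in> L2 \<mu>" "L2_tendsto \<mu> (\<lambda>n. S (u n)) (T u)" "T v \<in> L2 \<mu>" "L2_tendsto \<mu> (\<lambda>n. S (v n)) (T v)"
      using PT[OF u] PT[OF v] by (auto simp: P_def)
    have "L2_tendsto \<mu> (\<lambda>n x. a * S (u n) x + b * S (v n) x) (\<lambda>x. a * T u x + b * T v x)"
      using * S ind_V[OF u] ind_V[OF v] by (intro L2_tendsto_add L2_tendsto_cmult L2_cmult) auto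
    then have "L2_tendsto \<mu> (\<lambda>n. S (?w n)) (\<lambda>x. a * T u x + b * T v x)"
    proof (rule L2_tendsto_cong_AE[rotated -1])
      show "AE x in \<mu>. a * S (u n) x + b * S (v n) x = S (?w n) x" for n
        using S_lincomb[OF ind_V[OF u, of n] ind_V[OF v, of n], of a b] by eventually_elim simp
    qed (use * S ind_V[OF u] ind_V[OF v] w in \<open>auto intro!: L2_add L2_cmult\<close>)
    then have "P ?w (\<lambda>x. a * T u x + b * T v x)"
      using * by (auto simp: P_def intro!: L2_add L2_cmult)
    then show "AE x in \<mu>. T ?w x = a * T u x + b * T v x" by (rule T_eq[OF w])
  next
    fix u v assume u: "u \<in> ind H mHG \<xi>" and v: "v \<in> ind H mHG \<xi>"
    have "(\<lambda>n. L2_inner \<mu> (S (u n)) (S (v n))) \<longlonglongrightarrow> L2_inner \<mu> (T u) (T v)"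
      using PT[OF u] PT[OF v] S ind_V[OF u] ind_V[OF v] by (intro L2_inner_tendsto) (auto simp: P_def)
    then show "L2_inner \<mu> (T u) (T v) = ind_inner mHG u v"
      using S_inner[OF ind_V[OF u] ind_V[OF v]] by (simp add: ind_inner_def limI)
  next
    fix u g assume u: "u \<in> ind H mHG \<xi>"
    have tr: "ind_act g u n \<in> ?V" for n using trans[OF ind_V[OF u]] by (simp add: ind_act_def)
    have *: "T u \<in> L2 \<mu>" "L2_tendsto \<mu> (\<lambda>n. S (u n)) (T u)"
      using PT[OF u] by (auto simp: P_def)
    \<comment> \<open>The action preserves \<open>\<mu>\<close>, so translating functions is
      isometric and commutes with \<open>L2\<close> limits.\<close>
    have L2_act: "(\<lambda>x. \<phi> (act h x)) \<in> L2 \<mu>"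
      and int_act: "(LINT x|\<mu>. (cmod (\<phi> (act h x)))\<^sup>2) = (LINT x|\<mu>. (cmod (\<phi> x))\<^sup>2)" if "\<phi> \<in> L2 \<mu>" for \<phi> h
    proof -
      have m [measurable]: "\<phi> \<in> borel_measurable \<mu>" "act h \<in> measurable \<mu> \<mu>"
        using that act_measurable by (auto dest: L2_measurable)
      have "integrable (distr \<mu> \<mu> (act h)) (\<lambda>x. (cmod (\<phi> x))\<^sup>2)"
        using that by (simp add: act_distr L2_def)
      then show "(\<lambda>x. \<phi> (act h x)) \<in> L2 \<mu>"
        by (subst (asm) integrable_distr_eq) (auto simp: L2_def)
      have "(LINT x|distr \<mu> \<mu> (act h). (cmod (\<phi> x))\<^sup>2) = (LINT x|\<mu>. (cmod (\<phi> (act h x)))\<^sup>2)"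
        by (rule integral_distr) measurable
      then show "(LINT x|\<mu>. (cmod (\<phi> (act h x)))\<^sup>2) = (LINT x|\<mu>. (cmod (\<phi> x))\<^sup>2)"
        by (simp add: act_distr)
    qed
    have "L2_tendsto \<mu> (\<lambda>n x. S (u n) (act (- g) x)) (\<lambda>x. T u (act (- g) x))"
      using *(2) int_act[OF L2_diff[OF S[OF ind_V[OF u]] *(1)]] by (simp add: L2_tendsto_def)
    then have "L2_tendsto \<mu> (\<lambda>n. S (ind_act g u n)) (\<lambda>x. T u (act (- g) x))"
    proof (rule L2_tendsto_cong_AE[rotated -1])
      show "AE x in \<mu>. S (u n) (act (- g) x) = S (ind_act g u n) x" for n
        using S_trans[OF ind_V[OF u, of n], of g] unfolding ind_act_def by eventually_elim simp
    qed (use * S ind_V[OF u] tr L2_act in auto)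
    then have "P (ind_act g u) (\<lambda>x. T u (act (- g) x))"
      using L2_act[OF *(1)] by (simp add: P_def)
    then show "AE x in \<mu>. T (ind_act g u) x = T u (act (- g) x)" by (rule T_eq[OF tr])
  qed
  moreover have "AE x in \<mu>. T (\<lambda>_. f) x = S f x" if "f \<in> ?V" for f
    by (rule T_eq) (use that S in \<open>auto simp: P_def L2_tendsto_def\<close>)
  ultimately show ?thesis by blast
qed

section \<open>Cosets\<close>

lemma is_subgroupD:
  assumes "is_subgroup S"
  shows "0 \<in> S" "\<And>a b. a \<in> S \<Longrightarrow> b \<in> S \<Longrightarrow> a + b \<in> S" "\<And>a. a \<in> S \<Longrightarrow> - a \<in> S"
  using assms by (auto simp: is_subgroup_def)

lemma mem_coset_iff:
  assumes "is_subgroup H"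
  shows "x \<in> coset H g \<longleftrightarrow> x - g \<in> H"
proof
  assume "x - g \<in> H"
  then have "x - g + g \<in> coset H g" unfolding coset_def by blast
  then show "x \<in> coset H g" by simp
qed (auto simp: coset_def add_diff_eq[symmetric])

lemma coset_eq_iff:
  assumes "is_subgroup H"
  shows "coset H a = coset H b \<longleftrightarrow> a - b \<in> H"
proof
  assume "coset H a = coset H b"
  moreover have "a \<in> coset H a" using is_subgroupD(1)[OF assms] by (simp add: mem_coset_iff[OF assms])
  ultimately show "a - b \<in> H" by (simp add: mem_coset_iff[OF assms])
next
  assume ab: "a - b \<in> H"
  have "x - a \<in> H \<longleftrightarrow> x - b \<in> H" for x
  proof
    assume "x - a \<in> H"
    from is_subgroupD(2)[OF assms this ab] show "x - b \<in> H" by (simp add: diff_add_eq add_diff_eq)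
  next
    assume "x - b \<in> H"
    from is_subgroupD(2)[OF assms this is_subgroupD(3)[OF assms ab]]
    show "x - a \<in> H" by (simp add: diff_add_eq add_diff_eq)
  qed
  then show "coset H a = coset H b" by (auto simp: mem_coset_iff[OF assms])
qed

lemma coset_add:
  assumes "is_subgroup H" "h \<in> H"
  shows "coset H (h + g) = coset H g"
  using assms by (simp add: coset_eq_iff)

lemma rep_coset:
  assumes "is_subgroup H"
  obtains h where "h \<in> H" "rep (coset H g) = h + g"
proof -
  have "g \<in> coset H g" using is_subgroupD(1)[OF assms] by (simp add: mem_coset_iff[OF assms])
  then have "rep (coset H g) \<in> coset H g" unfolding rep_def by (rule someI)
  then show thesis using that by (auto simp: coset_def)
qed

lemma coset_rep:
  assumes "is_subgroup H" "c \<in> cosets H"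
  shows "coset H (rep c) = c"
proof -
  obtain g where g: "c = coset H g" using assms(2) by (auto simp: cosets_def)
  obtain h where "h \<in> H" "rep c = h + g" using rep_coset[OF assms(1)] g by metis
  then show ?thesis using g coset_add[OF assms(1)] by simp
qed

lemma continuous_on_translate [continuous_intros]:
  "continuous_on S (\<lambda>x. a + (x::'g::lcsc_group_add))" "continuous_on S (\<lambda>x. x + (a::'g))"
  by (intro continuous_intros)+

lemma continuous_on_diff_group:
  fixes f g :: "_ \<Rightarrow> 'g::lcsc_group_add"
  assumes "continuous_on S f" "continuous_on S g"
  shows "continuous_on S (\<lambda>x. f x - g x)"
  unfolding diff_conv_add_uminus by (intro continuous_intros assms)

lemma open_left_translate:
  fixes U :: "'g::lcsc_group_add set"
  assumes "open U"
  shows "open ((\<lambda>x. a + x) ` U)"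
proof -
  have "(\<lambda>x. a + x) ` U = (\<lambda>x. - a + x) -` U"
    by (force simp: image_iff add.assoc[symmetric] intro: bexI[where x="- a + _"])
  then show ?thesis using open_vimage[OF assms, of "\<lambda>x. - a + x"] by (simp add: continuous_on_translate)
qed

text \<open>Lindelof yields countably many relatively compact open sets covering the group. Because
  open sets cover, a compact set lies in finitely many of them and hence in a single
  \<open>D n\<close>; statements about all compact sets thus reduce to countably many.\<close>

lemma compact_cover_exhaustion:
  obtains D :: "nat \<Rightarrow> 'g::lcsc_group_add set"
  where "\<And>n. compact (D n)" "\<And>C. compact C \<Longrightarrow> \<exists>n. C \<subseteq> D n"
proof -
  let ?F = "{U :: 'g set. open U \<and> (\<exists>K. compact K \<and> U \<subseteq> K)}"
  obtain F where F: "F \<subseteq> ?F" "countable F" "\<Union>F = \<Union>?F"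
    using Lindelof[of ?F] by blast
  have "\<Union>?F = UNIV" using locally_compact by blast
  with F have cover: "\<Union>F = UNIV" by simp
  then have "F \<noteq> {}" by auto
  define U where "U = from_nat_into F"
  have U: "U n \<in> F" for n unfolding U_def by (rule from_nat_into) fact
  have rU: "range U = F" unfolding U_def using \<open>F \<noteq> {}\<close> F(2) by simp
  have "\<forall>n. \<exists>K. compact K \<and> U n \<subseteq> K" using U F(1) by blast
  then obtain K where K: "\<And>n. compact (K n)" "\<And>n. U n \<subseteq> K n" by metis
  show thesis
  proof
    show "compact (\<Union>i\<le>n. K i)" for n using K by auto
    fix C :: "'g set" assume "compact C"
    have op: "open (U n)" for n using U F(1) by blast
    have "C \<subseteq> (\<Union>n\<in>UNIV. U n)" using rU cover by auto
    from compactE_image[OF \<open>compact C\<close> op this]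
    obtain I where I: "finite I" "C \<subseteq> (\<Union>n\<in>I. U n)" by metis
    obtain n where "I \<subseteq> {..n}" using I(1) by (auto simp: finite_nat_iff_bounded_le)
    then have "(\<Union>n\<in>I. U n) \<subseteq> (\<Union>i\<le>n. K i)" using K(2) by (intro UN_mono) auto
    with I(2) have "C \<subseteq> (\<Union>i\<le>n. K i)" by (rule order_trans)
    then show "\<exists>n. C \<subseteq> (\<Union>i\<le>n. K i)" by blast
  qed
qed

lemma compactin_coset_image:
  assumes "compact C"
  shows "compactin (coset_topology H) (coset H ` C)"
proof (rule image_compactin[where X=euclidean])
  show "continuous_map euclidean (coset_topology H) (coset H)"
    unfolding continuous_map_def
    by (auto simp: topspace_coset_topology cosets_def openin_coset_topology vimage_def)
qed (use assms in auto)

text \<open>The quotient map is open, so the images of relatively compact open sets form an open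
  cover of \<open>K\<close>; the compact hulls of a finite subcover make up \<open>C\<close>.
  Support conditions on the coset space can then be stated with compact subsets of the
  group.\<close>

lemma compactin_cosetsE:
  assumes H: "is_subgroup H" and K: "compactin (coset_topology H) K"
  obtains C where "compact C" "K \<subseteq> coset H ` C"
proof -
  define F where "F = {coset H ` U |U. open U \<and> (\<exists>K. compact K \<and> U \<subseteq> K)}"
  have "openin (coset_topology H) (coset H ` U)" if "open U" for U
  proof -
    have "coset H -` coset H ` U = (\<Union>h\<in>H. (\<lambda>x. h + x) ` U)"
    proof (intro equalityI subsetI)
      fix x assume "x \<in> coset H -` coset H ` U"
      then obtain u where "u \<in> U" "x - u \<in> H" by (auto simp: coset_eq_iff[OF H])
      then show "x \<in> (\<Union>h\<in>H. (\<lambda>x. h + x) ` U)"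
        by (intro UN_I[of "x - u"] image_eqI[of _ _ u]) auto
    qed (auto simp: coset_add[OF H])
    then show ?thesis
      using open_left_translate[OF that] by (auto simp: openin_coset_topology cosets_def)
  qed
  then have op: "\<And>S. S \<in> F \<Longrightarrow> openin (coset_topology H) S" by (auto simp: F_def)
  have "K \<subseteq> \<Union>F"
  proof
    fix c assume "c \<in> K"
    then obtain g where g: "c = coset H g"
      using compactin_subset_topspace[OF K] by (auto simp: topspace_coset_topology cosets_def)
    obtain U K where "open U" "compact K" "g \<in> U" "U \<subseteq> K" using locally_compact[of g] by metis
    then have "coset H ` U \<in> F" unfolding F_def by (intro CollectI exI[of _ U]) auto
    moreover have "c \<in> coset H ` U" using g \<open>g \<in> U\<close> by blast
    ultimately show "c \<in> \<Union>F" by (rule UnionI)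
  qed
  then obtain F' where F': "finite F'" "F' \<subseteq> F" "K \<subseteq> \<Union>F'"
    using compactinD[OF K op] by metis
  have "\<exists>K. compact K \<and> S \<subseteq> coset H ` K" if S: "S \<in> F" for S
  proof -
    obtain U K where "S = coset H ` U" "compact K" "U \<subseteq> K" using S unfolding F_def by blast
    then show ?thesis using image_mono[of U K "coset H"] by metis
  qed
  then have "\<forall>S\<in>F'. \<exists>K. compact K \<and> S \<subseteq> coset H ` K" using F'(2) by (meson subsetD)
  then obtain k where k: "\<And>S. S \<in> F' \<Longrightarrow> compact (k S)" "\<And>S. S \<in> F' \<Longrightarrow> S \<subseteq> coset H ` k S" by metis
  show thesis
  proof
    show "compact (\<Union>S\<in>F'. k S)" using F'(1) k(1) by auto
    show "K \<subseteq> coset H ` (\<Union>S\<in>F'. k S)" using F'(3) k(2) by blast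
  qed
qed

section \<open>Haar measures\<close>

lemma borel_measurable_group_uminus [measurable (raw)]:
  fixes f :: "'a \<Rightarrow> 'g::lcsc_group_add"
  assumes "f \<in> borel_measurable M"
  shows "(\<lambda>x. - f x) \<in> borel_measurable M"
  by (rule borel_measurable_continuous_on[OF _ assms]) (intro continuous_intros)

lemma ennreal_one_divide_antimono:
  fixes v p :: ennreal
  assumes "v \<le> p" "v > 0" "p < top"
  shows "1 / p \<le> 1 / v"
proof (rule divide_le_posI_ennreal)
  have "1 = v / v" using assms by (intro ennreal_divide_self[symmetric]) auto
  also have "\<dots> \<le> p / v" by (rule divide_right_mono_ennreal) fact
  finally show "1 \<le> p * (1 / v)" by (simp add: ennreal_times_divide)
qed (use assms in auto)

locale haar_subgroup =
  fixes S :: "'g::lcsc_group_add set" and m :: "'g measure"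
  assumes haar: "haar_measure S m" and unimod: "unimodular S"
    and closed_S: "closed S" and subgroup: "is_subgroup S"
begin

lemma space_m [simp]: "space m = S" and sets_m [measurable_cong]: "sets m = sets (restrict_space borel S)"
  using haar by (auto simp: haar_measure_def)

lemma zero_mem: "0 \<in> S" and add_mem: "a \<in> S \<Longrightarrow> b \<in> S \<Longrightarrow> a + b \<in> S" and uminus_mem: "a \<in> S \<Longrightarrow> - a \<in> S"
  using is_subgroupD[OF subgroup] by auto

lemma id_measurable [measurable]: "(\<lambda>x. x) \<in> borel_measurable m"
  unfolding measurable_cong_sets[OF sets_m refl] by (rule measurable_restrict_space1) simp

lemma borel_measurable_m: "f \<in> measurable borel N \<Longrightarrow> f \<in> measurable m N"
  using measurable_compose[OF id_measurable] by auto

lemma measurable_into_m: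
  assumes "f \<in> borel_measurable N" "\<And>x. x \<in> space N \<Longrightarrow> f x \<in> S"
  shows "f \<in> measurable N m"
  unfolding measurable_cong_sets[OF refl sets_m]
  by (rule measurable_restrict_space2) (use assms in auto)

lemma compact_finite:
  assumes "compact K" "K \<subseteq> S"
  shows "emeasure m K < \<infinity>"
  using haar assms by (auto simp: haar_measure_def)

lemma sigma_finite: "sigma_finite_measure m"
proof
  obtain D :: "nat \<Rightarrow> 'g set" where D: "\<And>n. compact (D n)" "\<And>C. compact C \<Longrightarrow> \<exists>n. C \<subseteq> D n"
    by (rule compact_cover_exhaustion) blast
  have "compact (D n \<inter> S)" for n using D(1) closed_S by (simp add: compact_Int_closed)
  then have fin: "emeasure m (D n \<inter> S) \<noteq> \<infinity>" for n using compact_finite[of "D n \<inter> S"] by auto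
  have sets: "D n \<inter> S \<in> sets m" for n
    using D(1)[THEN compact_imp_closed] by (auto simp: sets_m sets_restrict_space)
  have "x \<in> (\<Union>n. D n)" for x using D(2)[of "{x}"] by auto
  then have "(\<Union>n. D n \<inter> S) = S" by auto
  then show "\<exists>A. countable A \<and> A \<subseteq> sets m \<and> \<Union>A = space m \<and> (\<forall>a\<in>A. emeasure m a \<noteq> \<infinity>)"
    using fin sets by (intro exI[of _ "range (\<lambda>n. D n \<inter> S)"]) auto
qed

sublocale sigma_finite_measure m by (rule sigma_finite)

lemma distr_left: assumes "g \<in> S" shows "distr m m (\<lambda>x. g + x) = m"
proof (rule measure_eqI)
  have [measurable]: "(\<lambda>x. g + x) \<in> measurable m m"
    by (rule measurable_into_m) (use assms add_mem in auto)
  fix A assume "A \<in> sets (distr m m (\<lambda>x. g + x))"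
  then have A: "A \<in> sets m" by simp
  then have "A \<subseteq> S" using sets.sets_into_space by fastforce
  then have "(\<lambda>x. g + x) -` A \<inter> S = (\<lambda>x. - g + x) ` A"
    using assms add_mem uminus_mem by (force simp: image_iff add.assoc[symmetric] intro: bexI[where x="g + _"])
  then show "emeasure (distr m m (\<lambda>x. g + x)) A = emeasure m A"
    using haar A assms uminus_mem by (auto simp: emeasure_distr haar_measure_def)
qed simp

lemma distr_right: assumes "g \<in> S" shows "distr m m (\<lambda>x. x + g) = m"
proof (rule measure_eqI)
  have [measurable]: "(\<lambda>x. x + g) \<in> measurable m m"
    by (rule measurable_into_m) (use assms add_mem in auto)
  fix A assume "A \<in> sets (distr m m (\<lambda>x. x + g))"
  then have A: "A \<in> sets m" by simp
  then have "A \<subseteq> S" using sets.sets_into_space by fastforce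
  then have "(\<lambda>x. x + g) -` A \<inter> S = (\<lambda>x. x + - g) ` A"
    using assms add_mem uminus_mem by (force simp: image_iff add.assoc intro: bexI[where x="_ + g"])
  then show "emeasure (distr m m (\<lambda>x. x + g)) A = emeasure m A"
    using haar unimod A uminus_mem[OF assms] unfolding unimodular_def
    by (simp add: emeasure_distr del: diff_conv_add_uminus add_uminus_conv_diff)
qed simp

lemma nn_integral_left:
  assumes "g \<in> S" "f \<in> borel_measurable m"
  shows "(\<integral>\<^sup>+x. f (g + x) \<partial>m) = (\<integral>\<^sup>+x. f x \<partial>m)"
proof -
  have "(\<lambda>x. g + x) \<in> measurable m m" by (rule measurable_into_m) (use assms add_mem in auto)
  from nn_integral_distr[OF this, of f] show ?thesis using assms by (simp add: distr_left)
qed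

lemma nn_integral_right:
  assumes "g \<in> S" "f \<in> borel_measurable m"
  shows "(\<integral>\<^sup>+x. f (x + g) \<partial>m) = (\<integral>\<^sup>+x. f x \<partial>m)"
proof -
  have "(\<lambda>x. x + g) \<in> measurable m m" by (rule measurable_into_m) (use assms add_mem in auto)
  from nn_integral_distr[OF this, of f] show ?thesis using assms by (simp add: distr_right)
qed

text \<open>By Lindelof, countably many translates of \<open>V\<close> cover \<open>S\<close>; were
  \<open>V \<inter> S\<close> a null set, the whole measure would vanish.\<close>

lemma open_positive:
  assumes V: "open V" "0 \<in> V"
  shows "emeasure m (V \<inter> S) > 0"
proof (rule ccontr)
  assume "\<not> ?thesis"
  then have null: "emeasure m (V \<inter> S) = 0" by auto
  obtain F where F: "F \<subseteq> (\<lambda>g. (\<lambda>x. g + x) ` V) ` S" "countable F"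
      "\<Union>F = \<Union>((\<lambda>g. (\<lambda>x. g + x) ` V) ` S)"
    using Lindelof[of "(\<lambda>g. (\<lambda>x. g + x) ` V) ` S"] open_left_translate[OF V(1)] by blast
  have VS: "V \<inter> S \<in> sets m" using V by (auto simp: sets_m sets_restrict_space)
  have "U \<inter> S \<in> null_sets m" if "U \<in> F" for U
  proof -
    obtain g where g: "g \<in> S" "U = (\<lambda>x. g + x) ` V" using F(1) \<open>U \<in> F\<close> by auto
    have "U \<inter> S = (\<lambda>x. g + x) ` (V \<inter> S)"
    proof (intro equalityI subsetI)
      fix y assume "y \<in> U \<inter> S"
      then obtain x where x: "x \<in> V" "y = g + x" "y \<in> S" using g by auto
      then have "x = - g + y" by (simp add: add.assoc[symmetric])
      then have "x \<in> S" using x(3) g(1) add_mem uminus_mem by metis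
      then show "y \<in> (\<lambda>x. g + x) ` (V \<inter> S)" using x by auto
    qed (use g add_mem in auto)
    moreover have "open U" using g open_left_translate[OF V(1)] by simp
    then have "U \<inter> S \<in> sets m" by (auto simp: sets_m sets_restrict_space)
    moreover have "emeasure m ((\<lambda>x. g + x) ` (V \<inter> S)) = 0"
      using haar VS null g(1) unfolding haar_measure_def by metis
    ultimately show ?thesis by (simp add: null_sets_def)
  qed
  then have "(\<Union>U\<in>F. U \<inter> S) \<in> null_sets m" using F(2) by (intro null_sets_UN') auto
  moreover have "(\<Union>U\<in>F. U \<inter> S) = S"
    using F(3) V(2) by (force intro: image_eqI[where x=0])
  ultimately show False using haar by (auto simp: haar_measure_def null_sets_def)
qed

text \<open>\<open>\<rho>\<close> is the indicator of a compact set \<open>K \<supseteq> C\<close>, divided by its integrals over the cosets.\<close>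

lemma coset_partition_function:
  assumes "compact C"
  obtains \<rho> :: "'g \<Rightarrow> real" and K B
  where "\<rho> \<in> borel_measurable borel" "compact K" "\<And>g. g \<notin> K \<Longrightarrow> \<rho> g = 0"
    "\<And>g. 0 \<le> \<rho> g" "\<And>g. \<rho> g \<le> B"
    "\<And>g. coset S g \<in> coset S ` C \<Longrightarrow> (\<integral>\<^sup>+h. ennreal (\<rho> (h + g)) \<partial>m) = 1"
proof -
  obtain V K0 where V: "open V" "compact K0" "(0::'g) \<in> V" "V \<subseteq> K0"
    using locally_compact[of "0::'g"] by metis
  define K where "K = (\<lambda>(x, y). x + y) ` (K0 \<times> C)"
  have cK: "compact K"
    unfolding K_def case_prod_beta
    by (intro compact_continuous_image compact_Times V assms continuous_intros)
  have [measurable]: "K \<in> sets borel" using cK by (simp add: compact_imp_closed)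
  define P where "P g = (\<integral>\<^sup>+h. indicator K (h + g) \<partial>m)" for g
  \<comment> \<open>A lower bound for \<open>P\<close> on \<open>C\<close>: as \<open>K\<close>
    consists of sums of \<open>K0\<close> and \<open>C\<close>, the fibre over a point of
    \<open>C\<close> contains \<open>V \<inter> S\<close>. Hence the quotient defining
    \<open>\<rho>\<close> is at most \<open>1 / v\<close>.\<close>
  define v where "v = emeasure m (V \<inter> S)"
  have v0: "v > 0" unfolding v_def using V by (intro open_positive) auto
  have VS: "V \<inter> S \<in> sets m" using V by (auto simp: sets_m sets_restrict_space)
  have fin: "P g < \<infinity>" for g
  proof -
    have "P g = (\<integral>\<^sup>+h. indicator ((\<lambda>x. x - g) ` K \<inter> S) h \<partial>m)"
      unfolding P_def by (rule nn_integral_cong) (force simp: indicator_def image_iff)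
    also have "\<dots> = emeasure m ((\<lambda>x. x - g) ` K \<inter> S)"
    proof (rule nn_integral_indicator)
      have "compact ((\<lambda>x. x - g) ` K)"
        by (rule compact_continuous_image[OF _ cK]) (intro continuous_on_diff_group continuous_intros)
      then have "(\<lambda>x. x - g) ` K \<in> sets borel" by (intro borel_closed compact_imp_closed)
      then show "(\<lambda>x. x - g) ` K \<inter> S \<in> sets m"
        unfolding sets_m sets_restrict_space by blast
    qed
    also have "\<dots> < \<infinity>"
    proof (rule compact_finite)
      have "compact ((\<lambda>x. x - g) ` K)"
        by (rule compact_continuous_image[OF _ cK]) (intro continuous_on_diff_group continuous_intros)
      then show "compact ((\<lambda>x. x - g) ` K \<inter> S)" using closed_S by (simp add: compact_Int_closed)
    qed simp
    finally show ?thesis .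
  qed
  have [measurable]: "P \<in> borel_measurable borel"
    unfolding P_def by measurable
  \<comment> \<open>Unimodularity of \<open>S\<close> enters here: changing the representative of a
    coset translates the fibre integral on the right.\<close>
  have inv: "P (h + g) = P g" if "h \<in> S" for h g
    unfolding P_def using nn_integral_right[OF that, of "\<lambda>x. indicator K (x + g)"] by (simp add: add.assoc)
  have lower: "v \<le> P c" if "c \<in> C" for c
  proof -
    have "v = (\<integral>\<^sup>+h. indicator (V \<inter> S) h \<partial>m)" unfolding v_def using VS by simp
    also have "\<dots> \<le> P c"
      unfolding P_def using V \<open>c \<in> C\<close> by (intro nn_integral_mono) (force simp: indicator_def K_def)
    finally show ?thesis .
  qed
  \<comment> \<open>Over cosets that miss \<open>C\<close>, the fibre integral may be arbitrarily
    small; the threshold \<open>v\<close> keeps the quotient bounded there.\<close>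
  define \<rho> where "\<rho> g = enn2real (if v \<le> P g then indicator K g / P g else 0)" for g
  have fin': "(if v \<le> P g then indicator K g / P g else 0) < \<infinity>" for g
    using v0 by (auto simp: indicator_def ennreal_divide_eq_top_iff less_top[symmetric])
  show thesis
  proof
    show "\<rho> \<in> borel_measurable borel" unfolding \<rho>_def by measurable
    show "compact K" by fact
    show "\<rho> g = 0" if "g \<notin> K" for g using that by (simp add: \<rho>_def)
    show "0 \<le> \<rho> g" for g by (simp add: \<rho>_def)
    show "\<rho> g \<le> enn2real (1 / v)" for g
      unfolding \<rho>_def
    proof (rule enn2real_mono)
      show "(if v \<le> P g then indicator K g / P g else 0) \<le> 1 / v"
        using v0 fin[of g] by (auto simp: indicator_def intro!: ennreal_one_divide_antimono)
    qed (use v0 in \<open>auto simp: ennreal_divide_eq_top_iff less_top[symmetric]\<close>)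
    fix g assume "coset S g \<in> coset S ` C"
    then obtain c where c: "c \<in> C" "g - c \<in> S" by (auto simp: coset_eq_iff[OF subgroup])
    have "P g = P c" using inv[OF c(2), of c] by simp
    then have Pg: "v \<le> P g" using lower[OF c(1)] by simp
    have "(\<integral>\<^sup>+h. ennreal (\<rho> (h + g)) \<partial>m) = (\<integral>\<^sup>+h. indicator K (h + g) / P g \<partial>m)"
    proof (rule nn_integral_cong)
      fix h assume "h \<in> space m"
      then have "P (h + g) = P g" using inv by simp
      then show "ennreal (\<rho> (h + g)) = indicator K (h + g) / P g"
        using fin'[of "h + g"] Pg by (simp add: \<rho>_def)
    qed
    also have "\<dots> = P g / P g"
      unfolding divide_ennreal_def P_def by (rule nn_integral_multc) measurable
    also have "\<dots> = 1"
      using Pg v0 fin[of g] by (intro ennreal_divide_self) auto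
    finally show "(\<integral>\<^sup>+h. ennreal (\<rho> (h + g)) \<partial>m) = 1" .
  qed
qed

end

text \<open>Tonelli's theorem for \<open>f x * k (- y)\<close>: translate \<open>x\<close> by \<open>y\<close> on the right, then \<open>y\<close> by \<open>x\<close> on
  the left.\<close>

lemma (in haar_subgroup) nn_integral_uminus:
  assumes S: "S = UNIV" and [measurable]: "k \<in> borel_measurable borel"
  shows "(\<integral>\<^sup>+x. k (- x) \<partial>m) = (\<integral>\<^sup>+x. k x \<partial>m)"
proof -
  have [measurable_cong]: "sets m = sets borel" using sets_m S by simp
  interpret pair_sigma_finite m m ..
  obtain V K0 where V: "open V" "compact K0" "(0::'g) \<in> V" "V \<subseteq> K0"
    using locally_compact[of "0::'g"] by metis
  have [measurable]: "V \<in> sets borel" using V by auto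
  \<comment> \<open>Any function with positive finite integral would serve; it is cancelled at the
    end.\<close>
  define f :: "'g \<Rightarrow> ennreal" where "f = indicator V"
  have [measurable]: "f \<in> borel_measurable borel" unfolding f_def by measurable
  have f: "(\<integral>\<^sup>+x. f x \<partial>m) = emeasure m V" unfolding f_def by simp
  have pos: "emeasure m V > 0" using open_positive[OF V(1,3)] S by simp
  have "emeasure m V \<le> emeasure m K0" using V(2,4) by (intro emeasure_mono) (auto simp: compact_imp_closed)
  then have fin: "emeasure m V < \<infinity>" using compact_finite[OF V(2)] S by (simp add: le_less_trans)
  have "(\<integral>\<^sup>+x. f x \<partial>m) * (\<integral>\<^sup>+y. k (- y) \<partial>m) = (\<integral>\<^sup>+y. (\<integral>\<^sup>+x. f x \<partial>m) * k (- y) \<partial>m)"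
    by (rule nn_integral_cmult[symmetric]) measurable
  also have "\<dots> = (\<integral>\<^sup>+y. (\<integral>\<^sup>+x. f (x + y) * k (- y) \<partial>m) \<partial>m)"
  proof (rule nn_integral_cong)
    fix y
    have "(\<integral>\<^sup>+x. f (x + y) * k (- y) \<partial>m) = (\<integral>\<^sup>+x. f x * k (- y) \<partial>m)"
      using nn_integral_right[of y "\<lambda>x. f x * k (- y)"] S by simp
    also have "\<dots> = (\<integral>\<^sup>+x. f x \<partial>m) * k (- y)"
      by (rule nn_integral_multc) measurable
    finally show "(\<integral>\<^sup>+x. f x \<partial>m) * k (- y) = (\<integral>\<^sup>+x. f (x + y) * k (- y) \<partial>m)" by simp
  qed
  also have "\<dots> = (\<integral>\<^sup>+x. (\<integral>\<^sup>+y. f (x + y) * k (- y) \<partial>m) \<partial>m)"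
    by (rule Fubini') measurable
  also have "\<dots> = (\<integral>\<^sup>+x. (\<integral>\<^sup>+y. f y * k (- y + x) \<partial>m) \<partial>m)"
  proof (rule nn_integral_cong)
    fix x
    show "(\<integral>\<^sup>+y. f (x + y) * k (- y) \<partial>m) = (\<integral>\<^sup>+y. f y * k (- y + x) \<partial>m)"
      using nn_integral_left[of x "\<lambda>y. f y * k (- y + x)"] S by (simp add: minus_add add.assoc)
  qed
  also have "\<dots> = (\<integral>\<^sup>+y. (\<integral>\<^sup>+x. f y * k (- y + x) \<partial>m) \<partial>m)"
    by (rule Fubini') measurable
  also have "\<dots> = (\<integral>\<^sup>+y. f y * (\<integral>\<^sup>+x. k x \<partial>m) \<partial>m)"
  proof (rule nn_integral_cong)
    fix y
    have "(\<integral>\<^sup>+x. f y * k (- y + x) \<partial>m) = f y * (\<integral>\<^sup>+x. k (- y + x) \<partial>m)"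
      by (rule nn_integral_cmult) measurable
    then show "(\<integral>\<^sup>+x. f y * k (- y + x) \<partial>m) = f y * (\<integral>\<^sup>+x. k x \<partial>m)"
      using nn_integral_left[of "- y" k] S by simp
  qed
  also have "\<dots> = (\<integral>\<^sup>+x. f x \<partial>m) * (\<integral>\<^sup>+x. k x \<partial>m)"
    by (rule nn_integral_multc) measurable
  finally show ?thesis
    unfolding f using pos fin by (subst (asm) ennreal_mult_cancel_left) auto
qed

lemma (in haar_subgroup) integral_uminus:
  fixes k :: "'g \<Rightarrow> complex"
  assumes S: "S = UNIV" and [measurable]: "k \<in> borel_measurable borel"
  shows "(LINT x|m. k (- x)) = (LINT x|m. k x)"
proof -
  have [measurable_cong]: "sets m = sets borel" using sets_m S by simp
  have "distr m m uminus = m"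
  proof (rule measure_eqI)
    fix A assume "A \<in> sets (distr m m uminus)"
    then have [measurable]: "A \<in> sets borel" by (simp add: sets_m S)
    have "emeasure (distr m m uminus) A = (\<integral>\<^sup>+x. indicator A (- x) \<partial>m)"
      by (subst emeasure_distr) (auto simp: S nn_integral_indicator[symmetric] indicator_def vimage_def
          simp del: nn_integral_indicator intro!: nn_integral_cong)
    then show "emeasure (distr m m uminus) A = emeasure m A"
      by (simp add: nn_integral_uminus[OF S])
  qed simp
  then show ?thesis using integral_distr[of uminus m m k] by simp
qed

section \<open>Integration on the coset space\<close>

text \<open>The choice \<open>rep\<close> itself need not be measurable. An invariant continuous
  \<open>w\<close>, however, descends to the quotient topology, whose open sets generate
  \<open>coset_borel\<close>.\<close>

lemma borel_measurable_rep:
  fixes w :: "'g::lcsc_group_add \<Rightarrow> 'b::topological_space"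
  assumes H: "is_subgroup H" and space: "space N = cosets H" and sets: "sets N = sets (coset_borel H)"
    and cont: "continuous_on UNIV w" and inv: "\<And>h g. h \<in> H \<Longrightarrow> w (h + g) = w g"
  shows "(\<lambda>c. w (rep c)) \<in> borel_measurable N"
proof (rule borel_measurableI)
  fix U :: "'b set" assume "open U"
  have w: "w (rep (coset H g)) = w g" for g by (rule rep_coset[OF H, of g]) (simp add: inv)
  let ?A = "(\<lambda>c. w (rep c)) -` U \<inter> space N"
  have "coset H -` ?A = w -` U" by (auto simp: w space cosets_def)
  then have "openin (coset_topology H) ?A"
    using open_vimage[OF \<open>open U\<close> cont] by (auto simp: openin_coset_topology space)
  moreover have "{U. openin (coset_topology H) U} \<subseteq> Pow (cosets H)"
    by (auto simp: openin_coset_topology)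
  ultimately show "?A \<in> sets N"
    unfolding sets coset_borel_def by (auto intro: sigma_sets.Basic)
qed

text \<open>Weil's formula for \<open>\<rho> g * w g\<close>: invariance takes \<open>w\<close> out
  of the fibre integral, and what remains is 1 wherever \<open>w\<close> is nonzero.\<close>

lemma quotient_measure_nn_integral:
  fixes w :: "'g::lcsc_group_add \<Rightarrow> ennreal"
  assumes H: "haar_subgroup H mH" and G: "haar_measure UNIV mG"
    and q: "quotient_measure H mG mH mHG"
    and [measurable]: "\<rho> \<in> borel_measurable borel" "w \<in> borel_measurable borel"
    and inv: "\<And>h g. h \<in> H \<Longrightarrow> w (h + g) = w g"
    and \<rho>: "\<And>g. w g \<noteq> 0 \<Longrightarrow> (\<integral>\<^sup>+h. \<rho> (h + g) \<partial>mH) = 1"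
  shows "(\<integral>\<^sup>+c. w (rep c) \<partial>mHG) = (\<integral>\<^sup>+g. \<rho> g * w g \<partial>mG)"
proof -
  interpret haar_subgroup H mH by fact
  have "sets mG = sets borel" using G by (auto simp: haar_measure_def)
  have "(\<integral>\<^sup>+g. \<rho> g * w g \<partial>mG) = (\<integral>\<^sup>+c. (\<integral>\<^sup>+h. \<rho> (h + rep c) * w (h + rep c) \<partial>mH) \<partial>mHG)"
  proof -
    have "(\<lambda>g. \<rho> g * w g) \<in> borel_measurable mG"
      unfolding measurable_cong_sets[OF \<open>sets mG = sets borel\<close> refl] by measurable
    then show ?thesis using q unfolding quotient_measure_def by blast
  qed
  also have "\<dots> = (\<integral>\<^sup>+c. w (rep c) \<partial>mHG)"
  proof (rule nn_integral_cong)
    fix c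
    have "(\<integral>\<^sup>+h. \<rho> (h + rep c) * w (h + rep c) \<partial>mH) = (\<integral>\<^sup>+h. \<rho> (h + rep c) * w (rep c) \<partial>mH)"
      by (rule nn_integral_cong) (simp add: inv)
    also have "\<dots> = (\<integral>\<^sup>+h. \<rho> (h + rep c) \<partial>mH) * w (rep c)"
      by (rule nn_integral_multc) measurable
    also have "\<dots> = w (rep c)" using \<rho>[of "rep c"] by (cases "w (rep c) = 0") auto
    finally show "(\<integral>\<^sup>+h. \<rho> (h + rep c) * w (h + rep c) \<partial>mH) = w (rep c)" .
  qed
  finally show ?thesis by simp
qed

lemma quotient_measure_integral:
  fixes w :: "'g::lcsc_group_add \<Rightarrow> complex" and \<rho> :: "'g \<Rightarrow> real"
  assumes H: "haar_subgroup H mH" and G: "haar_measure UNIV mG"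
    and q: "quotient_measure H mG mH mHG"
    and \<rho>m: "\<rho> \<in> borel_measurable borel" and \<rho>0: "\<And>g. 0 \<le> \<rho> g" and cont: "continuous_on UNIV w"
    and inv: "\<And>h g. h \<in> H \<Longrightarrow> w (h + g) = w g"
    and \<rho>: "\<And>g. w g \<noteq> 0 \<Longrightarrow> (\<integral>\<^sup>+h. ennreal (\<rho> (h + g)) \<partial>mH) = 1"
    and int: "integrable mG (\<lambda>g. \<rho> g * w g)"
  shows "(LINT c|mHG. w (rep c)) = (LINT g|mG. \<rho> g * w g)"
proof -
  interpret haar_subgroup H mH by fact
  have space: "space mHG = cosets H" and sets: "sets mHG = sets (coset_borel H)"
    using q by (auto simp: quotient_measure_def)
  \<comment> \<open>\<open>ennreal\<close> sends negative reals to 0, so the instances for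
    \<open>u\<close> and \<open>- u\<close> are the positive and the negative part of a real
    integral.\<close>
  have nn: "(\<integral>\<^sup>+c. ennreal (u (rep c)) \<partial>mHG) = (\<integral>\<^sup>+g. ennreal (\<rho> g * u g) \<partial>mG)"
    if u: "continuous_on UNIV u" "\<And>h g. h \<in> H \<Longrightarrow> u (h + g) = u g" "\<And>g. w g = 0 \<Longrightarrow> u g = 0" for u
  proof -
    have [measurable]: "u \<in> borel_measurable borel" using u(1) by (rule borel_measurable_continuous_onI)
    have "(\<integral>\<^sup>+c. ennreal (u (rep c)) \<partial>mHG) = (\<integral>\<^sup>+g. ennreal (\<rho> g) * ennreal (u g) \<partial>mG)"
    proof (rule quotient_measure_nn_integral[OF H G q])
      fix g assume "ennreal (u g) \<noteq> 0"
      then have "w g \<noteq> 0" using u(3) by fastforce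
      then show "(\<integral>\<^sup>+h. ennreal (\<rho> (h + g)) \<partial>mH) = 1" by (rule \<rho>)
    qed (use u \<rho>m in auto)
    then show ?thesis by (simp add: ennreal_mult' \<rho>0)
  qed
  have real: "(LINT c|mHG. u (rep c)) = (LINT g|mG. \<rho> g * u g) \<and> integrable mHG (\<lambda>c. u (rep c))"
    if u: "continuous_on UNIV u" "\<And>h g. h \<in> H \<Longrightarrow> u (h + g) = u g" "\<And>g. w g = 0 \<Longrightarrow> u g = 0"
      and i: "integrable mG (\<lambda>g. \<rho> g * u g)" for u :: "'g \<Rightarrow> real"
  proof -
    have m: "(\<lambda>c. u (rep c)) \<in> borel_measurable mHG"
      using borel_measurable_rep[OF subgroup space sets u(1,2)] by simp
    have "(\<integral>\<^sup>+c. ennreal \<bar>u (rep c)\<bar> \<partial>mHG) = (\<integral>\<^sup>+g. ennreal (\<rho> g * \<bar>u g\<bar>) \<partial>mG)"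
      by (rule nn) (use u in \<open>auto intro: continuous_intros\<close>)
    also have "\<dots> < \<infinity>" using i \<rho>0 by (simp add: integrable_iff_bounded abs_mult)
    finally have i': "integrable mHG (\<lambda>c. u (rep c))"
      using m by (simp add: integrable_iff_bounded)
    have "(\<integral>\<^sup>+c. ennreal (- u (rep c)) \<partial>mHG) = (\<integral>\<^sup>+g. ennreal (\<rho> g * - u g) \<partial>mG)"
      using u by (intro nn) (auto intro: continuous_intros)
    then show ?thesis
      using i i' nn[OF u] by (simp add: real_lebesgue_integral_def)
  qed
  have cR: "continuous_on UNIV (\<lambda>g. Re (w g))" and cI: "continuous_on UNIV (\<lambda>g. Im (w g))"
    using cont by (auto intro: continuous_intros)
  have R: "(LINT c|mHG. Re (w (rep c))) = (LINT g|mG. \<rho> g * Re (w g)) \<and> integrable mHG (\<lambda>c. Re (w (rep c)))"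
    using integrable_Re[OF int] by (intro real cR) (auto simp: inv)
  have I: "(LINT c|mHG. Im (w (rep c))) = (LINT g|mG. \<rho> g * Im (w g)) \<and> integrable mHG (\<lambda>c. Im (w (rep c)))"
    using integrable_Im[OF int] by (intro real cI) (auto simp: inv)
  have "integrable mHG (\<lambda>c. complex_of_real (Re (w (rep c))) + \<i> * complex_of_real (Im (w (rep c))))"
    using R I by auto
  then have i: "integrable mHG (\<lambda>c. w (rep c))" by (simp add: complex_eq[symmetric])
  have "(LINT c|mHG. Re (w (rep c))) = Re (LINT c|mHG. w (rep c))"
    "(LINT c|mHG. Im (w (rep c))) = Im (LINT c|mHG. w (rep c))"
    using integral_Re[OF i] integral_Im[OF i] by auto
  moreover have "(LINT g|mG. \<rho> g * Re (w g)) = Re (LINT g|mG. \<rho> g * w g)"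
    "(LINT g|mG. \<rho> g * Im (w g)) = Im (LINT g|mG. \<rho> g * w g)"
    using integral_Re[OF int] integral_Im[OF int] by auto
  ultimately show ?thesis using R I by (simp add: complex_eq_iff)
qed

section \<open>Transverse systems\<close>

lemma borel_measurable_completion_AE:
  fixes f g :: "'a \<Rightarrow> 'b::topological_space"
  assumes g: "g \<in> borel_measurable (completion M)" and eq: "AE x in M. f x = g x"
  shows "f \<in> borel_measurable (completion M)"
proof (rule borel_measurableI)
  fix U :: "'b set" assume "open U"
  obtain N where N: "N \<in> null_sets M" "{x \<in> space M. f x \<noteq> g x} \<subseteq> N"
    using eq by (auto elim: AE_E simp: null_sets_def)
  have "f -` U \<inter> space M = (g -` U \<inter> space M - N) \<union> (f -` U \<inter> space M \<inter> N)"
    using N(2) by auto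
  moreover have "g -` U \<inter> space M \<in> sets (completion M)"
    using measurable_sets[OF g, of U] \<open>open U\<close> by simp
  moreover have "f -` U \<inter> space M \<inter> N \<in> null_sets (completion M)"
    using null_sets_completion_subset[OF _ null_sets_completionI[OF N(1)]] by auto
  ultimately show "f -` U \<inter> space (completion M) \<in> sets (completion M)"
    using null_sets_completionI[OF N(1)] by (metis null_setsD2 sets.Diff sets.Un space_completion)
qed

lemma completion_ex_borel_measurable_complex:
  fixes f :: "'a \<Rightarrow> complex"
  assumes f: "f \<in> borel_measurable (completion M)"
  shows "\<exists>f'\<in>borel_measurable M. AE x in M. f x = f' x"
proof -
  obtain r where r: "r \<in> borel_measurable M" "AE x in M. Re (f x) = r x"
    using completion_ex_borel_measurable_real[of "\<lambda>x. Re (f x)" M] f by auto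
  obtain i where i: "i \<in> borel_measurable M" "AE x in M. Im (f x) = i x"
    using completion_ex_borel_measurable_real[of "\<lambda>x. Im (f x)" M] f by auto
  show ?thesis
  proof
    show "(\<lambda>x. complex_of_real (r x) + \<i> * complex_of_real (i x)) \<in> borel_measurable M"
      using r i by auto
    show "AE x in M. f x = complex_of_real (r x) + \<i> * complex_of_real (i x)"
      using r(2) i(2) by eventually_elim (simp add: complex_eq_iff)
  qed
qed

text \<open>\<open>\<sigma>_nonzero\<close> will follow from the eigenfunction being nonzero. Here
  it provides the test function with nonzero integral in \<open>Wsum_integrable\<close>.\<close>

locale transverse_system = H: haar_subgroup H mH + G: haar_subgroup UNIV mG
  for H :: "'g::lcsc_group_add set" and mH mG :: "'g measure" +
  fixes act :: "'g \<Rightarrow> 'x \<Rightarrow> 'x" and \<mu> :: "'x measure" and Y :: "'x set" and \<sigma> :: "'x measure"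
  assumes G_space: "borel_G_space act \<mu>" and invariant: "invariant_probability act \<mu>"
    and cross_section: "cross_section act \<mu> H Y"
    and square_integrable: "square_integrable_system act \<mu> H Y"
    and transverse: "transverse_measure act \<mu> H Y mG mH \<sigma>"
    and \<sigma>_nonzero: "measure \<sigma> Y \<noteq> 0"
begin

sublocale prob_space \<mu>
  using invariant by (simp add: invariant_probability_def)

sublocale \<sigma>: finite_measure \<sigma>
  using transverse by (simp add: transverse_measure_def)

lemma space_\<sigma> [simp]: "space \<sigma> = Y" and sets_\<sigma>: "sets \<sigma> = sets (restrict_space \<mu> Y)"
  using transverse by (auto simp: transverse_measure_def)

lemma sets_mG: "sets mG = sets borel"
  using G.sets_m by simp

sublocale P: pair_sigma_finite mG \<sigma> ..

abbreviation P :: "('g \<times> 'x) measure" where "P \<equiv> mG \<Otimes>\<^sub>M \<sigma>"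

lemma sets_P: "sets P = sets (borel \<Otimes>\<^sub>M restrict_space \<mu> Y)"
  by (rule sets_pair_measure_cong[OF sets_mG sets_\<sigma>])

lemma space_P: "space P = UNIV \<times> Y"
  by (simp add: space_pair_measure)

lemma Y_sets [measurable]: "Y \<in> sets \<mu>"
  using cross_section by (simp add: cross_section_def)

lemma Y_space: "y \<in> Y \<Longrightarrow> y \<in> space \<mu>"
  using sets.sets_into_space[OF Y_sets] by auto

lemma act_pair_measurable: "(\<lambda>(g, x). act g x) \<in> measurable (borel \<Otimes>\<^sub>M \<mu>) \<mu>"
  using G_space by (simp add: borel_G_space_def)

lemma act_measurable [measurable (raw)]:
  assumes "f \<in> borel_measurable N" "k \<in> measurable N \<mu>"
  shows "(\<lambda>z. act (f z) (k z)) \<in> measurable N \<mu>"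
  using measurable_compose[OF measurable_Pair[OF assms] act_pair_measurable] by simp

lemma act_space: "x \<in> space \<mu> \<Longrightarrow> act g x \<in> space \<mu>"
  using measurable_space[OF act_measurable[of "\<lambda>_. g" \<mu> "\<lambda>x. x"]] by simp

lemma act_0: "x \<in> space \<mu> \<Longrightarrow> act 0 x = x"
  and act_add: "x \<in> space \<mu> \<Longrightarrow> act (g + h) x = act g (act h x)"
  using G_space by (auto simp: borel_G_space_def)

lemma act_minus: "x \<in> space \<mu> \<Longrightarrow> act (- g) (act g x) = x"
  using act_add[of x "- g" g] act_0 by simp

lemma act_Y: "h \<in> H \<Longrightarrow> y \<in> Y \<Longrightarrow> act h y \<in> Y"
  using cross_section unfolding cross_section_def by blast

lemma act_Y_iff: "x \<in> space \<mu> \<Longrightarrow> h \<in> H \<Longrightarrow> act h x \<in> Y \<longleftrightarrow> x \<in> Y"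
  using act_Y act_minus H.uminus_mem by metis

lemma measurable_\<sigma>_\<mu> [measurable]: "(\<lambda>y. y) \<in> measurable \<sigma> \<mu>"
  unfolding measurable_cong_sets[OF sets_\<sigma> refl] by (rule measurable_restrict_space1) simp

lemma act_\<sigma>_measurable: "h \<in> H \<Longrightarrow> act h \<in> measurable \<sigma> \<sigma>"
  unfolding measurable_cong_sets[OF refl sets_\<sigma>]
  by (rule measurable_restrict_space2) (auto intro: act_Y)

lemma distr_\<sigma>: "h \<in> H \<Longrightarrow> distr \<sigma> \<sigma> (act h) = \<sigma>"
  using transverse by (simp add: transverse_measure_def)

text \<open>The invariance of \<open>\<sigma>\<close> in the form used by the averaging: the point
  of \<open>Y\<close> moves while the group coordinate stays fixed.\<close>

lemma distr_P:
  assumes "h \<in> H"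
  shows "distr P P (\<lambda>(g, y). (g, act h y)) = P"
proof -
  have "distr mG mG (\<lambda>g. g) \<Otimes>\<^sub>M distr \<sigma> \<sigma> (act h) = distr P P (\<lambda>(g, y). (g, act h y))"
    by (rule pair_measure_distr)
       (use assms act_\<sigma>_measurable distr_\<sigma> \<sigma>.sigma_finite_measure_axioms in auto)
  then show ?thesis using distr_\<sigma>[OF assms] by (simp add: distr_id)
qed

lemma twist_measurable: "h \<in> H \<Longrightarrow> (\<lambda>(g, y). (g, act h y)) \<in> measurable P P"
  using act_\<sigma>_measurable[of h] by measurable

section \<open>Hitting sets and their local finiteness\<close>

abbreviation hits :: "'x \<Rightarrow> 'g set set" where "hits x \<equiv> hitting act H Y x"

lemma coset_mem_hits:
  assumes "x \<in> space \<mu>"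
  shows "coset H g \<in> hits x \<longleftrightarrow> act g x \<in> Y"
proof
  assume "coset H g \<in> hits x"
  then obtain g' where g': "g - g' \<in> H" "act g' x \<in> Y"
    by (auto simp: hitting_def coset_eq_iff[OF H.subgroup])
  have "act g x = act (g - g') (act g' x)" using act_add[OF assms, of "g - g'" g'] by simp
  then show "act g x \<in> Y" using act_Y g' by simp
qed (auto simp: hitting_def)

lemma hits_cosets: "c \<in> hits x \<Longrightarrow> c \<in> cosets H"
  by (auto simp: hitting_def cosets_def)

lemma rep_hits:
  assumes "x \<in> space \<mu>" "c \<in> hits x"
  shows "act (rep c) x \<in> Y"
  using coset_mem_hits[OF assms(1), of "rep c"] coset_rep[OF H.subgroup hits_cosets[OF assms(2)]] assms(2)
  by simp

lemma act_rep_Y: "x \<in> space \<mu> \<Longrightarrow> c \<in> hits x \<Longrightarrow> h \<in> H \<Longrightarrow> act (h + rep c) x \<in> Y"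
  using rep_hits by (simp add: act_add act_Y)

definition D :: "nat \<Rightarrow> 'g set" where
  "D = (SOME D. (\<forall>n. compact (D n)) \<and> (\<forall>C. compact C \<longrightarrow> (\<exists>n. C \<subseteq> D n)))"

lemma D_compact: "compact (D n)" and D_exhausts: "compact C \<Longrightarrow> \<exists>n. C \<subseteq> D n"
proof -
  have "\<exists>D :: nat \<Rightarrow> 'g set. (\<forall>n. compact (D n)) \<and> (\<forall>C. compact C \<longrightarrow> (\<exists>n. C \<subseteq> D n))"
    by (rule compact_cover_exhaustion) blast
  from someI_ex[OF this] have "(\<forall>n. compact (D n)) \<and> (\<forall>C. compact C \<longrightarrow> (\<exists>n. C \<subseteq> D n))"
    unfolding D_def .
  then show "compact (D n)" "compact C \<Longrightarrow> \<exists>n. C \<subseteq> D n" by auto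
qed

lemma D_cover: "\<exists>n. g \<in> D n"
  using D_exhausts[of "{g}"] by auto

definition locally_finite_hits :: "'x \<Rightarrow> bool" where
  "locally_finite_hits x \<longleftrightarrow> (\<forall>C. compact C \<longrightarrow> finite (hits x \<inter> coset H ` C))"

text \<open>Integrability of the squared count makes the count over each \<open>D n\<close> finite
  almost everywhere, and the exhaustion provides one null set for all compact sets.\<close>

lemma AE_locally_finite_hits: "AE x in \<mu>. locally_finite_hits x"
proof -
  have "AE x in \<mu>. finite (hits x \<inter> coset H ` D n)" for n
  proof -
    let ?e = "\<lambda>x. emeasure (count_space UNIV) (hits x \<inter> coset H ` D n)"
    have "?e \<in> borel_measurable (completion \<mu>)" "(\<integral>\<^sup>+ x. (?e x)\<^sup>2 \<partial>completion \<mu>) < \<infinity>"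
      using square_integrable compactin_coset_image[OF D_compact]
      by (auto simp: square_integrable_system_def)
    then have "AE x in completion \<mu>. (?e x)\<^sup>2 \<noteq> \<infinity>"
      by (intro nn_integral_PInf_AE) auto
    then have "AE x in \<mu>. (?e x)\<^sup>2 \<noteq> \<infinity>" by (simp add: AE_completion_iff)
    then show ?thesis
      by eventually_elim (auto simp: emeasure_count_space split: if_splits)
  qed
  then have "AE x in \<mu>. \<forall>n. finite (hits x \<inter> coset H ` D n)" by (simp add: AE_all_countable)
  then show ?thesis
  proof eventually_elim
    case (elim x)
    have "finite (hits x \<inter> coset H ` C)" if "compact C" for C
    proof -
      obtain n where "C \<subseteq> D n" using D_exhausts[OF \<open>compact C\<close>] by auto
      then have "hits x \<inter> coset H ` C \<subseteq> hits x \<inter> coset H ` D n" by (intro Int_mono image_mono order_refl)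
      then show ?thesis using elim finite_subset by blast
    qed
    then show ?case by (simp add: locally_finite_hits_def)
  qed
qed

section \<open>Test functions for the transverse formula\<close>

definition admissible :: "('g \<times> 'x \<Rightarrow> complex) \<Rightarrow> bool" where
  "admissible F \<longleftrightarrow> F \<in> borel_measurable P \<and> (\<exists>B. \<forall>g. \<forall>y\<in>Y. cmod (F (g, y)) \<le> B) \<and>
     (\<exists>K. compact K \<and> (\<forall>g. \<forall>y\<in>Y. g \<notin> K \<longrightarrow> F (g, y) = 0))"

lemma admissibleI:
  assumes "F \<in> borel_measurable P" "\<And>g y. y \<in> Y \<Longrightarrow> cmod (F (g, y)) \<le> B"
    "compact K" "\<And>g y. y \<in> Y \<Longrightarrow> g \<notin> K \<Longrightarrow> F (g, y) = 0"
  shows "admissible F"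
  using assms by (auto simp: admissible_def)

lemma admissibleE:
  assumes "admissible F"
  obtains B K where "F \<in> borel_measurable P" "\<And>g y. y \<in> Y \<Longrightarrow> cmod (F (g, y)) \<le> B"
    "compact K" "\<And>g y. y \<in> Y \<Longrightarrow> g \<notin> K \<Longrightarrow> F (g, y) = 0"
  using assms unfolding admissible_def by blast

lemma admissible_integrable:
  assumes "admissible F"
  shows "integrable P F"
proof -
  obtain B K where F: "F \<in> borel_measurable P" "\<And>g y. y \<in> Y \<Longrightarrow> cmod (F (g, y)) \<le> B"
    "compact K" "\<And>g y. y \<in> Y \<Longrightarrow> g \<notin> K \<Longrightarrow> F (g, y) = 0"
    using assms by (rule admissibleE) blast
  have K: "K \<in> sets mG" using F(3) by (simp add: sets_mG compact_imp_closed)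
  have "Y \<in> sets \<sigma>" using sets.top[of \<sigma>] by simp
  then have "emeasure P (K \<times> Y) = emeasure mG K * emeasure \<sigma> Y"
    using K by (intro \<sigma>.emeasure_pair_measure_Times)
  moreover have "emeasure \<sigma> Y < \<top>" by (simp add: less_top[symmetric])
  ultimately have fin: "emeasure P (K \<times> Y) < \<infinity>"
    using G.compact_finite[OF F(3)] by (simp add: ennreal_mult_less_top)
  show ?thesis
  proof (rule integrableI_bounded_set[of "K \<times> Y" _ _ B])
    show "AE z in P. z \<in> K \<times> Y \<longrightarrow> norm (F z) \<le> B" using F(2) by (auto intro!: AE_I2)
    show "AE z in P. z \<notin> K \<times> Y \<longrightarrow> F z = 0"
    proof (intro AE_I2 impI)
      fix z assume "z \<in> space P" "z \<notin> K \<times> Y"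
      then show "F z = 0" using F(4)[of "snd z" "fst z"] by (auto simp: space_P mem_Times_iff)
    qed
  qed (use F K fin \<open>Y \<in> sets \<sigma>\<close> in auto)
qed

text \<open>The integrand over \<open>X\<close> in the transverse formula.\<close>

definition Wsum :: "('g \<times> 'x \<Rightarrow> complex) \<Rightarrow> 'x \<Rightarrow> complex" where
  "Wsum F x = (\<Sum>\<^sub>\<infinity>c\<in>hits x. LINT h|mH. F (- (h + rep c), act (h + rep c) x))"

lemma integral_Wsum:
  assumes "admissible F"
  shows "(LINT x|completion \<mu>. Wsum F x) = integral\<^sup>L P F"
proof -
  have "F \<in> borel_measurable (borel \<Otimes>\<^sub>M restrict_space \<mu> Y)"
    using assms sets_P by (simp add: admissible_def cong: measurable_cong_sets)
  then have "(LINT x|completion \<mu>. Wsum F x) = (LINT g|mG. LINT y|\<sigma>. F (g, y))"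
    using assms transverse unfolding transverse_measure_def Wsum_def admissible_def by blast
  then show ?thesis using P.integral_fst'[OF admissible_integrable[OF assms]] by simp
qed

lemma admissible_fibre_integrable:
  assumes F: "admissible F" and x: "x \<in> space \<mu>" and c: "c \<in> hits x"
  shows "integrable mH (\<lambda>h. F (- (h + rep c), act (h + rep c) x))"
proof -
  obtain B K where FB: "F \<in> borel_measurable P" "\<And>g y. y \<in> Y \<Longrightarrow> cmod (F (g, y)) \<le> B"
    "compact K" "\<And>g y. y \<in> Y \<Longrightarrow> g \<notin> K \<Longrightarrow> F (g, y) = 0"
    using F by (rule admissibleE) blast
  \<comment> \<open>\<open>?K\<close> is the trace of the support of \<open>F\<close> on the fibre
    over \<open>c\<close>, read off as a compact subset of \<open>H\<close>.\<close>
  let ?r = "rep c" and ?K = "(\<lambda>g. - g - rep c) ` K \<inter> H"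
  have act: "(\<lambda>h. act (h + ?r) x) \<in> measurable mH \<sigma>"
    unfolding measurable_cong_sets[OF refl sets_\<sigma>]
    by (rule measurable_restrict_space2) (use act_rep_Y[OF x c] x in auto)
  have "(\<lambda>h. - (h + ?r)) \<in> measurable mH mG"
    unfolding measurable_cong_sets[OF refl sets_mG] by measurable
  then have "(\<lambda>h. (- (h + ?r), act (h + ?r) x)) \<in> measurable mH P"
    using act by (rule measurable_Pair)
  then have m: "(\<lambda>h. F (- (h + ?r), act (h + ?r) x)) \<in> borel_measurable mH"
    by (rule measurable_compose) (rule FB(1))
  have "compact ((\<lambda>g. - g - rep c) ` K)"
    by (rule compact_continuous_image[OF _ FB(3)]) (intro continuous_on_diff_group continuous_intros)
  then have cK: "compact ?K" using H.closed_S by (simp add: compact_Int_closed)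
  have "?K \<in> sets borel" using cK by (simp add: compact_imp_closed)
  then have KH: "?K \<in> sets mH" by (auto simp: H.sets_m sets_restrict_space)
  show ?thesis
  proof (rule integrableI_bounded_set[OF KH m, of B])
    show "emeasure mH ?K < \<infinity>" by (rule H.compact_finite[OF cK]) simp
    show "AE h in mH. h \<in> ?K \<longrightarrow> norm (F (- (h + ?r), act (h + ?r) x)) \<le> B"
      using FB(2) act_rep_Y[OF x c] by (intro AE_I2) auto
    have "h \<in> ?K" if "h \<in> H" "- (h + ?r) \<in> K" for h
      using that by (auto simp: image_iff intro!: bexI[where x="- (h + ?r)"] simp: minus_add)
    then show "AE h in mH. h \<notin> ?K \<longrightarrow> F (- (h + ?r), act (h + ?r) x) = 0"
      using FB(4) act_rep_Y[OF x c] by (intro AE_I2) auto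
  qed
qed

lemma infsum_hits:
  fixes u :: "'g set \<Rightarrow> complex"
  assumes "\<And>c. c \<in> hits x \<Longrightarrow> c \<notin> coset H ` C \<Longrightarrow> u c = 0" "finite (hits x \<inter> coset H ` C)"
  shows "(\<Sum>\<^sub>\<infinity>c\<in>hits x. u c) = (\<Sum>c\<in>hits x \<inter> coset H ` C. u c)"
proof -
  have "(\<Sum>\<^sub>\<infinity>c\<in>hits x. u c) = (\<Sum>\<^sub>\<infinity>c\<in>hits x \<inter> coset H ` C. u c)"
    by (rule infsum_cong_neutral) (use assms(1) in auto)
  then show ?thesis using assms(2) by simp
qed

text \<open>The group argument of \<open>F\<close> is inverted in \<open>Wsum\<close>, so only
  cosets that meet the inverse of \<open>K\<close> contribute. With finitely many terms, additivity
  requires no discussion of summability.\<close>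

lemma Wsum_eq_sum:
  assumes x: "x \<in> space \<mu>" "locally_finite_hits x" and K: "compact K"
    and F: "\<And>g y. y \<in> Y \<Longrightarrow> g \<notin> K \<Longrightarrow> F (g, y) = 0"
  shows "Wsum F x = (\<Sum>c\<in>hits x \<inter> coset H ` (uminus ` K). LINT h|mH. F (- (h + rep c), act (h + rep c) x))"
  unfolding Wsum_def
proof (rule infsum_hits)
  have "compact (uminus ` K)" by (rule compact_continuous_image[OF _ K]) (intro continuous_intros)
  then show "finite (hits x \<inter> coset H ` (uminus ` K))" using x(2) by (simp add: locally_finite_hits_def)
  fix c assume c: "c \<in> hits x" "c \<notin> coset H ` (uminus ` K)"
  have "F (- (h + rep c), act (h + rep c) x) = 0" if "h \<in> H" for h
  proof (rule F[OF act_rep_Y[OF x(1) c(1) that]])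
    show "- (h + rep c) \<notin> K"
    proof
      assume "- (h + rep c) \<in> K"
      then have "h + rep c \<in> uminus ` K" by (metis image_eqI minus_minus)
      moreover have "c = coset H (h + rep c)"
        using coset_add[OF H.subgroup that] coset_rep[OF H.subgroup hits_cosets[OF c(1)]] by simp
      ultimately show False using c(2) by blast
    qed
  qed
  then show "(LINT h|mH. F (- (h + rep c), act (h + rep c) x)) = 0"
    by (intro integral_eq_zero_AE AE_I2) simp
qed

lemma Wsum_add:
  assumes x: "x \<in> space \<mu>" "locally_finite_hits x" and F: "admissible F" "admissible F'"
  shows "Wsum (\<lambda>z. F z + F' z) x = Wsum F x + Wsum F' x"
proof -
  obtain K where K: "compact K" "\<And>g y. y \<in> Y \<Longrightarrow> g \<notin> K \<Longrightarrow> F (g, y) = 0"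
    using F(1) by (rule admissibleE) blast
  obtain K' where K': "compact K'" "\<And>g y. y \<in> Y \<Longrightarrow> g \<notin> K' \<Longrightarrow> F' (g, y) = 0"
    using F(2) by (rule admissibleE) blast
  have KK: "compact (K \<union> K')" using K(1) K'(1) by auto
  show ?thesis
    using K(2) K'(2) admissible_fibre_integrable[OF _ x(1)] F
    by (subst (1 2 3) Wsum_eq_sum[OF x KK]) (auto simp: sum.distrib[symmetric] intro!: sum.cong)
qed

lemma admissible_add:
  assumes "admissible F" "admissible F'"
  shows "admissible (\<lambda>z. F z + F' z)"
proof -
  obtain B K where F: "F \<in> borel_measurable P" "\<And>g y. y \<in> Y \<Longrightarrow> cmod (F (g, y)) \<le> B"
    "compact K" "\<And>g y. y \<in> Y \<Longrightarrow> g \<notin> K \<Longrightarrow> F (g, y) = 0"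
    using assms(1) by (rule admissibleE) blast
  obtain B' K' where F': "F' \<in> borel_measurable P" "\<And>g y. y \<in> Y \<Longrightarrow> cmod (F' (g, y)) \<le> B'"
    "compact K'" "\<And>g y. y \<in> Y \<Longrightarrow> g \<notin> K' \<Longrightarrow> F' (g, y) = 0"
    using assms(2) by (rule admissibleE) blast
  show ?thesis
    by (rule admissibleI[of _ "B + B'" "K \<union> K'"])
       (use F F' in \<open>auto intro!: norm_triangle_mono\<close>)
qed

text \<open>The transverse formula alone does not say that its left-hand side exists, because a
  non-integrable function has integral \<open>0\<close>. But an integrand with nonzero integral is integrable,
  and adding a fixed one of these to \<open>Wsum F\<close> makes the integral nonzero.\<close>

lemma Wsum_integrable:
  assumes F: "admissible F"
  shows "integrable (completion \<mu>) (Wsum F)"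
proof (cases "integral\<^sup>L P F = 0")
  case False
  then show ?thesis using integral_Wsum[OF F] not_integrable_integral_eq by metis
next
  case True
  obtain V K where V: "open V" "compact K" "(0::'g) \<in> V" "V \<subseteq> K"
    using locally_compact[of "0::'g"] by metis
  have [measurable]: "K \<in> sets borel" using V(2) by (simp add: compact_imp_closed)
  define F0 :: "'g \<times> 'x \<Rightarrow> complex" where "F0 z = indicator K (fst z)" for z
  have F0: "admissible F0"
    by (rule admissibleI[of _ 1 K]) (use V in \<open>auto simp: F0_def[abs_def] indicator_def\<close>)
  have "emeasure mG (V \<inter> UNIV) > 0" using V by (intro G.open_positive) auto
  also have "emeasure mG (V \<inter> UNIV) \<le> emeasure mG K"
    using V by (intro emeasure_mono) (auto simp: sets_mG)
  finally have pos: "measure mG K > 0"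
    using G.compact_finite[OF V(2)] by (simp add: measure_def enn2real_positive_iff less_top)
  have "integral\<^sup>L P F0 = (LINT g|mG. LINT y|\<sigma>. F0 (g, y))"
    using P.integral_fst'[OF admissible_integrable[OF F0]] by simp
  also have "\<dots> = complex_of_real (measure mG K * measure \<sigma> Y)"
  proof -
    have "(LINT g|mG. LINT y|\<sigma>. F0 (g, y)) = (LINT g|mG. complex_of_real (indicator K g * measure \<sigma> Y))"
      by (rule Bochner_Integration.integral_cong) (auto simp: F0_def scaleR_conv_of_real indicator_def)
    also have "\<dots> = complex_of_real (LINT g|mG. indicator K g * measure \<sigma> Y)"
      by (rule integral_complex_of_real)
    also have "(LINT g|mG. indicator K g * measure \<sigma> Y) = measure mG K * measure \<sigma> Y"
      by simp
    finally show ?thesis .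
  qed
  finally have I0: "integral\<^sup>L P F0 \<noteq> 0" using pos \<sigma>_nonzero by simp
  have i0: "integrable (completion \<mu>) (Wsum F0)"
    using I0 integral_Wsum[OF F0] not_integrable_integral_eq by metis
  let ?F = "\<lambda>z. F z + F0 z"
  have "integral\<^sup>L P ?F = integral\<^sup>L P F0"
    using True admissible_integrable[OF F] admissible_integrable[OF F0] by simp
  then have i1: "integrable (completion \<mu>) (Wsum ?F)"
    using I0 integral_Wsum[OF admissible_add[OF F F0]] not_integrable_integral_eq by metis
  have i2: "integrable (completion \<mu>) (\<lambda>x. Wsum ?F x - Wsum F0 x)"
    using i0 i1 by simp
  have eq: "AE x in \<mu>. Wsum F x = Wsum ?F x - Wsum F0 x"
    using AE_locally_finite_hits AE_space by eventually_elim (simp add: Wsum_add F F0)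
  show ?thesis
  proof (rule integrable_cong_AE_imp[OF i2])
    show "Wsum F \<in> borel_measurable (completion \<mu>)"
      by (rule borel_measurable_completion_AE[OF borel_measurable_integrable[OF i2] eq])
    show "AE x in completion \<mu>. Wsum ?F x - Wsum F0 x = Wsum F x"
      using AE_completion[OF eq] by eventually_elim simp
  qed
qed

text \<open>In \<open>Wsum\<close> the two arguments are \<open>- g\<close> and
  \<open>act g x\<close>, so \<open>\<phi> (act g y)\<close> collapses to \<open>\<phi> x\<close>.
  Since \<open>E\<close> is constant along each coset, only the weight remains under the fibre
  integral. This is how a function on \<open>X\<close> enters the right-hand side of the transverse
  formula.\<close>

lemma Wsum_weighted:
  fixes \<rho> :: "'g \<Rightarrow> real" and E :: "'g \<Rightarrow> 'x \<Rightarrow> complex"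
  assumes x: "x \<in> space \<mu>"
    and inv: "\<And>g h. h \<in> H \<Longrightarrow> act g x \<in> Y \<Longrightarrow> E (h + g) (act (h + g) x) = E g (act g x)"
  shows "Wsum (\<lambda>(g, y). complex_of_real (\<rho> (- g)) * E (- g) y * \<phi> (act g y)) x =
    (\<Sum>\<^sub>\<infinity>c\<in>hits x. complex_of_real (LINT h|mH. \<rho> (h + rep c)) * E (rep c) (act (rep c) x)) * \<phi> x"
proof -
  have "(LINT h|mH. complex_of_real (\<rho> (- (- (h + rep c)))) * E (- (- (h + rep c))) (act (h + rep c) x) * \<phi> (act (- (h + rep c)) (act (h + rep c) x)))
      = complex_of_real (LINT h|mH. \<rho> (h + rep c)) * E (rep c) (act (rep c) x) * \<phi> x" if "c \<in> hits x" for c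
  proof -
    have "(LINT h|mH. complex_of_real (\<rho> (- (- (h + rep c)))) * E (- (- (h + rep c))) (act (h + rep c) x) * \<phi> (act (- (h + rep c)) (act (h + rep c) x)))
        = (LINT h|mH. complex_of_real (\<rho> (h + rep c)) * (E (rep c) (act (rep c) x) * \<phi> x))"
      by (rule Bochner_Integration.integral_cong)
         (use x inv rep_hits[OF x that] in \<open>auto simp: act_minus\<close>)
    then show ?thesis by (simp add: mult.assoc)
  qed
  then have "Wsum (\<lambda>(g, y). complex_of_real (\<rho> (- g)) * E (- g) y * \<phi> (act g y)) x =
    (\<Sum>\<^sub>\<infinity>c\<in>hits x. complex_of_real (LINT h|mH. \<rho> (h + rep c)) * E (rep c) (act (rep c) x) * \<phi> x)"
    unfolding Wsum_def by (intro infsum_cong) auto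
  then show ?thesis by (simp add: infsum_cmult_left')
qed

text \<open>For the indicator of the pairs with \<open>act g y \<in> N\<close>, cut off at
  \<open>D n\<close>, the integrand over \<open>X\<close> is supported in \<open>N\<close> because
  \<open>g\<close> and its inverse cancel. Hence the integral over \<open>P\<close>
  vanishes.\<close>

lemma AE_P_notin_null:
  assumes N: "N \<in> null_sets \<mu>"
  shows "AE z in P. act (fst z) (snd z) \<notin> N"
proof -
  have [measurable]: "N \<in> sets \<mu>" using N by auto
  have "AE z in P. fst z \<in> D n \<longrightarrow> act (fst z) (snd z) \<notin> N" for n
  proof -
    have [measurable]: "D n \<in> sets borel" using D_compact by (simp add: compact_imp_closed)
    define F :: "'g \<times> 'x \<Rightarrow> real" where "F z = indicator (D n) (fst z) * indicator N (act (fst z) (snd z))" for z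
    have [measurable]: "F \<in> borel_measurable P" unfolding F_def by measurable
    have F: "admissible (\<lambda>z. complex_of_real (F z))"
      by (rule admissibleI[of _ 1 "D n"]) (use D_compact in \<open>auto simp: F_def indicator_def\<close>)
    have "AE x in completion \<mu>. Wsum (\<lambda>z. complex_of_real (F z)) x = 0"
      using AE_completion[OF AE_not_in[OF N]] AE_space
    proof eventually_elim
      case (elim x)
      then have "F (- (h + rep c), act (h + rep c) x) = 0" for h c
        by (simp add: F_def act_minus)
      then show ?case by (simp add: Wsum_def)
    qed
    then have "integral\<^sup>L P (\<lambda>z. complex_of_real (F z)) = 0"
      using integral_Wsum[OF F] integral_eq_zero_AE by metis
    then have "integral\<^sup>L P F = 0" by simp
    moreover have "integrable P F"
      using admissible_integrable[OF F] by (simp add: complex_of_real_integrable_eq)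
    ultimately have "AE z in P. F z = 0"
      by (subst (asm) integral_nonneg_eq_0_iff_AE) (auto simp: F_def)
    then show ?thesis by eventually_elim (auto simp: F_def)
  qed
  then have "AE z in P. \<forall>n. fst z \<in> D n \<longrightarrow> act (fst z) (snd z) \<notin> N"
    unfolding AE_all_countable by blast
  then show ?thesis by eventually_elim (use D_cover in blast)
qed

lemma AE_act_P:
  assumes "AE x in \<mu>. Q x"
  shows "AE z in P. Q (act (fst z) (snd z))"
proof -
  obtain N where N: "N \<in> null_sets \<mu>" "{x \<in> space \<mu>. \<not> Q x} \<subseteq> N"
    using assms by (auto elim: AE_E simp: null_sets_def)
  show ?thesis
    using AE_P_notin_null[OF N(1)] AE_space
  proof eventually_elim
    case (elim z)
    then have "act (fst z) (snd z) \<in> space \<mu>" using act_space Y_space by (auto simp: space_P)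
    then show ?case using elim N(2) by auto
  qed
qed

text \<open>The test function \<open>\<rho> (- g) * indicator Z y\<close> has integral 0 over
  \<open>P\<close>. Its \<open>Wsum\<close> is a sum of nonnegative terms and so vanishes almost
  everywhere; an orbit point in \<open>Z\<close> over \<open>D n\<close> would contribute the term
  1. Invariance of \<open>Z\<close> makes membership a property of the coset.\<close>

lemma AE_avoids_null:
  assumes Z: "Z \<in> null_sets \<sigma>" and inv: "\<And>h y. h \<in> H \<Longrightarrow> y \<in> Z \<Longrightarrow> act h y \<in> Z"
  shows "AE x in \<mu>. \<forall>g. act g x \<notin> Z"
proof -
  have [measurable]: "Z \<in> sets \<sigma>" using Z by auto
  have ZY: "Z \<subseteq> Y" using sets.sets_into_space[of Z \<sigma>] by auto
  have "AE x in \<mu>. \<forall>g\<in>D n. act g x \<notin> Z" for n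
  proof -
    obtain \<rho> K B where \<rho>: "\<rho> \<in> borel_measurable borel" "compact K" "\<And>g. g \<notin> K \<Longrightarrow> \<rho> g = 0"
        "\<And>g. 0 \<le> \<rho> g" "\<And>g. \<rho> g \<le> B"
        "\<And>g. coset H g \<in> coset H ` D n \<Longrightarrow> (\<integral>\<^sup>+h. ennreal (\<rho> (h + g)) \<partial>mH) = 1"
      by (rule H.coset_partition_function[OF D_compact[of n]]) blast
    note [measurable] = \<rho>(1)
    define F :: "'g \<times> 'x \<Rightarrow> complex" where "F = (\<lambda>(g, y). complex_of_real (\<rho> (- g)) * indicator Z y * 1)"
    have Fm: "F \<in> borel_measurable P"
      unfolding F_def case_prod_beta by measurable
    have F: "admissible F"
    proof (rule admissibleI[OF Fm, of B "uminus ` K"])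
      show "compact (uminus ` K)"
        by (rule compact_continuous_image[OF _ \<rho>(2)]) (intro continuous_intros)
      show "F (g, y) = 0" if "g \<notin> uminus ` K" for g y
        using \<rho>(3)[of "- g"] that by (force simp: F_def image_iff)
      show "cmod (F (g, y)) \<le> B" for g y
        using \<rho>(4,5)[of "- g"] by (auto simp: F_def indicator_def)
    qed
    \<comment> \<open>The doubled inverse is \<open>K\<close> itself: \<open>F\<close> is supported
      on the inverse of \<open>K\<close>, and \<open>Wsum_eq_sum\<close> inverts once more.\<close>
    have W: "Wsum F x = complex_of_real (\<Sum>c\<in>hits x \<inter> coset H ` (uminus ` (uminus ` K)).
        (LINT h|mH. \<rho> (h + rep c)) * indicator Z (act (rep c) x))"
      if x: "x \<in> space \<mu>" "locally_finite_hits x" for x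
    proof -
      have cK: "compact (uminus ` K)"
        by (rule compact_continuous_image[OF _ \<rho>(2)]) (intro continuous_intros)
      have F0: "F (g, y) = 0" if "g \<notin> uminus ` K" for g y
        using \<rho>(3)[of "- g"] that by (force simp: F_def image_iff)
      have ZZ: "act (h + g) x \<in> Z \<longleftrightarrow> act g x \<in> Z" if "h \<in> H" for h g
        using inv[OF that, of "act g x"] inv[OF H.uminus_mem[OF that], of "act h (act g x)"]
          act_minus[OF act_space[OF x(1)]] act_add[OF x(1)] by metis
      have "(LINT h|mH. F (- (h + rep c), act (h + rep c) x))
          = complex_of_real ((LINT h|mH. \<rho> (h + rep c)) * indicator Z (act (rep c) x))" for c
      proof -
        have "(LINT h|mH. F (- (h + rep c), act (h + rep c) x))
          = (LINT h|mH. complex_of_real (\<rho> (h + rep c)) * indicator Z (act (rep c) x))"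
          by (rule Bochner_Integration.integral_cong) (use ZZ in \<open>auto simp: F_def indicator_def\<close>)
        then show ?thesis by (simp add: indicator_def)
      qed
      then show ?thesis using Wsum_eq_sum[OF x cK, of F] F0 by simp
    qed
    have R: "AE x in completion \<mu>. Re (Wsum F x) \<ge> 0"
      using AE_completion[OF AE_locally_finite_hits] AE_space
      by eventually_elim (auto simp: W \<rho>(4) intro!: sum_nonneg mult_nonneg_nonneg Bochner_Integration.integral_nonneg)
    have "AE z in P. snd z \<notin> Z"
    proof -
      have "UNIV \<times> Z \<in> null_sets P"
        using Z sets.top[of mG] by (auto simp: null_sets_def \<sigma>.emeasure_pair_measure_Times)
      from AE_not_in[OF this] show ?thesis by eventually_elim (auto simp: mem_Times_iff)
    qed
    then have "AE z in P. F z = 0"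
      by eventually_elim (auto simp: F_def case_prod_beta)
    then have "integral\<^sup>L P F = 0" by (rule integral_eq_zero_AE)
    then have "(LINT x|completion \<mu>. Re (Wsum F x)) = 0"
      using integral_Wsum[OF F] integral_Re[OF Wsum_integrable[OF F]] by simp
    then have "AE x in completion \<mu>. Re (Wsum F x) = 0"
      using integral_nonneg_eq_0_iff_AE[OF integrable_Re[OF Wsum_integrable[OF F]] R] by simp
    then have "AE x in \<mu>. Re (Wsum F x) = 0" by (simp add: AE_completion_iff)
    then show ?thesis using AE_locally_finite_hits AE_space
    proof eventually_elim
      case (elim x)
      let ?A = "hits x \<inter> coset H ` (uminus ` (uminus ` K))"
      let ?p = "\<lambda>c. LINT h|mH. \<rho> (h + rep c)"
      have "compact (uminus ` (uminus ` K))" using \<rho>(2) by (simp add: image_image)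
      then have fin: "finite ?A" using elim(2) by (simp add: locally_finite_hits_def)
      have "(\<Sum>c\<in>?A. ?p c * indicator Z (act (rep c) x)) = 0" using elim W by simp
      then have zero: "?p c * indicator Z (act (rep c) x) = 0" if "c \<in> ?A" for c
        using that fin \<rho>(4) by (subst (asm) sum_nonneg_eq_0_iff) auto
      show ?case
      proof (intro ballI notI)
        fix g assume g: "g \<in> D n" "act g x \<in> Z"
        let ?c = "coset H g"
        have hit: "?c \<in> hits x" using g(2) ZY elim(3) by (auto simp: coset_mem_hits)
        obtain h where h: "h \<in> H" "rep ?c = h + g" by (rule rep_coset[OF H.subgroup, of g])
        then have Zrep: "act (rep ?c) x \<in> Z" using g(2) inv elim(3) by (simp add: act_add)
        have "coset H (rep ?c) \<in> coset H ` D n" using h g coset_add[OF H.subgroup h(1)] by simp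
        then have one: "(\<integral>\<^sup>+h. ennreal (\<rho> (h + rep ?c)) \<partial>mH) = 1" by (rule \<rho>(6))
        have "?p ?c = enn2real (\<integral>\<^sup>+h. ennreal (\<rho> (h + rep ?c)) \<partial>mH)"
          by (rule integral_eq_nn_integral) (use \<rho>(4) in auto)
        then have p1: "?p ?c = 1" using one by simp
        \<comment> \<open>Otherwise \<open>\<rho>\<close> would vanish on the entire coset and its
          fibre integral could not be 1.\<close>
        have "?c \<in> coset H ` (uminus ` (uminus ` K))"
        proof (rule ccontr)
          assume no: "?c \<notin> coset H ` (uminus ` (uminus ` K))"
          have "\<rho> (h' + rep ?c) = 0" if "h' \<in> H" for h'
          proof (rule \<rho>(3), rule notI)
            assume "h' + rep ?c \<in> K"
            moreover have "coset H (h' + rep ?c) = ?c"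
              using coset_add[OF H.subgroup that] coset_add[OF H.subgroup h(1)] h(2) by simp
            ultimately show False using no by (auto simp: image_image)
          qed
          then have "?p ?c = 0" by (intro integral_eq_zero_AE AE_I2) simp
          then show False using p1 by simp
        qed
        then have "?c \<in> ?A" using hit by simp
        from zero[OF this] show False using p1 Zrep by simp
      qed
    qed
  qed
  then have "AE x in \<mu>. \<forall>n. \<forall>g\<in>D n. act g x \<notin> Z" unfolding AE_all_countable by blast
  then show ?thesis by eventually_elim (use D_cover in blast)
qed

end

section \<open>Characters and induced representations\<close>

text \<open>Pairing repeats every point of a countable dense set infinitely often. Recurrence is
  essential: a contracting factor that occurs only once would not force a product to tend to 0.
  Relatively open sets appear because nontriviality of a continuous character is an open
  condition.\<close>

lemma dense_enumeration:
  fixes H :: "'g::second_countable_topology set"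
  assumes "H \<noteq> {}"
  obtains e :: "nat \<Rightarrow> 'g"
  where "\<And>j. e j \<in> H" "\<And>U. open U \<Longrightarrow> U \<inter> H \<noteq> {} \<Longrightarrow> \<exists>d\<in>U \<inter> H. infinite {j. e j = d}"
proof -
  obtain B :: "'g set set" where B: "countable B" "topological_basis B"
    using ex_countable_basis by blast
  define p where "p U = (SOME x. x \<in> U \<inter> H)" for U
  have p: "p U \<in> U \<inter> H" if "U \<inter> H \<noteq> {}" for U
    using that unfolding p_def by (intro someI_ex[of "\<lambda>x. x \<in> U \<inter> H"]) auto
  define A where "A = p ` {U\<in>B. U \<inter> H \<noteq> {}}"
  have "countable A" unfolding A_def using B(1) by auto
  have meets: "\<exists>d\<in>A. d \<in> U \<inter> H" if U: "open U" "U \<inter> H \<noteq> {}" for U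
  proof -
    obtain x where x: "x \<in> U" "x \<in> H" using U by auto
    obtain V where V: "V \<in> B" "x \<in> V" "V \<subseteq> U" using topological_basisE[OF B(2) U(1) x(1)] by metis
    then have "V \<inter> H \<noteq> {}" using x by auto
    from p[OF this] V have "p V \<in> A" "p V \<in> U \<inter> H" using \<open>V \<inter> H \<noteq> {}\<close> by (auto simp: A_def)
    then show ?thesis by blast
  qed
  have "A \<noteq> {}" using meets[of UNIV] assms by auto
  define e where "e j = from_nat_into A (fst (prod_decode j))" for j
  show thesis
  proof
    show "e j \<in> H" for j
    proof -
      have "A \<subseteq> H" using p by (auto simp: A_def)
      then show ?thesis using from_nat_into[OF \<open>A \<noteq> {}\<close>] by (auto simp: e_def)
    qed
    fix U :: "'g set" assume "open U" "U \<inter> H \<noteq> {}"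
    then obtain d where d: "d \<in> A" "d \<in> U \<inter> H" using meets by blast
    obtain i where i: "from_nat_into A i = d"
      using from_nat_into_surj[OF \<open>countable A\<close> d(1)] by auto
    have "range (\<lambda>j. prod_encode (i, j)) \<subseteq> {j. e j = d}" using i by (auto simp: e_def)
    moreover have "infinite (range (\<lambda>j. prod_encode (i, j)))"
      by (rule range_inj_infinite) (auto simp: inj_def)
    ultimately have "infinite {j. e j = d}" by (metis infinite_super)
    then show "\<exists>d\<in>U \<inter> H. infinite {j. e j = d}" using d by blast
  qed
qed

text \<open>The midpoint of two points on the unit circle lies strictly inside the disc unless they
  coincide.\<close>

lemma cmod_half_one_add:
  assumes "cmod z = 1"
  shows "cmod ((1 + z) / 2) \<le> 1" and "z \<noteq> 1 \<Longrightarrow> cmod ((1 + z) / 2) < 1"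
proof -
  have one: "(Re z)\<^sup>2 + (Im z)\<^sup>2 = 1" using cmod_power2[of z] assms by simp
  then have sq: "(cmod (1 + z))\<^sup>2 = 2 + 2 * Re z" by (simp add: cmod_power2 power2_sum)
  show "cmod ((1 + z) / 2) \<le> 1" using norm_triangle_ineq[of 1 z] assms by (simp add: norm_divide)
  assume "z \<noteq> 1"
  have "Re z < 1"
  proof (rule ccontr)
    assume "\<not> Re z < 1"
    then have r: "Re z = 1" using complex_Re_le_cmod[of z] assms by simp
    then have "Im z = 0" using one by simp
    then show False using r \<open>z \<noteq> 1\<close> by (simp add: complex_eq_iff)
  qed
  then have "(cmod (1 + z))\<^sup>2 < 2\<^sup>2" using sq by simp
  then have "cmod (1 + z) < 2" by (rule power_less_imp_less_base) simp
  then show "cmod ((1 + z) / 2) < 1" by (simp add: norm_divide)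
qed

text \<open>The moduli of the partial products decrease to some \<open>a\<close>. Comparing the
  limits before and after each occurrence of \<open>w\<close> gives \<open>a = cmod w * a\<close>,
  hence \<open>a = 0\<close>.\<close>

lemma prod_tendsto_0:
  fixes z :: "nat \<Rightarrow> complex"
  assumes le: "\<And>j. cmod (z j) \<le> 1" and w: "cmod w < 1" "infinite {j. z j = w}"
  shows "(\<lambda>k. \<Prod>j<k. z j) \<longlonglongrightarrow> 0"
proof -
  let ?p = "\<lambda>k. \<Prod>j<k. cmod (z j)"
  have "decseq ?p"
    using le by (intro decseq_SucI) (auto simp: mult_left_le prod_nonneg)
  moreover have "?p k \<ge> 0" for k by (simp add: prod_nonneg)
  ultimately obtain a where a: "?p \<longlonglongrightarrow> a" by (metis decseq_convergent)
  obtain r :: "nat \<Rightarrow> nat" where r: "strict_mono r" "\<And>i. z (r i) = w"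
    using infinite_enumerate[OF w(2)] by auto
  have "(\<lambda>i. ?p (Suc (r i))) \<longlonglongrightarrow> a"
    using LIMSEQ_subseq_LIMSEQ[OF LIMSEQ_Suc[OF a] r(1)] by (simp add: o_def)
  moreover have "?p (Suc (r i)) = cmod w * ?p (r i)" for i using r(2)[of i] by simp
  ultimately have "(\<lambda>i. cmod w * ?p (r i)) \<longlonglongrightarrow> a" by (simp only:)
  moreover have "(\<lambda>i. cmod w * ?p (r i)) \<longlonglongrightarrow> cmod w * a"
    using LIMSEQ_subseq_LIMSEQ[OF a r(1)] by (intro tendsto_intros) (simp add: o_def)
  ultimately have "a = cmod w * a" by (rule LIMSEQ_unique)
  then have "a = 0" using w(1) by (cases "a = 0") auto
  then have "(\<lambda>k. cmod (\<Prod>j<k. z j)) \<longlonglongrightarrow> 0" using a by (simp add: prod_norm)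
  then show ?thesis by (rule tendsto_norm_zero_cancel)
qed

lemma unitary_characterD:
  assumes "unitary_character H \<xi>" "is_subgroup H"
  shows "\<xi> 0 = 1" "\<And>h. h \<in> H \<Longrightarrow> cmod (\<xi> h) = 1" "continuous_on H \<xi>"
    "\<And>h h'. h \<in> H \<Longrightarrow> h' \<in> H \<Longrightarrow> \<xi> (h + h') = \<xi> h * \<xi> h'"
    "\<And>h. h \<in> H \<Longrightarrow> \<xi> h * cnj (\<xi> h) = 1"
    "\<And>h. h \<in> H \<Longrightarrow> \<xi> (- h) = cnj (\<xi> h)"
proof -
  note H = is_subgroupD[OF assms(2)]
  show norm: "\<And>h. h \<in> H \<Longrightarrow> cmod (\<xi> h) = 1" and "continuous_on H \<xi>"
    and add: "\<And>h h'. h \<in> H \<Longrightarrow> h' \<in> H \<Longrightarrow> \<xi> (h + h') = \<xi> h * \<xi> h'"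
    using assms(1) by (auto simp: unitary_character_def)
  have "\<xi> 0 * \<xi> 0 = \<xi> 0" using add[OF H(1) H(1)] by simp
  moreover have "\<xi> 0 \<noteq> 0" using norm[OF H(1)] by auto
  ultimately show one: "\<xi> 0 = 1" by simp
  show cnj: "\<xi> h * cnj (\<xi> h) = 1" if "h \<in> H" for h
    using norm[OF that] by (simp add: complex_norm_square[symmetric])
  show "\<xi> (- h) = cnj (\<xi> h)" if "h \<in> H" for h
  proof -
    have "\<xi> h * \<xi> (- h) = \<xi> h * cnj (\<xi> h)"
      using add[OF that H(3)[OF that]] one cnj[OF that] by simp
    moreover have "\<xi> h \<noteq> 0" using norm[OF that] by auto
    ultimately show ?thesis by simp
  qed
qed

text \<open>The modulus of \<open>f\<close> is constant on cosets because \<open>\<xi>\<close> is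
  unitary, so a bound on the compact set \<open>C\<close> is a bound everywhere.\<close>

lemma ind0E:
  assumes H: "is_subgroup H" and \<xi>: "unitary_character H \<xi>" and f: "f \<in> ind0 H \<xi>"
  obtains C B where "compact C" "\<And>g. coset H g \<notin> coset H ` C \<Longrightarrow> f g = 0" "B \<ge> 0" "\<And>g. cmod (f g) \<le> B"
proof -
  obtain K where cont: "continuous_on UNIV f" and inv: "\<And>h g. h \<in> H \<Longrightarrow> f (h + g) = \<xi> h * f g"
    and K: "compactin (coset_topology H) K" "\<And>g. coset H g \<notin> K \<Longrightarrow> f g = 0"
    using f by (auto simp: ind0_def)
  obtain C where C: "compact C" "K \<subseteq> coset H ` C" using compactin_cosetsE[OF H K(1)] by metis
  have "bounded (f ` C)"
    using C(1) continuous_on_subset[OF cont] by (intro compact_imp_bounded compact_continuous_image) auto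
  then obtain B where B: "\<And>c. c \<in> C \<Longrightarrow> cmod (f c) \<le> B" by (auto simp: bounded_iff)
  have supp: "f g = 0" if "coset H g \<notin> coset H ` C" for g using that C(2) K(2) by blast
  show thesis
  proof
    show "cmod (f g) \<le> max B 0" for g
    proof (cases "coset H g \<in> coset H ` C")
      case True
      then obtain c where c: "c \<in> C" "g - c \<in> H" by (auto simp: coset_eq_iff[OF H])
      have "f g = \<xi> (g - c) * f c" using inv[OF c(2), of c] by simp
      then show ?thesis using B[OF c(1)] unitary_characterD(2)[OF \<xi> H c(2)] by (simp add: norm_mult)
    qed (use supp in auto)
  qed (use C(1) supp in auto)
qed

lemma ind0_lincomb:
  assumes "f1 \<in> ind0 H \<xi>" "f2 \<in> ind0 H \<xi>"
  shows "(\<lambda>g. a * f1 g + b * f2 g) \<in> ind0 H \<xi>"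
proof -
  obtain K1 where K1: "compactin (coset_topology H) K1" "\<And>g. coset H g \<notin> K1 \<Longrightarrow> f1 g = 0"
    using assms(1) by (auto simp: ind0_def)
  obtain K2 where K2: "compactin (coset_topology H) K2" "\<And>g. coset H g \<notin> K2 \<Longrightarrow> f2 g = 0"
    using assms(2) by (auto simp: ind0_def)
  have "compactin (coset_topology H) (K1 \<union> K2)" using K1 K2 by (simp add: compactin_Un)
  moreover have "\<And>g. coset H g \<notin> K1 \<union> K2 \<Longrightarrow> a * f1 g + b * f2 g = 0" using K1 K2 by simp
  moreover have "continuous_on UNIV (\<lambda>g. a * f1 g + b * f2 g)"
    using assms by (auto simp: ind0_def intro!: continuous_intros)
  moreover have "a * f1 (h + g) + b * f2 (h + g) = \<xi> h * (a * f1 g + b * f2 g)" if "h \<in> H" for h g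
    using assms that by (simp add: ind0_def algebra_simps)
  ultimately show ?thesis unfolding ind0_def by blast
qed

lemma ind0_translate:
  assumes H: "is_subgroup H" and f: "f \<in> ind0 H \<xi>"
  shows "(\<lambda>x. f (x + g)) \<in> ind0 H \<xi>"
proof -
  obtain K where cont: "continuous_on UNIV f" and inv: "\<And>h g. h \<in> H \<Longrightarrow> f (h + g) = \<xi> h * f g"
    and K: "compactin (coset_topology H) K" "\<And>g. coset H g \<notin> K \<Longrightarrow> f g = 0"
    using f by (auto simp: ind0_def)
  obtain C where C: "compact C" "K \<subseteq> coset H ` C" using compactin_cosetsE[OF H K(1)] by metis
  let ?C = "(\<lambda>c. c - g) ` C"
  have "compact ?C"
    by (rule compact_continuous_image[OF _ C(1)]) (intro continuous_on_diff_group continuous_intros)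
  then have "compactin (coset_topology H) (coset H ` ?C)" by (rule compactin_coset_image)
  moreover have "f (x + g) = 0" if "coset H x \<notin> coset H ` ?C" for x
  proof (rule K(2), rule notI)
    assume "coset H (x + g) \<in> K"
    then obtain c where c: "c \<in> C" "x + g - c \<in> H" using C(2) by (force simp: coset_eq_iff[OF H])
    then have "x - (c - g) \<in> H" by (simp add: diff_add_eq add_diff_eq diff_diff_eq2)
    then show False using that c(1) by (auto simp: coset_eq_iff[OF H])
  qed
  moreover have "continuous_on UNIV (\<lambda>x. f (x + g))"
    by (rule continuous_on_compose2[OF cont]) (auto intro: continuous_intros)
  moreover have "f (h + x + g) = \<xi> h * f (x + g)" if "h \<in> H" for h x
    using inv[OF that] by (simp add: add.assoc)
  ultimately show ?thesis unfolding ind0_def by blast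
qed

section \<open>The twisted Siegel--Radon transform\<close>

locale twisted_system = transverse_system H mH mG act \<mu> Y \<sigma>
  for H :: "'g::lcsc_group_add set" and mH mG :: "'g measure"
    and act :: "'g \<Rightarrow> 'x \<Rightarrow> 'x" and \<mu> Y \<sigma> +
  fixes L :: "'g set" and mHG :: "'g set measure" and \<xi> :: "'g \<Rightarrow> complex"
    and Y0 :: "'x set" and \<psi> :: "'x \<Rightarrow> complex"
  assumes semidirect: "internal_semidirect H L"
    and quotient: "quotient_measure H mG mH mHG"
    and character: "unitary_character H \<xi>"
    and eigen: "eigenfunction act \<sigma> H \<xi> Y0 \<psi>"
    and normalized: "(LINT y:Y0|\<sigma>. (cmod (\<psi> y))\<^sup>2) = measure \<sigma> Y"
    and stabilizer: "character_stabilizer H L \<xi> \<inter> return_set act H L Y = {0}"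
begin

lemmas \<xi> = unitary_characterD[OF character H.subgroup]

lemma conj_mem: "h \<in> H \<Longrightarrow> g + h - g \<in> H"
  using semidirect by (auto simp: internal_semidirect_def is_normal_subgroup_def)

lemma L_subgroup: "is_subgroup L" and H_Int_L: "H \<inter> L = {0}"
  and decompose: "\<exists>h\<in>H. \<exists>l\<in>L. g = h + l"
  using semidirect by (auto simp: internal_semidirect_def)

lemma Y0_sets [measurable]: "Y0 \<in> sets \<sigma>" and Y0_AE: "AE y in \<sigma>. y \<in> Y0"
  and Y0_act: "h \<in> H \<Longrightarrow> y \<in> Y0 \<Longrightarrow> act h y \<in> Y0"
  using eigen by (auto simp: eigenfunction_def)

text \<open>Extension by zero. As \<open>Y0\<close> is stable under \<open>H\<close> and inverses,
  so is its complement in \<open>Y\<close>, and the eigenvalue relation holds on all of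
  \<open>Y\<close>.\<close>

definition \<psi>0 :: "'x \<Rightarrow> complex" where "\<psi>0 y = (if y \<in> Y0 then \<psi> y else 0)"

lemma \<psi>0_measurable [measurable]: "\<psi>0 \<in> borel_measurable \<sigma>"
proof -
  have "(\<lambda>y. indicator Y0 y *\<^sub>R \<psi> y) \<in> borel_measurable \<sigma>"
    using eigen by (subst borel_measurable_restrict_space_iff[symmetric])
      (auto simp: eigenfunction_def dest: sets.sets_into_space)
  moreover have "(\<lambda>y. indicator Y0 y *\<^sub>R \<psi> y) = \<psi>0" by (auto simp: \<psi>0_def indicator_def)
  ultimately show ?thesis by simp
qed

definition b\<psi> :: real where "b\<psi> = (SOME B. B \<ge> 0 \<and> (\<forall>y. cmod (\<psi>0 y) \<le> B))"

lemma b\<psi>: "b\<psi> \<ge> 0" "cmod (\<psi>0 y) \<le> b\<psi>"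
proof -
  obtain B where "\<And>y. y \<in> Y0 \<Longrightarrow> cmod (\<psi> y) \<le> B" using eigen by (auto simp: eigenfunction_def)
  then have "max B 0 \<ge> 0 \<and> (\<forall>y. cmod (\<psi>0 y) \<le> max B 0)"
    by (auto simp: \<psi>0_def intro: max.coboundedI1)
  then have "b\<psi> \<ge> 0 \<and> (\<forall>y. cmod (\<psi>0 y) \<le> b\<psi>)" unfolding b\<psi>_def by (rule someI)
  then show "b\<psi> \<ge> 0" "cmod (\<psi>0 y) \<le> b\<psi>" by auto
qed

lemma \<psi>0_act_minus:
  assumes "h \<in> H" "y \<in> Y"
  shows "\<psi>0 (act (- h) y) = \<xi> h * \<psi>0 y"
proof (cases "y \<in> Y0")
  case True
  then show ?thesis
    using eigen assms Y0_act[OF H.uminus_mem] by (auto simp: \<psi>0_def eigenfunction_def)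
next
  case False
  have "act (- h) y \<notin> Y0"
  proof
    assume "act (- h) y \<in> Y0"
    then have "act h (act (- h) y) \<in> Y0" using Y0_act assms by blast
    then show False using False act_minus[of y "- h"] Y_space assms by simp
  qed
  then show ?thesis using False by (simp add: \<psi>0_def)
qed

lemma \<psi>0_act:
  assumes "h \<in> H" "y \<in> Y"
  shows "\<psi>0 (act h y) = cnj (\<xi> h) * \<psi>0 y"
  using \<psi>0_act_minus[OF H.uminus_mem[OF assms(1)] assms(2)] \<xi>(6)[OF assms(1)] by simp

definition good :: "'x \<Rightarrow> bool" where
  "good x \<longleftrightarrow> x \<in> space \<mu> \<and> locally_finite_hits x \<and> (\<forall>g. act g x \<in> Y \<longrightarrow> act g x \<in> Y0)"

text \<open>\<open>Y - Y0\<close> is null for \<open>\<sigma>\<close> and invariant under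
  \<open>H\<close>, so almost every orbit avoids it; on such orbits \<open>\<psi>\<close> and
  \<open>\<psi>0\<close> agree at every hit.\<close>

lemma AE_good: "AE x in \<mu>. good x"
proof -
  have "Y - Y0 \<in> null_sets \<sigma>"
    using Y0_AE sets.top[of \<sigma>] by (subst (asm) AE_iff_null) (auto simp: set_diff_eq)
  moreover have "act h y \<in> Y - Y0" if "h \<in> H" "y \<in> Y - Y0" for h y
    using that act_Y Y0_act[OF H.uminus_mem[OF that(1)], of "act h y"] act_minus[OF Y_space] by auto
  ultimately have "AE x in \<mu>. \<forall>g. act g x \<notin> Y - Y0" by (rule AE_avoids_null)
  then show ?thesis using AE_locally_finite_hits AE_space
    by eventually_elim (auto simp: good_def)
qed

lemma good_space: "good x \<Longrightarrow> x \<in> space \<mu>"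
  by (simp add: good_def)

text \<open>Moving the point by \<open>g\<close> shifts its hitting set on the right, and translates
  of compact sets are compact.\<close>

lemma good_act:
  assumes "good x"
  shows "good (act g x)"
proof -
  have x: "x \<in> space \<mu>" using assms by (rule good_space)
  have "finite (hits (act g x) \<inter> coset H ` C)" if "compact C" for C
  proof (rule finite_surj)
    have "compact ((\<lambda>c. c + g) ` C)"
      by (rule compact_continuous_image[OF _ that]) (intro continuous_intros)
    then show "finite (hits x \<inter> coset H ` (\<lambda>c. c + g) ` C)"
      using assms by (simp add: good_def locally_finite_hits_def)
    show "hits (act g x) \<inter> coset H ` C \<subseteq> (\<lambda>c. coset H (rep c - g)) ` (hits x \<inter> coset H ` (\<lambda>c. c + g) ` C)"
    proof
      fix c assume "c \<in> hits (act g x) \<inter> coset H ` C"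
      then obtain k where k: "c = coset H k" "k \<in> C" "act k (act g x) \<in> Y"
        using coset_mem_hits[OF act_space[OF x]] by auto
      have "coset H (k + g) \<in> hits x \<inter> coset H ` (\<lambda>c. c + g) ` C"
        using k by (auto simp: coset_mem_hits[OF x] act_add[OF x])
      moreover obtain h where "h \<in> H" "rep (coset H (k + g)) = h + (k + g)"
        by (rule rep_coset[OF H.subgroup])
      then have "c = coset H (rep (coset H (k + g)) - g)"
        using k(1) coset_add[OF H.subgroup] by (simp add: add.assoc[symmetric])
      ultimately show "c \<in> (\<lambda>c. coset H (rep c - g)) ` (hits x \<inter> coset H ` (\<lambda>c. c + g) ` C)"
        by blast
    qed
  qed
  moreover have "act k (act g x) \<in> Y0" if "act k (act g x) \<in> Y" for k
    using that assms by (simp add: good_def act_add[OF x, symmetric])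
  ultimately show ?thesis using act_space[OF x] by (simp add: good_def locally_finite_hits_def)
qed

text \<open>Since \<open>Y\<close> may be null in \<open>X\<close>, goodness is obtained first at
  \<open>act g y\<close>, through \<open>AE_act_P\<close>, and is then moved back along the orbit to
  \<open>y\<close>.\<close>

lemma AE_P_good: "AE z in P. good (snd z) \<and> snd z \<in> Y"
  using AE_act_P[OF AE_good] AE_space
proof eventually_elim
  case (elim z)
  then have "snd z \<in> Y" by (auto simp: space_P)
  then show ?case using good_act[OF elim(1), of "- fst z"] act_minus[OF Y_space] by simp
qed

section \<open>Hitting sets indexed by \<open>L\<close>\<close>

definition hits_L :: "'x \<Rightarrow> 'g set" where "hits_L x = {l \<in> L. act l x \<in> Y}"

lemma act_conj:
  assumes "x \<in> space \<mu>"
  shows "act g (act h x) = act (g + h - g) (act g x)"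
  using act_add[OF assms, of g h] act_add[OF assms, of "g + h - g" g] by simp

lemma act_act_Y_iff:
  assumes "x \<in> space \<mu>" "h \<in> H"
  shows "act g (act h x) \<in> Y \<longleftrightarrow> act g x \<in> Y"
  using act_conj[OF assms(1), of g h]
    act_Y_iff[OF act_space[OF assms(1)] conj_mem[OF assms(2), of g], of g] by simp

text \<open>By normality, acting with \<open>h\<close> before \<open>l\<close> amounts to acting
  with a conjugate of \<open>h\<close> after \<open>l\<close>, which preserves \<open>Y\<close>. The
  index set of the sum therefore stays put during the averaging.\<close>

lemma hits_L_act: "x \<in> space \<mu> \<Longrightarrow> h \<in> H \<Longrightarrow> hits_L (act h x) = hits_L x"
  by (simp add: hits_L_def act_act_Y_iff)

text \<open>Injectivity is \<open>H \<inter> L = {0}\<close>; surjectivity decomposes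
  \<open>k + g\<close> for a hit \<open>k\<close>. Indexing the hits of \<open>act g x\<close> by
  those of \<open>x\<close> frees the index set from \<open>g\<close>.\<close>

lemma bij_hits_L:
  assumes x: "x \<in> space \<mu>"
  shows "bij_betw (\<lambda>l. coset H (l - g)) (hits_L x) (hits (act g x))"
proof (rule bij_betw_imageI)
  show "inj_on (\<lambda>l. coset H (l - g)) (hits_L x)"
  proof (rule inj_onI)
    fix l l' assume l: "l \<in> hits_L x" "l' \<in> hits_L x" "coset H (l - g) = coset H (l' - g)"
    then have "l - l' \<in> H" by (simp add: coset_eq_iff[OF H.subgroup] diff_diff_eq2)
    moreover have "l - l' \<in> L"
    proof -
      have "l \<in> L" "l' \<in> L" using l(1,2) by (auto simp: hits_L_def)
      then have "l + - l' \<in> L" by (intro is_subgroupD[OF L_subgroup])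
      then show ?thesis by simp
    qed
    ultimately have "l - l' \<in> {0}" unfolding H_Int_L[symmetric] by (rule IntI)
    then show "l = l'" by simp
  qed
  show "(\<lambda>l. coset H (l - g)) ` hits_L x = hits (act g x)"
  proof (intro equalityI subsetI)
    fix c assume "c \<in> (\<lambda>l. coset H (l - g)) ` hits_L x"
    then obtain l where l: "c = coset H (l - g)" "act l x \<in> Y" by (auto simp: hits_L_def)
    then show "c \<in> hits (act g x)"
      by (simp add: coset_mem_hits[OF act_space[OF x]] act_add[OF x, symmetric])
  next
    fix c assume "c \<in> hits (act g x)"
    then obtain k where k: "c = coset H k" "act k (act g x) \<in> Y" by (auto simp: hitting_def)
    obtain h l where hl: "h \<in> H" "l \<in> L" "k + g = h + l" using decompose by blast
    have "act (h + l) x \<in> Y" using k(2) hl(3) act_add[OF x] by metis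
    then have "l \<in> hits_L x" using hl by (simp add: hits_L_def act_add[OF x] act_Y_iff[OF act_space[OF x]])
    moreover have "k = h + (l - g)" using hl(3) by (metis add_diff_cancel add_diff_eq)
    then have "c = coset H (l - g)" using k(1) hl(1) by (simp add: coset_add[OF H.subgroup])
    ultimately show "c \<in> (\<lambda>l. coset H (l - g)) ` hits_L x" by blast
  qed
qed

section \<open>Pointwise form of the transform\<close>

definition S :: "('g \<Rightarrow> complex) \<Rightarrow> 'x \<Rightarrow> complex" where "S = siegel_radon act H Y \<psi>"

text \<open>The factors \<open>\<xi> h\<close> and \<open>cnj (\<xi> h)\<close> cancel, so the
  summands of the transform do not depend on the choice made by \<open>rep\<close>.\<close>

lemma ind0_term:
  assumes f: "f \<in> ind0 H \<xi>" and x: "x \<in> space \<mu>" and k: "act k x \<in> Y" and h: "h \<in> H"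
  shows "f (h + k) * \<psi>0 (act (h + k) x) = f k * \<psi>0 (act k x)"
proof -
  have "f (h + k) = \<xi> h * f k" using f h by (simp add: ind0_def)
  moreover have "\<psi>0 (act (h + k) x) = cnj (\<xi> h) * \<psi>0 (act k x)"
    using \<psi>0_act[OF h k] by (simp add: act_add[OF x])
  ultimately show ?thesis using \<xi>(5)[OF h] by (simp add: algebra_simps)
qed

lemma S_eq_infsum:
  assumes x: "good x"
  shows "S f x = (\<Sum>\<^sub>\<infinity>c\<in>hits x. f (rep c) * \<psi>0 (act (rep c) x))"
  unfolding S_def siegel_radon_def
proof (rule infsum_cong)
  fix c assume "c \<in> hits x"
  then have "act (rep c) x \<in> Y" using rep_hits good_space[OF x] by blast
  then show "f (rep c) * \<psi> (act (rep c) x) = f (rep c) * \<psi>0 (act (rep c) x)"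
    using x by (simp add: \<psi>0_def good_def)
qed

definition supp_hits :: "'g set \<Rightarrow> 'g \<Rightarrow> 'x \<Rightarrow> 'g set" where
  "supp_hits C g x = {l \<in> hits_L x. coset H (l - g) \<in> coset H ` C}"

lemma supp_hits_image:
  assumes "x \<in> space \<mu>"
  shows "(\<lambda>l. coset H (l - g)) ` supp_hits C g x = hits (act g x) \<inter> coset H ` C"
  unfolding bij_betw_imp_surj_on[OF bij_hits_L[OF assms, of g], symmetric] by (auto simp: supp_hits_def)

lemma inj_on_supp_hits:
  assumes "x \<in> space \<mu>"
  shows "inj_on (\<lambda>l. coset H (l - g)) (supp_hits C g x)"
  by (rule inj_on_subset[OF bij_betw_imp_inj_on[OF bij_hits_L[OF assms]]]) (auto simp: supp_hits_def)

lemma finite_supp_hits: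
  assumes "good x" "compact C"
  shows "finite (supp_hits C g x)"
proof -
  have "finite (hits (act g x) \<inter> coset H ` C)"
    using good_act[OF assms(1), of g] assms(2) by (simp add: good_def locally_finite_hits_def)
  then show ?thesis
    using supp_hits_image[OF good_space[OF assms(1)]] inj_on_supp_hits[OF good_space[OF assms(1)]]
    by (metis finite_imageD)
qed

text \<open>For the representative \<open>l - g\<close>, the point
  \<open>act (l - g) (act g x)\<close> is \<open>act l x\<close>, free of \<open>g\<close>. The
  averaging operates on this expansion.\<close>

lemma S_act:
  assumes f: "f \<in> ind0 H \<xi>" and x: "good x" and C: "compact C" "\<And>g. coset H g \<notin> coset H ` C \<Longrightarrow> f g = 0"
  shows "S f (act g x) = (\<Sum>l\<in>supp_hits C g x. f (l - g) * \<psi>0 (act l x))"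
proof -
  note xs = good_space[OF x]
  let ?t = "\<lambda>c. f (rep c) * \<psi>0 (act (rep c) (act g x))"
  have t: "?t (coset H (l - g)) = f (l - g) * \<psi>0 (act l x)" if "l \<in> hits_L x" for l
  proof -
    obtain h where h: "h \<in> H" "rep (coset H (l - g)) = h + (l - g)" by (rule rep_coset[OF H.subgroup])
    have "act (l - g) (act g x) = act l x" using act_add[OF xs, of "l - g" g] by simp
    then show ?thesis
      using ind0_term[OF f act_space[OF xs] _ h(1), of "l - g" g] that h(2) by (simp add: hits_L_def)
  qed
  have "S f (act g x) = (\<Sum>\<^sub>\<infinity>l\<in>hits_L x. ?t (coset H (l - g)))"
    unfolding S_eq_infsum[OF good_act[OF x]]
    using infsum_reindex_bij_betw[OF bij_hits_L[OF xs, of g], of ?t] by simp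
  also have "\<dots> = (\<Sum>\<^sub>\<infinity>l\<in>supp_hits C g x. f (l - g) * \<psi>0 (act l x))"
    by (rule infsum_cong_neutral) (auto simp: supp_hits_def t C(2))
  finally show ?thesis using finite_supp_hits[OF x C(1)] by simp
qed

definition N :: "'g set \<Rightarrow> 'x \<Rightarrow> real" where "N C x = real (card (hits x \<inter> coset H ` C))"

text \<open>By normality the hitting set itself is unchanged, not only its size. This is what makes
  \<open>N\<close> a truncation compatible with averaging along \<open>H\<close>.\<close>

lemma N_act_act:
  assumes x: "x \<in> space \<mu>" and h: "h \<in> H"
  shows "N C (act g (act h x)) = N C (act g x)"
proof -
  have "hits (act g (act h x)) = hits (act g x)"
    using bij_betw_imp_surj_on[OF bij_hits_L[OF x, of g]]
      bij_betw_imp_surj_on[OF bij_hits_L[OF act_space[OF x], of g h]] hits_L_act[OF x h] by simp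
  then show ?thesis by (simp add: N_def)
qed

lemma S_bound:
  assumes f: "f \<in> ind0 H \<xi>" and x: "good x" and C: "compact C" "\<And>g. coset H g \<notin> coset H ` C \<Longrightarrow> f g = 0"
    and B: "\<And>g. cmod (f g) \<le> B"
  shows "cmod (S f x) \<le> B * b\<psi> * N C x"
proof -
  have x0: "act 0 x = x" using act_0 good_space[OF x] by simp
  have "B \<ge> 0" using B[of 0] norm_ge_zero order_trans by blast
  have "S f x = (\<Sum>l\<in>supp_hits C 0 x. f (l - 0) * \<psi>0 (act l x))"
    using S_act[OF f x C, of 0] x0 by simp
  then have "cmod (S f x) \<le> (\<Sum>l\<in>supp_hits C 0 x. B * b\<psi>)"
    by (simp only:) (rule sum_norm_le, use B b\<psi> \<open>B \<ge> 0\<close> in \<open>auto simp: norm_mult intro!: mult_mono\<close>)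
  also have "\<dots> = B * b\<psi> * N C x"
    using card_image[OF inj_on_supp_hits[OF good_space[OF x], of 0 C]]
      supp_hits_image[OF good_space[OF x], of 0 C]
    by (simp add: x0 N_def)
  finally show ?thesis .
qed

lemma AE_S_lincomb:
  assumes f: "f1 \<in> ind0 H \<xi>" "f2 \<in> ind0 H \<xi>"
  shows "AE x in \<mu>. S (\<lambda>g. a * f1 g + b * f2 g) x = a * S f1 x + b * S f2 x"
  using AE_good
proof eventually_elim
  case (elim x)
  obtain C1 where C1: "compact C1" "\<And>g. coset H g \<notin> coset H ` C1 \<Longrightarrow> f1 g = 0"
    by (rule ind0E[OF H.subgroup character f(1)]) blast
  obtain C2 where C2: "compact C2" "\<And>g. coset H g \<notin> coset H ` C2 \<Longrightarrow> f2 g = 0"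
    by (rule ind0E[OF H.subgroup character f(2)]) blast
  let ?C = "C1 \<union> C2"
  have C: "compact ?C" "\<And>g. coset H g \<notin> coset H ` ?C \<Longrightarrow> f1 g = 0"
    "\<And>g. coset H g \<notin> coset H ` ?C \<Longrightarrow> f2 g = 0"
    "\<And>g. coset H g \<notin> coset H ` ?C \<Longrightarrow> a * f1 g + b * f2 g = 0"
    using C1 C2 by (auto simp: image_Un)
  have x0: "act 0 x = x" using act_0 good_space[OF elim] by simp
  show ?case
    using S_act[OF ind0_lincomb[OF f, of a b] elim C(1,4), of 0] S_act[OF f(1) elim C(1,2), of 0]
      S_act[OF f(2) elim C(1,3), of 0]
    by (simp add: x0 sum_distrib_left sum.distrib[symmetric] algebra_simps)
qed

lemma AE_S_translate:
  assumes f: "f \<in> ind0 H \<xi>"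
  shows "AE x in \<mu>. S (\<lambda>k. f (k + g)) x = S f (act (- g) x)"
  using AE_good
proof eventually_elim
  case (elim x)
  obtain C1 where C1: "compact C1" "\<And>g. coset H g \<notin> coset H ` C1 \<Longrightarrow> f g = 0"
    by (rule ind0E[OF H.subgroup character f]) blast
  obtain C2 where C2: "compact C2" "\<And>k. coset H k \<notin> coset H ` C2 \<Longrightarrow> f (k + g) = 0"
    by (rule ind0E[OF H.subgroup character ind0_translate[OF H.subgroup f, of g]]) blast
  have x0: "act 0 x = x" using act_0 good_space[OF elim] by simp
  have "S (\<lambda>k. f (k + g)) x = (\<Sum>l\<in>supp_hits C2 0 x. f (l + g) * \<psi>0 (act l x))"
    using S_act[OF ind0_translate[OF H.subgroup f] elim C2, of 0] x0 by simp
  \<comment> \<open>Both index sets contain every hit \<open>l\<close> at which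
    \<open>f (l + g)\<close> is nonzero, so they differ only by zero terms.\<close>
  also have "\<dots> = (\<Sum>l\<in>supp_hits C1 (- g) x. f (l + g) * \<psi>0 (act l x))"
    by (rule sum.mono_neutral_cong)
       (use finite_supp_hits[OF elim C1(1), of "- g"] finite_supp_hits[OF elim C2(1), of 0] C1 C2 in \<open>auto simp: supp_hits_def\<close>)
  also have "\<dots> = S f (act (- g) x)"
    using S_act[OF f elim C1, of "- g"] by simp
  finally show ?case .
qed

lemma N_square_integrable:
  assumes "compact C"
  shows "N C \<in> borel_measurable (completion \<mu>)" "integrable (completion \<mu>) (\<lambda>x. (N C x)\<^sup>2)"
proof -
  let ?e = "\<lambda>x. emeasure (count_space UNIV) (hits x \<inter> coset H ` C)"
  have e: "?e \<in> borel_measurable (completion \<mu>)" "(\<integral>\<^sup>+ x. (?e x)\<^sup>2 \<partial>completion \<mu>) < \<infinity>"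
    using square_integrable compactin_coset_image[OF assms]
    by (auto simp: square_integrable_system_def)
  \<comment> \<open>Where the set is infinite, \<open>card\<close> and \<open>enn2real\<close> both
    give 0.\<close>
  have N: "N C x = enn2real (?e x)" for x
    by (cases "finite (hits x \<inter> coset H ` C)") (auto simp: N_def emeasure_count_space)
  show m: "N C \<in> borel_measurable (completion \<mu>)"
    unfolding N[abs_def] using e(1) by measurable
  have "(\<integral>\<^sup>+ x. ennreal ((N C x)\<^sup>2) \<partial>completion \<mu>) \<le> (\<integral>\<^sup>+ x. (?e x)\<^sup>2 \<partial>completion \<mu>)"
    unfolding N by (intro nn_integral_mono) (auto simp: ennreal_power[symmetric] ennreal_enn2real_if intro!: power_mono)
  also have "\<dots> < \<infinity>" by (rule e(2))
  finally show "integrable (completion \<mu>) (\<lambda>x. (N C x)\<^sup>2)"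
    using m by (intro integrableI_bounded) auto
qed

text \<open>The fibre integral of \<open>\<rho>\<close> is 1 wherever \<open>f\<close> is nonzero,
  so \<open>Wsum F\<close> recovers \<open>S f x * \<phi> x\<close> at good points. Boundedness of
  \<open>\<phi>\<close> and compactness of \<open>K\<close> make \<open>F\<close>
  admissible.\<close>

lemma S_transverse:
  assumes f: "f \<in> ind0 H \<xi>" and C: "\<And>g. coset H g \<notin> coset H ` C \<Longrightarrow> f g = 0"
    and \<rho>: "\<rho> \<in> borel_measurable borel" "compact K" "\<And>g. g \<notin> K \<Longrightarrow> \<rho> g = 0"
      "\<And>g. 0 \<le> \<rho> g" "\<And>g. \<rho> g \<le> B"
      "\<And>g. coset H g \<in> coset H ` C \<Longrightarrow> (\<integral>\<^sup>+h. ennreal (\<rho> (h + g)) \<partial>mH) = 1"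
    and \<phi>: "\<phi> \<in> borel_measurable \<mu>" "\<And>x. x \<in> space \<mu> \<Longrightarrow> cmod (\<phi> x) \<le> B'"
  defines "F \<equiv> \<lambda>(g, y). complex_of_real (\<rho> (- g)) * (f (- g) * \<psi>0 y) * \<phi> (act g y)"
  shows "admissible F" "integrable (completion \<mu>) (\<lambda>x. S f x * \<phi> x)"
    "(LINT x|completion \<mu>. S f x * \<phi> x) = integral\<^sup>L P F"
proof -
  note [measurable] = \<rho>(1) \<phi>(1)
  obtain B'' where B'': "B'' \<ge> 0" "\<And>g. cmod (f g) \<le> B''"
    by (rule ind0E[OF H.subgroup character f]) blast
  have [measurable]: "f \<in> borel_measurable borel"
    using f by (auto simp: ind0_def intro: borel_measurable_continuous_onI)
  have Bs: "B \<ge> 0" using \<rho>(4,5)[of 0] by linarith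
  obtain x0 where "x0 \<in> space \<mu>" using not_empty by auto
  then have Bs': "B' \<ge> 0" using \<phi>(2) norm_ge_zero order_trans by blast
  have cK: "compact (uminus ` K)"
    by (rule compact_continuous_image[OF _ \<rho>(2)]) (intro continuous_intros)
  show F: "admissible F"
  proof (rule admissibleI[OF _ _ cK, of _ "B * (B'' * b\<psi>) * B'"])
    show "F \<in> borel_measurable P"
      unfolding F_def case_prod_beta by measurable
    show "F (g, y) = 0" if "g \<notin> uminus ` K" for g y
      using \<rho>(3)[of "- g"] that by (force simp: F_def image_iff)
    show "cmod (F (g, y)) \<le> B * (B'' * b\<psi>) * B'" if "y \<in> Y" for g y
      using \<rho>(4,5)[of "- g"] B'' b\<psi> Bs Bs' \<phi>(2)[OF act_space[OF Y_space[OF that]]]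
      by (auto simp: F_def norm_mult intro!: mult_mono mult_nonneg_nonneg)
  qed
  have W: "Wsum F x = S f x * \<phi> x" if x: "good x" for x
  proof -
    note xs = good_space[OF x]
    have "Wsum F x = (\<Sum>\<^sub>\<infinity>c\<in>hits x. complex_of_real (LINT h|mH. \<rho> (h + rep c)) * (f (rep c) * \<psi>0 (act (rep c) x))) * \<phi> x"
      unfolding F_def
      by (rule Wsum_weighted[OF xs, of "\<lambda>g y. f g * \<psi>0 y"]) (rule ind0_term[OF f xs])
    also have "(\<Sum>\<^sub>\<infinity>c\<in>hits x. complex_of_real (LINT h|mH. \<rho> (h + rep c)) * (f (rep c) * \<psi>0 (act (rep c) x)))
        = (\<Sum>\<^sub>\<infinity>c\<in>hits x. f (rep c) * \<psi>0 (act (rep c) x))"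
    proof (rule infsum_cong)
      fix c
      show "complex_of_real (LINT h|mH. \<rho> (h + rep c)) * (f (rep c) * \<psi>0 (act (rep c) x))
        = f (rep c) * \<psi>0 (act (rep c) x)"
      proof (cases "f (rep c) = 0")
        case False
        then have "(\<integral>\<^sup>+h. ennreal (\<rho> (h + rep c)) \<partial>mH) = 1" using C \<rho>(6) by blast
        moreover have "(LINT h|mH. \<rho> (h + rep c)) = enn2real (\<integral>\<^sup>+h. ennreal (\<rho> (h + rep c)) \<partial>mH)"
          by (rule integral_eq_nn_integral) (use \<rho>(4) in auto)
        ultimately show ?thesis by simp
      qed simp
    qed
    finally show ?thesis by (simp add: S_eq_infsum[OF x])
  qed
  have eq: "AE x in completion \<mu>. Wsum F x = S f x * \<phi> x"
    using AE_completion[OF AE_good] by eventually_elim (rule W)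
  have m: "(\<lambda>x. S f x * \<phi> x) \<in> borel_measurable (completion \<mu>)"
  proof (rule borel_measurable_completion_AE[OF borel_measurable_integrable[OF Wsum_integrable[OF F]]])
    show "AE x in \<mu>. S f x * \<phi> x = Wsum F x" using AE_good by eventually_elim (simp add: W)
  qed
  show "integrable (completion \<mu>) (\<lambda>x. S f x * \<phi> x)"
    by (rule integrable_cong_AE_imp[OF Wsum_integrable[OF F] m]) (use eq in eventually_elim, simp)
  have "(LINT x|completion \<mu>. S f x * \<phi> x) = (LINT x|completion \<mu>. Wsum F x)"
    by (rule integral_cong_AE[OF m borel_measurable_integrable[OF Wsum_integrable[OF F]]])
       (use eq in eventually_elim, simp)
  then show "(LINT x|completion \<mu>. S f x * \<phi> x) = integral\<^sup>L P F" by (simp add: integral_Wsum[OF F])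
qed

end

section \<open>Averaging along the normal subgroup\<close>

context twisted_system
begin

definition e :: "nat \<Rightarrow> 'g" where
  "e = (SOME e. (\<forall>j. e j \<in> H) \<and> (\<forall>U. open U \<longrightarrow> U \<inter> H \<noteq> {} \<longrightarrow> (\<exists>d\<in>U \<inter> H. infinite {j. e j = d})))"

lemma e_mem: "e j \<in> H"
  and e_dense: "open U \<Longrightarrow> U \<inter> H \<noteq> {} \<Longrightarrow> \<exists>d\<in>U \<inter> H. infinite {j. e j = d}"
proof -
  have "H \<noteq> {}" using H.zero_mem by auto
  then have "\<exists>e :: nat \<Rightarrow> 'g. (\<forall>j. e j \<in> H) \<and>
      (\<forall>U. open U \<longrightarrow> U \<inter> H \<noteq> {} \<longrightarrow> (\<exists>d\<in>U \<inter> H. infinite {j. e j = d}))"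
    by (rule dense_enumeration) blast
  from someI_ex[OF this] have *: "(\<forall>j. e j \<in> H) \<and>
      (\<forall>U. open U \<longrightarrow> U \<inter> H \<noteq> {} \<longrightarrow> (\<exists>d\<in>U \<inter> H. infinite {j. e j = d}))"
    unfolding e_def .
  then show "e j \<in> H" by simp
  from * show "open U \<Longrightarrow> U \<inter> H \<noteq> {} \<Longrightarrow> \<exists>d\<in>U \<inter> H. infinite {j. e j = d}" by simp
qed

text \<open>For \<open>h \<in> H\<close>, replacing \<open>y\<close> by \<open>act (- h) y\<close> multiplies the summand of
  \<open>\<psi>0 y * cnj (S f (act g y))\<close> at \<open>l\<close> by \<open>\<eta> l h\<close>, and \<open>k\<close> steps of the averaging multiply it by \<open>t k l\<close>.\<close>

definition \<eta> :: "'g \<Rightarrow> 'g \<Rightarrow> complex" where "\<eta> l h = \<xi> h * cnj (\<xi> (l + h - l))"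

definition t :: "nat \<Rightarrow> 'g \<Rightarrow> complex" where "t k l = (\<Prod>j<k. (1 + \<eta> l (e j)) / 2)"

lemma cmod_\<eta>: "h \<in> H \<Longrightarrow> cmod (\<eta> l h) = 1"
  by (simp add: \<eta>_def norm_mult \<xi>(2) conj_mem)

lemma t_0: "t k 0 = 1"
  by (simp add: t_def \<eta>_def \<xi>(5) e_mem)

text \<open>A hit \<open>l\<close> of a point of \<open>Y\<close> is a return element, so
  \<open>l \<noteq> 0\<close> does not stabilize \<open>\<xi>\<close> and \<open>\<eta> l\<close> is
  nontrivial. By continuity it differs from 1 on a nonempty relatively open set, which contains a
  point that \<open>e\<close> visits infinitely often.\<close>

lemma t_tendsto_0:
  assumes l: "l \<in> hits_L y" "l \<noteq> 0" and y: "y \<in> Y"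
  shows "(\<lambda>k. t k l) \<longlonglongrightarrow> 0"
proof -
  have "l \<in> L" "act l y \<in> Y" using l(1) by (auto simp: hits_L_def)
  then have "l \<in> return_set act H L Y"
    using y coset_mem_hits[OF Y_space[OF y]] by (auto simp: return_set_def)
  then have "l \<notin> character_stabilizer H L \<xi>" using stabilizer l(2) by blast
  then obtain h where h: "h \<in> H" "\<xi> (- l + h + l) \<noteq> \<xi> h"
    using \<open>l \<in> L\<close> by (auto simp: character_stabilizer_def)
  \<comment> \<open>The stabilizer compares \<open>\<xi>\<close> at \<open>- l + h + l\<close> and
    \<open>h\<close>, while \<open>\<eta> l\<close> compares it at its argument and the conjugate by
    \<open>l\<close>; conjugating the witness matches the two.\<close>
  define h' where "h' = - l + h + l"
  have h': "h' \<in> H" using conj_mem[OF h(1), of "- l"] by (simp add: h'_def)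
  have "\<eta> l h' \<noteq> 1"
  proof
    assume "\<eta> l h' = 1"
    moreover have "l + h' - l = h" by (simp add: h'_def add.assoc)
    ultimately have one: "\<xi> h' * cnj (\<xi> h) = 1" by (simp add: \<eta>_def)
    have "\<xi> h' = \<xi> h' * (\<xi> h * cnj (\<xi> h))" using \<xi>(5)[OF h(1)] by simp
    also have "\<dots> = (\<xi> h' * cnj (\<xi> h)) * \<xi> h" by (simp only: ac_simps)
    also have "\<dots> = \<xi> h" using one by simp
    finally have "\<xi> h' = \<xi> h" .
    then show False using h(2) by (simp add: h'_def)
  qed
  have "continuous_on H (\<lambda>h. l + h - l)"
    by (intro continuous_on_diff_group continuous_intros)
  then have "continuous_on H (\<lambda>h. \<xi> (l + h - l))"
    by (rule continuous_on_compose2[OF \<xi>(3)]) (auto intro: conj_mem)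
  then have "continuous_on H (\<eta> l)"
    unfolding \<eta>_def[abs_def] by (intro continuous_intros \<xi>(3))
  moreover have "open (- {1 :: complex})" by (intro open_Compl closed_singleton)
  ultimately obtain U where U: "open U" "U \<inter> H = \<eta> l -` (- {1}) \<inter> H"
    unfolding continuous_on_open_invariant by blast
  then have "U \<inter> H \<noteq> {}" using h' \<open>\<eta> l h' \<noteq> 1\<close> by auto
  then obtain d where d: "d \<in> U \<inter> H" "infinite {j. e j = d}" using e_dense[OF U(1)] by blast
  have "d \<in> H" "\<eta> l d \<noteq> 1" using d(1) U(2) by auto
  have "{j. e j = d} \<subseteq> {j. (1 + \<eta> l (e j)) / 2 = (1 + \<eta> l d) / 2}" by auto
  then have "infinite {j. (1 + \<eta> l (e j)) / 2 = (1 + \<eta> l d) / 2}"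
    using d(2) by (metis infinite_super)
  with cmod_half_one_add(1)[OF cmod_\<eta>[OF e_mem]]
    cmod_half_one_add(2)[OF cmod_\<eta>[OF \<open>d \<in> H\<close>] \<open>\<eta> l d \<noteq> 1\<close>]
  show ?thesis unfolding t_def by (rule prod_tendsto_0)
qed

text \<open>Only the coordinate in \<open>Y\<close> moves, so a bound depending on \<open>g\<close>
  alone survives every step.\<close>

primrec avg :: "('g \<times> 'x \<Rightarrow> complex) \<Rightarrow> nat \<Rightarrow> 'g \<times> 'x \<Rightarrow> complex" where
  "avg F 0 = F"
| "avg F (Suc k) = (\<lambda>z. (avg F k z + avg F k (fst z, act (- e k) (snd z))) / 2)"

lemma twist_fst_snd:
  assumes "h \<in> H"
  shows "(\<lambda>z. (fst z, act h (snd z))) \<in> measurable P P" "distr P P (\<lambda>z. (fst z, act h (snd z))) = P"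
  using twist_measurable[OF assms] distr_P[OF assms] by (simp_all add: case_prod_beta')

lemma avg_measurable:
  assumes "F \<in> borel_measurable P"
  shows "avg F k \<in> borel_measurable P"
proof (induction k)
  case (Suc k)
  have "(\<lambda>z. avg F k (fst z, act (- e k) (snd z))) \<in> borel_measurable P"
    using measurable_compose[OF twist_fst_snd(1)[OF H.uminus_mem[OF e_mem]] Suc] .
  then show ?case using Suc by simp
qed (use assms in simp)

lemma avg_bound:
  assumes "\<And>g y. y \<in> Y \<Longrightarrow> cmod (F (g, y)) \<le> w g" "y \<in> Y"
  shows "cmod (avg F k (g, y)) \<le> w g"
  using assms(2)
proof (induction k arbitrary: y)
  case (Suc k)
  have "cmod (avg F k (g, y) + avg F k (g, act (- e k) y)) \<le> w g + w g"
    using Suc.IH[OF Suc.prems] Suc.IH[OF act_Y[OF H.uminus_mem[OF e_mem] Suc.prems]]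
    by (rule norm_triangle_mono)
  then show ?case by (simp add: norm_divide)
qed (use assms in simp)

text \<open>The twist preserves \<open>P\<close>, so both halves of a step have the same integral.
  The bound ensures that both are integrable, which splitting the integral requires.\<close>

lemma avg_integral:
  assumes F: "F \<in> borel_measurable P" and K: "compact K"
    and bound: "\<And>g y. y \<in> Y \<Longrightarrow> cmod (F (g, y)) \<le> b * indicator K g"
  shows "integral\<^sup>L P (avg F k) = integral\<^sup>L P F"
proof (induction k)
  case (Suc k)
  have le: "cmod (avg F k (g, y)) \<le> b * indicator K g" if "y \<in> Y" for k g y
    by (rule avg_bound[OF _ that]) (rule bound)
  have adm: "admissible (avg F k)"
  proof (rule admissibleI[OF avg_measurable[OF F] _ K])
    fix g y assume y: "y \<in> Y"
    have "b * indicator K g \<le> \<bar>b\<bar>" by (auto simp: indicator_def)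
    then show "cmod (avg F k (g, y)) \<le> \<bar>b\<bar>" using le[OF y] by (rule order_trans[rotated])
    show "avg F k (g, y) = 0" if "g \<notin> K" using le[OF y, of k g] that by simp
  qed
  let ?T = "\<lambda>z. (fst z, act (- e k) (snd z))"
  note T = twist_fst_snd[OF H.uminus_mem[OF e_mem[of k]]]
  have i: "integrable P (avg F k)" by (rule admissible_integrable[OF adm])
  have "integrable P (\<lambda>z. avg F k (?T z))"
    using integrable_distr[OF T(1), of "avg F k"] i by (simp add: T(2))
  moreover have "(LINT z|P. avg F k (?T z)) = integral\<^sup>L P (avg F k)"
    using integral_distr[OF T(1) avg_measurable[OF F], of k] by (simp add: T(2))
  ultimately show ?case using i Suc by simp
qed simp

text \<open>A twist by \<open>- e k\<close> leaves \<open>u\<close> and the index set alone,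
  multiplies \<open>\<psi>0 y\<close> by \<open>\<xi> (e k)\<close>, and multiplies the conjugated
  factor at \<open>l\<close> by the conjugate of \<open>\<xi>\<close> at \<open>l + e k - l\<close>.
  Their product is \<open>\<eta> l (e k)\<close>.\<close>

lemma avg_AE:
  assumes f: "f \<in> ind0 H \<xi>" and C: "compact C" "\<And>g. coset H g \<notin> coset H ` C \<Longrightarrow> f g = 0"
    and F: "AE z in P. F z = u z * (\<psi>0 (snd z) * cnj (S f (act (fst z) (snd z))))"
    and u: "\<And>g h y. h \<in> H \<Longrightarrow> y \<in> Y \<Longrightarrow> u (g, act h y) = u (g, y)"
  shows "AE z in P. avg F k z = u z * (\<Sum>l\<in>supp_hits C (fst z) (snd z).
    t k l * (\<psi>0 (snd z) * cnj (f (l - fst z) * \<psi>0 (act l (snd z)))))"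
proof (induction k)
  case 0
  show ?case using F AE_P_good
    by eventually_elim (simp add: S_act[OF f _ C] t_def sum_distrib_left)
next
  case (Suc k)
  let ?T = "\<lambda>z. (fst z, act (- e k) (snd z))"
  note T = twist_fst_snd[OF H.uminus_mem[OF e_mem[of k]]]
  \<comment> \<open>The twist preserves \<open>P\<close>, so the induction hypothesis holds almost
    everywhere at the twisted point as well.\<close>
  from Suc have "AE z in distr P P ?T. avg F k z = u z * (\<Sum>l\<in>supp_hits C (fst z) (snd z).
    t k l * (\<psi>0 (snd z) * cnj (f (l - fst z) * \<psi>0 (act l (snd z)))))" by (simp only: T(2))
  from AE_distrD[OF T(1) this] Suc AE_P_good show ?case
  proof eventually_elim
    case (elim z)
    obtain g y where z: "z = (g, y)" by (cases z)
    have y: "y \<in> Y" "good y" using elim z by auto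
    note ys = Y_space[OF y(1)]
    let ?h = "- e k"
    have h: "?h \<in> H" by (rule H.uminus_mem[OF e_mem])
    let ?A = "supp_hits C g y"
    let ?X = "\<lambda>l. \<psi>0 y * cnj (f (l - g) * \<psi>0 (act l y))"
    have A: "supp_hits C g (act ?h y) = ?A" using hits_L_act[OF ys h] by (simp add: supp_hits_def)
    have X: "\<psi>0 (act ?h y) * cnj (f (l - g) * \<psi>0 (act l (act ?h y))) = \<eta> l (e k) * ?X l"
      if "l \<in> ?A" for l
    proof -
      have lY: "act l y \<in> Y" using that by (simp add: supp_hits_def hits_L_def)
      have "act l (act ?h y) = act (- (l + e k - l)) (act l y)"
        using act_conj[OF ys, of l ?h] by (simp add: minus_add add.assoc diff_conv_add_uminus del: add_uminus_conv_diff)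
      then have "\<psi>0 (act l (act ?h y)) = \<xi> (l + e k - l) * \<psi>0 (act l y)"
        using \<psi>0_act_minus[OF conj_mem[OF e_mem] lY] by simp
      then show ?thesis using \<psi>0_act_minus[OF e_mem y(1)] by (simp add: \<eta>_def)
    qed
    have "avg F k (g, act ?h y) = u (g, y) * (\<Sum>l\<in>?A. t k l * (\<eta> l (e k) * ?X l))"
    proof -
      have "avg F k (g, act ?h y) = u (g, act ?h y) *
          (\<Sum>l\<in>?A. t k l * (\<psi>0 (act ?h y) * cnj (f (l - g) * \<psi>0 (act l (act ?h y)))))"
        using elim(1) by (simp only: z fst_conv snd_conv A)
      then show ?thesis by (simp only: u[OF h y(1)] X cong: sum.cong)
    qed
    moreover have "avg F k (g, y) = u (g, y) * (\<Sum>l\<in>?A. t k l * ?X l)" using elim(2) z by simp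
    ultimately have "avg F (Suc k) z
        = (u (g, y) * (\<Sum>l\<in>?A. t k l * ?X l) + u (g, y) * (\<Sum>l\<in>?A. t k l * (\<eta> l (e k) * ?X l))) / 2"
      by (simp add: z)
    also have "\<dots> = u (g, y) * (\<Sum>l\<in>?A. t (Suc k) l * ?X l)"
      by (simp add: t_def sum_distrib_left sum.distrib[symmetric] sum_divide_distrib algebra_simps add_divide_distrib)
    finally show ?case by (simp add: z)
  qed
qed

lemma avg_limit:
  assumes f: "f \<in> ind0 H \<xi>" and C: "compact C" "\<And>g. coset H g \<notin> coset H ` C \<Longrightarrow> f g = 0"
    and y: "good y" "y \<in> Y"
  shows "(\<lambda>k. \<Sum>l\<in>supp_hits C g y. t k l * (\<psi>0 y * cnj (f (l - g) * \<psi>0 (act l y))))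
    \<longlonglongrightarrow> cnj (f (- g)) * complex_of_real ((cmod (\<psi>0 y))\<^sup>2)"
proof -
  let ?X = "\<lambda>l. \<psi>0 y * cnj (f (l - g) * \<psi>0 (act l y))"
  have y0: "act 0 y = y" by (rule act_0[OF Y_space[OF y(2)]])
  have X0: "?X 0 = cnj (f (- g)) * complex_of_real ((cmod (\<psi>0 y))\<^sup>2)"
    by (simp add: y0 complex_norm_square del: of_real_power)
  have lim: "(\<lambda>k. \<Sum>l\<in>supp_hits C g y. t k l * ?X l)
      \<longlonglongrightarrow> (\<Sum>l\<in>supp_hits C g y. (if l = 0 then 1 else 0) * ?X l)"
  proof (intro tendsto_sum tendsto_mult tendsto_const)
    fix l assume "l \<in> supp_hits C g y"
    then have "l \<in> hits_L y" by (simp add: supp_hits_def)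
    then show "(\<lambda>k. t k l) \<longlonglongrightarrow> (if l = 0 then 1 else 0)"
      using t_tendsto_0[of l y] y(2) by (auto simp: t_0)
  qed
  have eq: "(\<Sum>l\<in>supp_hits C g y. (if l = 0 then 1 else 0) * ?X l) = ?X 0"
  proof (cases "0 \<in> supp_hits C g y")
    case True
    have "(\<Sum>l\<in>supp_hits C g y. (if l = 0 then 1 else 0) * ?X l)
        = (\<Sum>l\<in>supp_hits C g y. if l = 0 then ?X l else 0)"
      by (rule sum.cong) auto
    also have "\<dots> = ?X 0" using True finite_supp_hits[OF y(1) C(1)] by (simp add: sum.delta)
    finally show ?thesis .
  next
    case False
    \<comment> \<open>The identity is always a hit of \<open>y\<close>; if it is missing from the
      index set, then \<open>- g\<close> lies outside the support of \<open>f\<close>, and both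
      sides are 0.\<close>
    have "0 \<in> hits_L y" using y(2) y0 is_subgroupD(1)[OF L_subgroup] by (simp add: hits_L_def)
    then have "f (- g) = 0" using False C(2) by (simp add: supp_hits_def)
    moreover have "(\<Sum>l\<in>supp_hits C g y. (if l = 0 then 1 else 0) * ?X l) = 0"
      by (rule sum.neutral) (use False in auto)
    ultimately show ?thesis by simp
  qed
  show ?thesis using lim unfolding eq X0 .
qed

text \<open>The terms with \<open>l \<noteq> 0\<close> of \<open>S f\<close> do not contribute, because averaging over \<open>H\<close> multiplies
  them by products of factors \<open>(1 + \<eta> l h) / 2\<close>.\<close>

lemma integral_diagonal:
  assumes f: "f \<in> ind0 H \<xi>" and C: "compact C" "\<And>g. coset H g \<notin> coset H ` C \<Longrightarrow> f g = 0"
    and Fm: "F \<in> borel_measurable P" and K: "compact K"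
    and bound: "\<And>g y. y \<in> Y \<Longrightarrow> cmod (F (g, y)) \<le> b * indicator K g"
    and F: "AE z in P. F z = u z * (\<psi>0 (snd z) * cnj (S f (act (fst z) (snd z))))"
    and u: "\<And>g h y. h \<in> H \<Longrightarrow> y \<in> Y \<Longrightarrow> u (g, act h y) = u (g, y)"
    and Gm: "G \<in> borel_measurable P"
    and G: "AE z in P. G z = u z * (cnj (f (- fst z)) * complex_of_real ((cmod (\<psi>0 (snd z)))\<^sup>2))"
  shows "integral\<^sup>L P F = integral\<^sup>L P G"
proof -
  have [measurable]: "K \<in> sets borel" using K by (simp add: compact_imp_closed)
  have "(\<lambda>k. integral\<^sup>L P (avg F k)) \<longlonglongrightarrow> integral\<^sup>L P G"
  proof (rule integral_dominated_convergence)
    show "G \<in> borel_measurable P" "\<And>k. avg F k \<in> borel_measurable P"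
      using Gm avg_measurable[OF Fm] by auto
    have "admissible (\<lambda>z. complex_of_real (b * indicator K (fst z)))"
      by (rule admissibleI[of _ "\<bar>b\<bar>" K]) (use K in \<open>auto simp: indicator_def\<close>)
    from admissible_integrable[OF this] show "integrable P (\<lambda>z. b * indicator K (fst z))"
      by (simp only: complex_of_real_integrable_eq)
    show "AE z in P. norm (avg F k z) \<le> b * indicator K (fst z)" for k
      using avg_bound[of F "\<lambda>g. b * indicator K g", OF bound] by (intro AE_I2) (auto simp: space_P)
    \<comment> \<open>There are countably many steps, so one null set serves for all of
      them.\<close>
    have "AE z in P. \<forall>k. avg F k z = u z * (\<Sum>l\<in>supp_hits C (fst z) (snd z).
        t k l * (\<psi>0 (snd z) * cnj (f (l - fst z) * \<psi>0 (act l (snd z)))))"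
      unfolding AE_all_countable using avg_AE[OF f C F u] by blast
    then show "AE z in P. (\<lambda>k. avg F k z) \<longlonglongrightarrow> G z"
      using G AE_P_good
    proof eventually_elim
      case (elim z)
      then have "good (snd z)" "snd z \<in> Y" by auto
      from tendsto_mult[OF tendsto_const avg_limit[OF f C this, of "fst z"], of "u z"] elim
      show ?case by simp
    qed
  qed
  then have "(\<lambda>k. integral\<^sup>L P F) \<longlonglongrightarrow> integral\<^sup>L P G"
    by (simp only: avg_integral[OF Fm K bound])
  then show ?thesis by (simp add: LIMSEQ_const_iff)
qed

text \<open>Measurability is not evident from a sum over varying hitting sets; it comes from
  integrability in the transverse formula with the constant test factor 1.\<close>

lemma S_measurable:
  assumes f: "f \<in> ind0 H \<xi>"
  shows "S f \<in> borel_measurable (completion \<mu>)"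
proof -
  obtain C B where C: "compact C" "\<And>g. coset H g \<notin> coset H ` C \<Longrightarrow> f g = 0"
    by (rule ind0E[OF H.subgroup character f]) blast
  obtain \<rho> K B where \<rho>: "\<rho> \<in> borel_measurable borel" "compact K" "\<And>g. g \<notin> K \<Longrightarrow> \<rho> g = 0"
      "\<And>g. 0 \<le> \<rho> g" "\<And>g. \<rho> g \<le> B"
      "\<And>g. coset H g \<in> coset H ` C \<Longrightarrow> (\<integral>\<^sup>+h. ennreal (\<rho> (h + g)) \<partial>mH) = 1"
    by (rule H.coset_partition_function[OF C(1)]) blast
  have "integrable (completion \<mu>) (\<lambda>x. S f x * 1)"
    by (rule S_transverse(2)[OF f C(2) \<rho>, where \<phi>="\<lambda>_. 1" and B'=1]) auto
  then show ?thesis by simp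
qed

section \<open>The inner product formula\<close>

lemma integral_\<psi>0: "(LINT y|\<sigma>. (cmod (\<psi>0 y))\<^sup>2) = measure \<sigma> Y"
proof -
  have "(LINT y|\<sigma>. (cmod (\<psi>0 y))\<^sup>2) = (LINT y:Y0|\<sigma>. (cmod (\<psi> y))\<^sup>2)"
    unfolding set_lebesgue_integral_def
    by (rule Bochner_Integration.integral_cong) (auto simp: \<psi>0_def indicator_def)
  then show ?thesis using normalized by simp
qed

text \<open>Inversion invariance of \<open>mG\<close>, which rests on unimodularity, removes the
  minus signs; Weil's formula with the weight \<open>\<rho>\<close> then gives the integral over the
  coset space.\<close>

lemma quotient_integral:
  assumes f: "f1 \<in> ind0 H \<xi>" "f2 \<in> ind0 H \<xi>"
    and C: "\<And>g. coset H g \<notin> coset H ` C \<Longrightarrow> f1 g = 0"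
    and \<rho>: "\<rho> \<in> borel_measurable borel" "compact K" "\<And>g. g \<notin> K \<Longrightarrow> \<rho> g = 0"
      "\<And>g. 0 \<le> \<rho> g" "\<And>g. \<rho> g \<le> B"
      "\<And>g. coset H g \<in> coset H ` C \<Longrightarrow> (\<integral>\<^sup>+h. ennreal (\<rho> (h + g)) \<partial>mH) = 1"
  shows "(LINT g|mG. complex_of_real (\<rho> (- g)) * (f1 (- g) * cnj (f2 (- g)))) = ind0_inner mHG f1 f2"
proof -
  let ?w = "\<lambda>g. f1 g * cnj (f2 g)"
  have c: "continuous_on UNIV f1" "continuous_on UNIV f2" using f by (auto simp: ind0_def)
  then have [measurable]: "f1 \<in> borel_measurable borel" "f2 \<in> borel_measurable borel"
    by (auto intro: borel_measurable_continuous_onI)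
  note [measurable] = \<rho>(1)
  obtain B1 where B1: "B1 \<ge> 0" "\<And>g. cmod (f1 g) \<le> B1"
    by (rule ind0E[OF H.subgroup character f(1)]) blast
  obtain B2 where B2: "B2 \<ge> 0" "\<And>g. cmod (f2 g) \<le> B2"
    by (rule ind0E[OF H.subgroup character f(2)]) blast
  have "B \<ge> 0" using \<rho>(4,5)[of 0] by linarith
  have m: "(\<lambda>g. complex_of_real (\<rho> g) * ?w g) \<in> borel_measurable borel" by measurable
  have int: "integrable mG (\<lambda>g. complex_of_real (\<rho> g) * ?w g)"
  proof (rule integrableI_bounded_set[of K _ _ "B * (B1 * B2)"])
    show "(\<lambda>g. complex_of_real (\<rho> g) * ?w g) \<in> borel_measurable mG"
      using m by (rule G.borel_measurable_m)
    show "AE g in mG. g \<in> K \<longrightarrow> norm (complex_of_real (\<rho> g) * ?w g) \<le> B * (B1 * B2)"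
      using B1 B2 \<rho>(4,5) \<open>B \<ge> 0\<close> by (intro AE_I2) (auto simp: norm_mult intro!: mult_mono)
  qed (use \<rho>(2,3) G.compact_finite in \<open>auto simp: sets_mG compact_imp_closed\<close>)
  have "(LINT g|mG. complex_of_real (\<rho> (- g)) * ?w (- g)) = (LINT g|mG. complex_of_real (\<rho> g) * ?w g)"
    using G.integral_uminus[OF refl m] by simp
  also have "\<dots> = (LINT c|mHG. ?w (rep c))"
  proof (rule quotient_measure_integral[symmetric])
    show "haar_subgroup H mH" "haar_measure UNIV mG" by unfold_locales (rule G.haar)
    show "quotient_measure H mG mH mHG" by (rule quotient)
    show "?w (h + g) = ?w g" if "h \<in> H" for h g
      using f that \<xi>(5)[OF that] by (simp add: ind0_def algebra_simps)
    show "(\<integral>\<^sup>+h. ennreal (\<rho> (h + g)) \<partial>mH) = 1" if "?w g \<noteq> 0" for g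
      using that C \<rho>(6) by auto
    show "continuous_on UNIV ?w" using c by (intro continuous_intros)
  qed (use \<rho> int in auto)
  finally show ?thesis by (simp add: ind0_inner_def)
qed

lemma S_inner:
  assumes f: "f1 \<in> ind0 H \<xi>" "f2 \<in> ind0 H \<xi>"
  shows "(LINT x|completion \<mu>. S f1 x * cnj (S f2 x)) = complex_of_real (measure \<sigma> Y) * ind0_inner mHG f1 f2"
proof -
  obtain C1 B1 where C1: "compact C1" "\<And>g. coset H g \<notin> coset H ` C1 \<Longrightarrow> f1 g = 0"
    and B1: "B1 \<ge> 0" "\<And>g. cmod (f1 g) \<le> B1"
    by (rule ind0E[OF H.subgroup character f(1)]) blast
  obtain C2 B2 where C2: "compact C2" "\<And>g. coset H g \<notin> coset H ` C2 \<Longrightarrow> f2 g = 0"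
    and B2: "B2 \<ge> 0" "\<And>g. cmod (f2 g) \<le> B2"
    by (rule ind0E[OF H.subgroup character f(2)]) blast
  define C where "C = C1 \<union> C2"
  have C: "compact C" "\<And>g. coset H g \<notin> coset H ` C \<Longrightarrow> f1 g = 0" "\<And>g. coset H g \<notin> coset H ` C \<Longrightarrow> f2 g = 0"
    using C1 C2 by (auto simp: C_def image_Un)
  obtain \<rho> K B where \<rho>: "\<rho> \<in> borel_measurable borel" "compact K" "\<And>g. g \<notin> K \<Longrightarrow> \<rho> g = 0"
      "\<And>g. 0 \<le> \<rho> g" "\<And>g. \<rho> g \<le> B"
      "\<And>g. coset H g \<in> coset H ` C \<Longrightarrow> (\<integral>\<^sup>+h. ennreal (\<rho> (h + g)) \<partial>mH) = 1"
    by (rule H.coset_partition_function[OF C(1)]) blast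
  have "B \<ge> 0" using \<rho>(4,5)[of 0] by linarith
  have cf: "continuous_on UNIV f1" "continuous_on UNIV f2" using f by (auto simp: ind0_def)
  then have [measurable]: "f1 \<in> borel_measurable borel" "f2 \<in> borel_measurable borel"
    by (auto intro: borel_measurable_continuous_onI)
  note [measurable] = \<rho>(1)
  \<comment> \<open>\<open>S f2\<close> and \<open>N C\<close> are measurable only for the
    completion, while a test factor in \<open>S_transverse\<close> has to be Borel; hence the
    versions \<open>s\<close> and \<open>\<nu>\<close>.\<close>
  obtain s where [measurable]: "s \<in> borel_measurable \<mu>" and s: "AE x in \<mu>. S f2 x = s x"
    using completion_ex_borel_measurable_complex[OF S_measurable[OF f(2)]] by blast
  obtain \<nu> where [measurable]: "\<nu> \<in> borel_measurable \<mu>" and \<nu>: "AE x in \<mu>. N C x = \<nu> x"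
    using completion_ex_borel_measurable_real[OF N_square_integrable(1)[OF C(1)]] by blast
  define c where "c = B2 * b\<psi>"
  have "c \<ge> 0" using B2 b\<psi> by (simp add: c_def)
  \<comment> \<open>The cutoff by \<open>N C\<close> makes the integrand bounded and, by \<open>N_act_act\<close>, is \<open>H\<close>-invariant on the
    side of \<open>Y\<close>, so that it survives the averaging.\<close>
  define \<phi> where "\<phi> n x = (if \<nu> x \<le> real n \<and> cmod (s x) \<le> c * real n then cnj (s x) else 0)" for n x
  have [measurable]: "\<phi> n \<in> borel_measurable \<mu>" for n unfolding \<phi>_def by measurable
  have \<phi>_bound: "cmod (\<phi> n x) \<le> c * real n" for n x using \<open>c \<ge> 0\<close> by (simp add: \<phi>_def)
  \<comment> \<open>At almost every point the second condition in \<open>\<phi>\<close> follows from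
    the first by \<open>S_bound\<close>. It is there because \<open>S_transverse\<close> requires a
    bound at every point.\<close>
  have \<phi>_AE: "AE x in \<mu>. good x \<and> N C x = \<nu> x \<and> (\<forall>n. \<phi> n x = (if N C x \<le> real n then cnj (S f2 x) else 0))"
    using s \<nu> AE_good
  proof eventually_elim
    case (elim x)
    have "cmod (S f2 x) \<le> c * N C x"
      unfolding c_def by (rule S_bound[OF f(2) elim(3) C(1,3) B2(2)])
    then have "cmod (s x) \<le> c * real n" if "\<nu> x \<le> real n" for n
      using elim that \<open>c \<ge> 0\<close> by (metis mult_left_mono order_trans)
    then show ?case using elim by (auto simp: \<phi>_def)
  qed
  define F where "F n = (\<lambda>(g, y). complex_of_real (\<rho> (- g)) * (f1 (- g) * \<psi>0 y) * \<phi> n (act g y))" for n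
  \<comment> \<open>The diagonal term with truncation, written with \<open>\<nu>\<close> so that it
    is Borel.\<close>
  define G where "G n = (\<lambda>z. complex_of_real (\<rho> (- fst z)) * f1 (- fst z) * (if \<nu> (act (fst z) (snd z)) \<le> real n then 1 else 0)
      * (cnj (f2 (- fst z)) * complex_of_real ((cmod (\<psi>0 (snd z)))\<^sup>2)))" for n
  define G' where "G' z = complex_of_real (\<rho> (- fst z)) * f1 (- fst z)
      * (cnj (f2 (- fst z)) * complex_of_real ((cmod (\<psi>0 (snd z)))\<^sup>2))" for z
  have [measurable]: "G n \<in> borel_measurable P" for n unfolding G_def by measurable
  have [measurable]: "G' \<in> borel_measurable P" unfolding G'_def by measurable
  note tr = S_transverse[OF f(1) C(2) \<rho>, where \<phi>="\<phi> n" and B'="c * real n" for n, folded F_def]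
  have Fm [measurable]: "F n \<in> borel_measurable P" for n
    unfolding F_def case_prod_beta by measurable
  have cK: "compact (uminus ` K)"
    by (rule compact_continuous_image[OF _ \<rho>(2)]) (intro continuous_intros)
  have \<rho>_bound: "\<rho> (- g) \<le> B * indicator (uminus ` K) g" for g
    using \<rho>(3)[of "- g"] \<rho>(5)[of "- g"] by (force simp: indicator_def image_iff)
  have FG: "integral\<^sup>L P (F n) = integral\<^sup>L P (G n)" for n
  \<comment> \<open>The factor \<open>u\<close> uses \<open>N C\<close> rather than
    \<open>\<nu>\<close>: it must be invariant under \<open>H\<close> at every point of
    \<open>Y\<close>, and \<open>\<nu>\<close> agrees with \<open>N C\<close> only almost
    everywhere.\<close>
  proof (rule integral_diagonal[OF f(2) C(1,3) Fm cK, where b="B * (B1 * b\<psi>) * (c * real n)"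
        and u="\<lambda>(g, y). complex_of_real (\<rho> (- g)) * f1 (- g) * (if N C (act g y) \<le> real n then 1 else 0)"])
    show "cmod (F n (g, y)) \<le> B * (B1 * b\<psi>) * (c * real n) * indicator (uminus ` K) g" for g y
    proof -
      have "cmod (F n (g, y)) = \<rho> (- g) * (cmod (f1 (- g)) * cmod (\<psi>0 y)) * cmod (\<phi> n (act g y))"
        by (simp add: F_def norm_mult \<rho>(4))
      also have "\<dots> \<le> (B * indicator (uminus ` K) g) * (B1 * b\<psi>) * (c * real n)"
        using \<rho>_bound \<rho>(4) B1 b\<psi> \<phi>_bound \<open>B \<ge> 0\<close> by (intro mult_mono mult_nonneg_nonneg) auto
      finally show ?thesis by (simp add: ac_simps)
    qed
    show "AE z in P. F n z = (case z of (g, y) \<Rightarrow> complex_of_real (\<rho> (- g)) * f1 (- g) * (if N C (act g y) \<le> real n then 1 else 0)) *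
        (\<psi>0 (snd z) * cnj (S f2 (act (fst z) (snd z))))"
      using AE_act_P[OF \<phi>_AE] by eventually_elim (auto simp: F_def case_prod_beta)
    show "AE z in P. G n z = (case z of (g, y) \<Rightarrow> complex_of_real (\<rho> (- g)) * f1 (- g) * (if N C (act g y) \<le> real n then 1 else 0)) *
        (cnj (f2 (- fst z)) * complex_of_real ((cmod (\<psi>0 (snd z)))\<^sup>2))"
      using AE_act_P[OF \<phi>_AE] by eventually_elim (auto simp: G_def case_prod_beta)
  qed (auto simp: N_act_act Y_space)
  \<comment> \<open>The truncation is removed on \<open>X\<close>. Both transforms are bounded by
    multiples of \<open>N C x\<close>, whose square is integrable.\<close>
  have "(\<lambda>n. LINT x|completion \<mu>. S f1 x * \<phi> n x) \<longlonglongrightarrow> (LINT x|completion \<mu>. S f1 x * cnj (S f2 x))"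
  proof (rule integral_dominated_convergence)
    show "(\<lambda>x. S f1 x * cnj (S f2 x)) \<in> borel_measurable (completion \<mu>)"
      using S_measurable[OF f(1)] S_measurable[OF f(2)] by measurable
    show "(\<lambda>x. S f1 x * \<phi> n x) \<in> borel_measurable (completion \<mu>)" for n
      by (rule borel_measurable_integrable[OF tr(2)]) (use \<phi>_bound in auto)
    show "integrable (completion \<mu>) (\<lambda>x. B1 * b\<psi> * c * (N C x)\<^sup>2)"
      using N_square_integrable(2)[OF C(1)] by simp
    show "AE x in completion \<mu>. norm (S f1 x * \<phi> n x) \<le> B1 * b\<psi> * c * (N C x)\<^sup>2" for n
      using AE_completion[OF \<phi>_AE]
    proof eventually_elim
      case (elim x)
      then have x: "good x" by simp
      have "cmod (\<phi> n x) \<le> cmod (S f2 x)" using elim by simp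
      also have "\<dots> \<le> c * N C x" unfolding c_def by (rule S_bound[OF f(2) x C(1,3) B2(2)])
      finally have "cmod (\<phi> n x) \<le> c * N C x" .
      then have "cmod (S f1 x) * cmod (\<phi> n x) \<le> (B1 * b\<psi> * N C x) * (c * N C x)"
        using S_bound[OF f(1) x C(1,2) B1(2)] B1(1) b\<psi>(1) by (intro mult_mono) (auto simp: N_def)
      then show ?case by (simp add: norm_mult power2_eq_square ac_simps)
    qed
    show "AE x in completion \<mu>. (\<lambda>n. S f1 x * \<phi> n x) \<longlonglongrightarrow> S f1 x * cnj (S f2 x)"
      using AE_completion[OF \<phi>_AE]
    proof eventually_elim
      case (elim x)
      have "eventually (\<lambda>n. S f1 x * \<phi> n x = S f1 x * cnj (S f2 x)) sequentially"
        using eventually_ge_at_top[of "nat \<lceil>N C x\<rceil>"] by eventually_elim (use elim in \<open>auto simp: nat_ceiling_le_eq\<close>)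
      then show ?case by (rule tendsto_eventually)
    qed
  qed
  moreover have "(LINT x|completion \<mu>. S f1 x * \<phi> n x) = integral\<^sup>L P (G n)" for n
    unfolding FG[symmetric] by (rule tr(3)) (use \<phi>_bound in auto)
  moreover have "admissible G'"
  proof (rule admissibleI[OF _ _ cK, of _ "B * B1 * (B2 * b\<psi>\<^sup>2)"])
    show "G' (g, y) = 0" if "g \<notin> uminus ` K" for g y
      using \<rho>(3)[of "- g"] that by (force simp: G'_def image_iff)
    show "cmod (G' (g, y)) \<le> B * B1 * (B2 * b\<psi>\<^sup>2)" for g y
      using \<rho>(4,5)[of "- g"] B1 B2 b\<psi> \<open>B \<ge> 0\<close>
      by (auto simp: G'_def norm_mult norm_power intro!: mult_mono power_mono)
  qed measurable
  then have G'_int: "integrable P G'" by (rule admissible_integrable)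
  \<comment> \<open>On the diagonal the truncation is removed by domination with \<open>G'\<close>,
    which is already bounded with compact support in \<open>G\<close>.\<close>
  have "(\<lambda>n. integral\<^sup>L P (G n)) \<longlonglongrightarrow> integral\<^sup>L P G'"
  proof (rule integral_dominated_convergence[OF _ _ integrable_norm[OF G'_int]])
    show "AE z in P. norm (G n z) \<le> norm (G' z)" for n
      by (rule AE_I2) (auto simp: G_def G'_def norm_mult)
    show "AE z in P. (\<lambda>n. G n z) \<longlonglongrightarrow> G' z"
    proof (rule AE_I2)
      fix z
      have "eventually (\<lambda>n. G n z = G' z) sequentially"
        using eventually_ge_at_top[of "nat \<lceil>\<nu> (act (fst z) (snd z))\<rceil>"]
        by eventually_elim (auto simp: G_def G'_def nat_ceiling_le_eq)
      then show "(\<lambda>n. G n z) \<longlonglongrightarrow> G' z" by (rule tendsto_eventually)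
    qed
  qed measurable
  ultimately have "(LINT x|completion \<mu>. S f1 x * cnj (S f2 x)) = integral\<^sup>L P G'"
    by (simp add: LIMSEQ_unique)
  also have "\<dots> = (LINT g|mG. LINT y|\<sigma>. G' (g, y))" using P.integral_fst'[OF G'_int] by simp
  also have "\<dots> = (LINT g|mG. complex_of_real (\<rho> (- g)) * (f1 (- g) * cnj (f2 (- g))) * complex_of_real (measure \<sigma> Y))"
  proof (rule Bochner_Integration.integral_cong)
    fix g
    have "(LINT y|\<sigma>. G' (g, y)) = (LINT y|\<sigma>. complex_of_real (\<rho> (- g)) * (f1 (- g) * cnj (f2 (- g))) * complex_of_real ((cmod (\<psi>0 y))\<^sup>2))"
      by (simp add: G'_def mult.assoc del: of_real_power)
    also have "\<dots> = complex_of_real (\<rho> (- g)) * (f1 (- g) * cnj (f2 (- g))) * complex_of_real (LINT y|\<sigma>. (cmod (\<psi>0 y))\<^sup>2)"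
      by (simp only: integral_mult_right_zero integral_complex_of_real)
    finally show "(LINT y|\<sigma>. G' (g, y)) = complex_of_real (\<rho> (- g)) * (f1 (- g) * cnj (f2 (- g))) * complex_of_real (measure \<sigma> Y)"
      by (simp only: integral_\<psi>0)
  qed simp
  also have "\<dots> = ind0_inner mHG f1 f2 * complex_of_real (measure \<sigma> Y)"
  proof -
    have "(LINT g|mG. complex_of_real (\<rho> (- g)) * (f1 (- g) * cnj (f2 (- g)))) = ind0_inner mHG f1 f2"
      by (rule quotient_integral[OF f C(2) \<rho>])
    then show ?thesis by (simp only: integral_mult_left_zero)
  qed
  finally show ?thesis by (simp add: mult.commute)
qed

lemma unitary_intertwiner_exists:
  "\<exists>T. unitary_intertwiner act \<mu> H mHG \<xi> T \<and>
     (\<forall>f\<in>ind0 H \<xi>. AE x in \<mu>. T (\<lambda>_. f) x = siegel_radon_norm act H Y \<sigma> \<psi> f x)"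
proof -
  \<comment> \<open>Both arguments of the inner product carry this factor, so \<open>a * a\<close>
    cancels the total mass in \<open>S_inner\<close>.\<close>
  define a where "a = measure \<sigma> Y powr (- 1 / 2)"
  have "measure \<sigma> Y > 0" using \<sigma>_nonzero by (simp add: order_less_le)
  then have a: "a * a * measure \<sigma> Y = 1"
    by (simp add: a_def powr_add[symmetric] powr_minus_divide)
  \<comment> \<open>\<open>L2\<close> consists of Borel functions, so each \<open>S f\<close> is
    replaced by a Borel version; the extension lemma tolerates this because its hypotheses hold only
    almost everywhere.\<close>
  have "\<exists>s. \<forall>f\<in>ind0 H \<xi>. s f \<in> borel_measurable \<mu> \<and> (AE x in \<mu>. S f x = s f x)"
    using completion_ex_borel_measurable_complex[OF S_measurable] by (intro bchoice) blast
  then obtain s where sm: "\<And>f. f \<in> ind0 H \<xi> \<Longrightarrow> s f \<in> borel_measurable \<mu>"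
    and s: "\<And>f. f \<in> ind0 H \<xi> \<Longrightarrow> AE x in \<mu>. S f x = s f x" by blast
  let ?S = "\<lambda>f x. complex_of_real a * s f x"
  have s_L2: "s f \<in> L2 \<mu>" if f: "f \<in> ind0 H \<xi>" for f
  proof -
    obtain C B where C: "compact C" "\<And>g. coset H g \<notin> coset H ` C \<Longrightarrow> f g = 0"
      and B: "B \<ge> 0" "\<And>g. cmod (f g) \<le> B"
      by (rule ind0E[OF H.subgroup character f]) blast
    note [measurable] = sm[OF f]
    have "integrable (completion \<mu>) (\<lambda>x. (cmod (s f x))\<^sup>2)"
    proof (rule Bochner_Integration.integrable_bound)
      show "integrable (completion \<mu>) (\<lambda>x. (B * b\<psi>)\<^sup>2 * (N C x)\<^sup>2)"
        using N_square_integrable(2)[OF C(1)] by simp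
      show "(\<lambda>x. (cmod (s f x))\<^sup>2) \<in> borel_measurable (completion \<mu>)"
        by (rule measurable_completion) measurable
      have "AE x in \<mu>. norm ((cmod (s f x))\<^sup>2) \<le> norm ((B * b\<psi>)\<^sup>2 * (N C x)\<^sup>2)"
        using s[OF f] AE_good
      proof eventually_elim
        case (elim x)
        have "cmod (s f x) \<le> B * b\<psi> * N C x" using S_bound[OF f elim(2) C B(2)] elim by simp
        then have "(cmod (s f x))\<^sup>2 \<le> (B * b\<psi> * N C x)\<^sup>2" by (intro power_mono) auto
        then show ?case by (simp add: power_mult_distrib)
      qed
      then show "AE x in completion \<mu>. norm ((cmod (s f x))\<^sup>2) \<le> norm ((B * b\<psi>)\<^sup>2 * (N C x)\<^sup>2)"
        by (rule AE_completion)
    qed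
    then have "integrable \<mu> (\<lambda>x. (cmod (s f x))\<^sup>2)" by (subst (asm) integrable_completion) auto
    then show ?thesis using sm[OF f] by (simp add: L2_def)
  qed
  have act_distr: "distr \<mu> \<mu> (act g) = \<mu>" for g
    using invariant by (simp add: invariant_probability_def)
  have "\<exists>T. unitary_intertwiner act \<mu> H mHG \<xi> T \<and> (\<forall>f\<in>ind0 H \<xi>. AE x in \<mu>. T (\<lambda>_. f) x = ?S f x)"
  proof (rule unitary_intertwiner_extension)
    show "prob_space \<mu>" by (rule prob_space_axioms)
    show act_m: "act g \<in> measurable \<mu> \<mu>" for g by measurable
    show "distr \<mu> \<mu> (act g) = \<mu>" for g by (rule act_distr)
    show "?S f \<in> L2 \<mu>" if "f \<in> ind0 H \<xi>" for f by (rule L2_cmult[OF s_L2[OF that]])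
    show "(\<lambda>g. a * f1 g + b * f2 g) \<in> ind0 H \<xi>" if "f1 \<in> ind0 H \<xi>" "f2 \<in> ind0 H \<xi>" for f1 f2 a b
      by (rule ind0_lincomb[OF that])
    show "(\<lambda>x. f (x + g)) \<in> ind0 H \<xi>" if "f \<in> ind0 H \<xi>" for f g
      by (rule ind0_translate[OF H.subgroup that])
    show "AE x in \<mu>. ?S (\<lambda>g. c * f1 g + b * f2 g) x = c * ?S f1 x + b * ?S f2 x"
      if f: "f1 \<in> ind0 H \<xi>" "f2 \<in> ind0 H \<xi>" for f1 f2 c b
      using AE_S_lincomb[OF f, of c b] s[OF ind0_lincomb[OF f, of c b]] s[OF f(1)] s[OF f(2)]
    proof eventually_elim
      case (elim x)
      then have "s (\<lambda>g. c * f1 g + b * f2 g) x = c * s f1 x + b * s f2 x" by simp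
      then show ?case by (simp add: algebra_simps)
    qed
    show "L2_inner \<mu> (?S f1) (?S f2) = ind0_inner mHG f1 f2"
      if f: "f1 \<in> ind0 H \<xi>" "f2 \<in> ind0 H \<xi>" for f1 f2
    proof -
      note [measurable] = sm[OF f(1)] sm[OF f(2)]
      have "L2_inner \<mu> (?S f1) (?S f2) = (LINT x|\<mu>. complex_of_real (a * a) * (s f1 x * cnj (s f2 x)))"
        unfolding L2_inner_def by (rule Bochner_Integration.integral_cong) (auto simp: ac_simps)
      also have "\<dots> = complex_of_real (a * a) * (LINT x|\<mu>. s f1 x * cnj (s f2 x))"
        by (rule integral_mult_right_zero)
      also have "(LINT x|\<mu>. s f1 x * cnj (s f2 x)) = (LINT x|completion \<mu>. s f1 x * cnj (s f2 x))"
        by (rule integral_completion[symmetric]) measurable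
      also have "\<dots> = (LINT x|completion \<mu>. S f1 x * cnj (S f2 x))"
      proof (rule integral_cong_AE)
        show "(\<lambda>x. s f1 x * cnj (s f2 x)) \<in> borel_measurable (completion \<mu>)"
          by (rule measurable_completion) measurable
        show "(\<lambda>x. S f1 x * cnj (S f2 x)) \<in> borel_measurable (completion \<mu>)"
          using S_measurable[OF f(1)] S_measurable[OF f(2)] by measurable
        show "AE x in completion \<mu>. s f1 x * cnj (s f2 x) = S f1 x * cnj (S f2 x)"
          using AE_completion[OF s[OF f(1)]] AE_completion[OF s[OF f(2)]] by eventually_elim simp
      qed
      also have "\<dots> = complex_of_real (measure \<sigma> Y) * ind0_inner mHG f1 f2" by (rule S_inner[OF f])
      also have "complex_of_real (a * a) * (complex_of_real (measure \<sigma> Y) * ind0_inner mHG f1 f2)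
          = complex_of_real (a * a * measure \<sigma> Y) * ind0_inner mHG f1 f2" by (simp add: mult.assoc)
      finally show ?thesis using a by simp
    qed
    show "AE x in \<mu>. ?S (\<lambda>x. f (x + g)) x = ?S f (act (- g) x)" if f: "f \<in> ind0 H \<xi>" for f g
    proof -
      have "AE x in distr \<mu> \<mu> (act (- g)). S f x = s f x" using s[OF f] by (simp only: act_distr)
      then have "AE x in \<mu>. S f (act (- g) x) = s f (act (- g) x)" by (rule AE_distrD[OF act_m])
      then show ?thesis using AE_S_translate[OF f, of g] s[OF ind0_translate[OF H.subgroup f, of g]]
        by eventually_elim simp
    qed
  qed
  then obtain T where T: "unitary_intertwiner act \<mu> H mHG \<xi> T" "\<And>f. f \<in> ind0 H \<xi> \<Longrightarrow> AE x in \<mu>. T (\<lambda>_. f) x = ?S f x"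
    by blast
  have "AE x in \<mu>. T (\<lambda>_. f) x = siegel_radon_norm act H Y \<sigma> \<psi> f x" if f: "f \<in> ind0 H \<xi>" for f
    using T(2)[OF f] s[OF f] by eventually_elim (simp add: siegel_radon_norm_def a_def S_def)
  then show ?thesis using T(1) by blast
qed

end

theorem theorem8p3:
  fixes H L :: "'g::lcsc_group_add set"
    and mG mH :: "'g measure" and mHG :: "'g set measure"
    and act :: "'g \<Rightarrow> 'x \<Rightarrow> 'x" and \<mu> \<sigma> :: "'x measure" and Y Y0 :: "'x set"
    and \<xi> :: "'g \<Rightarrow> complex" and \<psi> :: "'x \<Rightarrow> complex"
  assumes "unimodular (UNIV :: 'g set)" and "haar_measure UNIV mG"
    and "closed H" and "unimodular H" and "haar_measure H mH"
    and "quotient_measure H mG mH mHG"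
    and "closed L" and "internal_semidirect H L"
    and "amenable H mH"
    and "borel_G_space act \<mu>" and "invariant_probability act \<mu>"
    and "cross_section act \<mu> H Y" and "square_integrable_system act \<mu> H Y"
    and "transverse_measure act \<mu> H Y mG mH \<sigma>"
    and "unitary_character H \<xi>" and "eigenfunction act \<sigma> H \<xi> Y0 \<psi>"
    and normalized: "(LINT y:Y0|\<sigma>. (cmod (\<psi> y))\<^sup>2) = measure \<sigma> Y"
    and "character_stabilizer H L \<xi> \<inter> return_set act H L Y = {0}"
  shows "\<exists>T. unitary_intertwiner act \<mu> H mHG \<xi> T \<and>
           (\<forall>f\<in>ind0 H \<xi>. AE x in \<mu>. T (\<lambda>_. f) x = siegel_radon_norm act H Y \<sigma> \<psi> f x)"
proof -
  have "is_subgroup H" using assms by (auto simp: internal_semidirect_def is_normal_subgroup_def)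
  moreover have "is_subgroup (UNIV :: 'g set)" by (simp add: is_subgroup_def)
  \<comment> \<open>If \<open>\<sigma>\<close> had no mass, every almost everywhere statement would
    hold, including the vanishing of \<open>\<psi>\<close> that \<open>eigenfunction\<close>
    excludes.\<close>
  moreover have "measure \<sigma> Y \<noteq> 0"
  proof
    assume "measure \<sigma> Y = 0"
    moreover have \<sigma>: "finite_measure \<sigma>" "space \<sigma> = Y" using assms by (auto simp: transverse_measure_def)
    ultimately have "emeasure \<sigma> (space \<sigma>) = 0"
      using finite_measure.emeasure_eq_measure[OF \<sigma>(1)] by simp
    then have "AE y in \<sigma>. Q y" for Q by (intro AE_I'[of "space \<sigma>"]) (auto simp: null_sets_def)
    then show False using assms by (simp add: eigenfunction_def)
  qed
  ultimately interpret twisted_system H mH mG act \<mu> Y \<sigma> L mHG \<xi> Y0 \<psi>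
    using assms by unfold_locales auto
  show ?thesis by (rule unitary_intertwiner_exists)
qed

end
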